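(* Assume (H1). Let $\psi_1,\psi_2:\mathbb R^N\times\mathbb R^d\times U\to\mathbb R$ satisfy (H2) and, for $i=1,2$, let $$H_i(x,p,A)=\sup_{a\in U}\{\langle-p,b(x,a)\rangle-\tfrac12\mathrm{tr}(\sigma\sigma^*(x,a)A)-\psi_i(x,p\sigma(x,a),a)\},\quad(x,p,A)\in\mathbb R^N\times\mathbb R^N\times\mathcal S^N.$$ Let $\lambda>0$. Suppose that $u\in USC(\overline\theta)$ is a viscosity subsolution on $\overline\theta$ of $\lambda V(x)+H_1(x,DV(x),D^2V(x))=0$, $x\in\overline\theta$, and $v\in LSC(\overline\theta)$ is a viscosity supersolution on $\overline\theta$ of $\lambda V(x)+H_2(x,DV(x),D^2V(x))=0$, $x\in\overline\theta$. Then, for every $x\in\overline\theta$, $$\lambda(u(x)-v(x))\le\sup_{a\in U,\ y\in\overline\theta,\ z\in\mathbb R^d}|\psi_1(y,z,a)-\psi_2(y,z,a)|.$$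
   Context: $(U,d)$ is a compact metric space. $\mathcal S^N$ is the set of symmetric $N\times N$ matrices; $p\sigma$ denotes the product of the row vector $p$ with the matrix $\sigma$. $USC(\overline\theta)$, $LSC(\overline\theta)$ denote the real-valued upper, lower semicontinuous functions on $\overline\theta$. (H1): $b:\mathbb R^N\times U\to\mathbb R^N$ and $\sigma:\mathbb R^N\times U\to\mathbb R^{N\times d}$ are uniformly continuous, and there is $c>0$ such that $|b(x,a)-b(x',a)|+|\sigma(x,a)-\sigma(x',a)|\le c|x-x'|$ and $|b(x,a)|+|\sigma(x,a)|\le c(1+|x|)$ for all $x,x'\in\mathbb R^N$, $a\in U$. (H2) for $\psi$: $\psi:\mathbb R^N\times\mathbb R^d\times U\to\mathbb R$ is continuous and there are nonnegative constants $K_x,K_z,M$ such that $|\psi(x,z,a)-\psi(x',z',a)|\le K_x|x-x'|+K_z|z-z'|$ and $|\psi(x,0,a)|\le M$ for all $x,x'\in\mathbb R^N$, $z,z'\in\mathbb R^d$, $a\in U$. $\theta\subset\mathbb R^N$ is non-empty and open with compact closure $\overline\theta$, and $\overline\theta$ is invariant: for every process $\alpha$ with values in $U$ adapted to the (completed) filtration of a $d$-dimensional Brownian motion $W$ and every $x\in\overline\theta$, the solution of $dX_t=b(X_t,\alpha_t)dt+\sigma(X_t,\alpha_t)dW_t$, $X_0=x$, satisfies $X_t\in\overline\theta$ for all $t\ge0$ a.s. $u\in USC(\overline\theta)$ is a viscosity subsolution on $\overline\theta$ of $\lambda V+H(x,DV,D^2V)=0$ if for all $x\in\overline\theta$ and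 $\varphi\in C^2(\mathbb R^N)$ such that $u-\varphi$ attains a local maximum on $\overline\theta$ at $x$, $\lambda u(x)+H(x,D\varphi(x),D^2\varphi(x))\le0$. $v\in LSC(\overline\theta)$ is a viscosity supersolution on $\overline\theta$ if for all $x\in\overline\theta$ and $\varphi\in C^2(\mathbb R^N)$ such that $v-\varphi$ attains a local minimum on $\overline\theta$ at $x$, $\lambda v(x)+H(x,D\varphi(x),D^2\varphi(x))\ge0$. *)

theory Defs
  imports "HOL-Probability.Probability"
begin

section \<open>Brownian motion and controlled stochastic differential equations\<close>

definition past_events ::
  "'w measure \<Rightarrow> (real \<Rightarrow> 'w \<Rightarrow> 'b::topological_space) \<Rightarrow> real \<Rightarrow> 'w set set" where
  "past_events M W t = {W s -` B \<inter> space M | s B. s \<in> {0..t} \<and> B \<in> sets borel}"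

definition brownian_motion :: "'w measure \<Rightarrow> (real \<Rightarrow> 'w \<Rightarrow> real^'d) \<Rightarrow> bool" where
  "brownian_motion M W \<longleftrightarrow>
     prob_space M \<and>
     (\<forall>t\<ge>0. W t \<in> borel_measurable M) \<and>
     (AE \<omega> in M. W 0 \<omega> = 0) \<and>
     (AE \<omega> in M. continuous_on {0..} (\<lambda>t. W t \<omega>)) \<and>
     (\<forall>s\<ge>0. \<forall>t>s.
        distributed M lborel (\<lambda>\<omega>. W t \<omega> - W s \<omega>)
          (\<lambda>x. ennreal (\<Prod>i\<in>UNIV. normal_density 0 (sqrt (t - s)) (x $ i))) \<and>
        prob_space.indep_set M (sigma_sets (space M) (past_events M W s))
          {(\<lambda>\<omega>. W t \<omega> - W s \<omega>) -` B \<inter> space M | B. B \<in> sets borel})"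

text \<open>The filtration generated by \<open>W\<close>, augmented by all subsets of null events. The space
  \<open>M\<close> itself need not be complete, so below events live in the completion of \<open>M\<close>.\<close>

definition completed_filtration ::
  "'w measure \<Rightarrow> (real \<Rightarrow> 'w \<Rightarrow> 'b::topological_space) \<Rightarrow> real \<Rightarrow> 'w measure" where
  "completed_filtration M W t =
     sigma (space M) (past_events M W t \<union> null_sets (completion M))"

text \<open>Processes are indexed by all reals, but only their values at times \<open>t \<ge> 0\<close> matter.\<close>

definition measurable_adapted ::
  "'w measure \<Rightarrow> (real \<Rightarrow> 'w \<Rightarrow> real^'d) \<Rightarrow> (real \<Rightarrow> 'w \<Rightarrow> 'b::topological_space) \<Rightarrow> bool" where
  "measurable_adapted M W Y \<longleftrightarrow>
     (\<lambda>(t, \<omega>). Y t \<omega>) \<in> borel_measurable (restrict_space borel {0..} \<Otimes>\<^sub>M completion M) \<and>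
     (\<forall>t\<ge>0. Y t \<in> borel_measurable (completed_filtration M W t))"

text \<open>A simple integrand is \<open>\<Sum>i<n. \<xi> i\<close> times the indicator of the interval from \<open>\<tau> i\<close>
  (exclusive) to \<open>\<tau> (i+1)\<close> (inclusive), with \<open>\<xi> i\<close> bounded and known at time \<open>\<tau> i\<close>.\<close>

definition simple_data ::
  "'w measure \<Rightarrow> (real \<Rightarrow> 'w \<Rightarrow> real^'d) \<Rightarrow> nat \<Rightarrow> (nat \<Rightarrow> real) \<Rightarrow>
   (nat \<Rightarrow> 'w \<Rightarrow> real^'d^'n) \<Rightarrow> bool" where
  "simple_data M W n \<tau> \<xi> \<longleftrightarrow>
     0 \<le> \<tau> 0 \<and> (\<forall>i<n. \<tau> i \<le> \<tau> (Suc i)) \<and>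
     (\<forall>i<n. \<xi> i \<in> borel_measurable (completed_filtration M W (\<tau> i)) \<and>
            (\<exists>C. \<forall>\<omega>\<in>space M. norm (\<xi> i \<omega>) \<le> C))"

definition simple_process ::
  "nat \<Rightarrow> (nat \<Rightarrow> real) \<Rightarrow> (nat \<Rightarrow> 'w \<Rightarrow> real^'d^'n) \<Rightarrow> real \<Rightarrow> 'w \<Rightarrow> real^'d^'n" where
  "simple_process n \<tau> \<xi> s \<omega> = (\<Sum>i<n. indicator {\<tau> i<..\<tau> (Suc i)} s *\<^sub>R \<xi> i \<omega>)"

definition simple_integral ::
  "(real \<Rightarrow> 'w \<Rightarrow> real^'d) \<Rightarrow> nat \<Rightarrow> (nat \<Rightarrow> real) \<Rightarrow> (nat \<Rightarrow> 'w \<Rightarrow> real^'d^'n) \<Rightarrow>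
   real \<Rightarrow> 'w \<Rightarrow> real^'n" where
  "simple_integral W n \<tau> \<xi> t \<omega> =
     (\<Sum>i<n. \<xi> i \<omega> *v (W (min t (\<tau> (Suc i))) \<omega> - W (min t (\<tau> i)) \<omega>))"

definition null_in_probability :: "'w measure \<Rightarrow> (nat \<Rightarrow> 'w \<Rightarrow> ennreal) \<Rightarrow> bool" where
  "null_in_probability P Y \<longleftrightarrow>
     (\<forall>\<epsilon>::real>0. (\<lambda>k. measure P {\<omega> \<in> space P. ennreal \<epsilon> < Y k \<omega>}) \<longlonglongrightarrow> 0)"

text \<open>\<open>has_ito_integral M W Y t I\<close>: the random variable \<open>I\<close> is (a version of) the Ito integral
  of \<open>Y\<close> with respect to \<open>W\<close> over \<open>[0,t]\<close>. This is the general Ito integral, for integrands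
  with almost surely square integrable paths, obtained from simple integrands by limits in
  probability.\<close>

definition has_ito_integral ::
  "'w measure \<Rightarrow> (real \<Rightarrow> 'w \<Rightarrow> real^'d) \<Rightarrow> (real \<Rightarrow> 'w \<Rightarrow> real^'d^'n) \<Rightarrow> real \<Rightarrow>
   ('w \<Rightarrow> real^'n) \<Rightarrow> bool" where
  "has_ito_integral M W Y t I \<longleftrightarrow>
     measurable_adapted M W Y \<and> I \<in> borel_measurable (completion M) \<and>
     (\<exists>n \<tau> \<xi>.
        (\<forall>k. simple_data M W (n k) (\<tau> k) (\<xi> k)) \<and>
        null_in_probability (completion M)
          (\<lambda>k \<omega>. \<integral>\<^sup>+ s\<in>{0..t}. ennreal ((norm (simple_process (n k) (\<tau> k) (\<xi> k) s \<omega> - Y s \<omega>))\<^sup>2) \<partial>lborel) \<and>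
        null_in_probability (completion M)
          (\<lambda>k \<omega>. ennreal (norm (simple_integral W (n k) (\<tau> k) (\<xi> k) t \<omega> - I \<omega>))))"

definition admissible_control ::
  "'w measure \<Rightarrow> (real \<Rightarrow> 'w \<Rightarrow> real^'d) \<Rightarrow> 'u::metric_space set \<Rightarrow> (real \<Rightarrow> 'w \<Rightarrow> 'u) \<Rightarrow> bool" where
  "admissible_control M W U \<alpha> \<longleftrightarrow>
     measurable_adapted M W \<alpha> \<and> (\<forall>t\<ge>0. \<forall>\<omega>\<in>space M. \<alpha> t \<omega> \<in> U)"

definition solves_sde ::
  "'w measure \<Rightarrow> (real \<Rightarrow> 'w \<Rightarrow> real^'d) \<Rightarrow>
   (real^'n \<Rightarrow> 'u \<Rightarrow> real^'n) \<Rightarrow> (real^'n \<Rightarrow> 'u \<Rightarrow> real^'d^'n) \<Rightarrow>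
   (real \<Rightarrow> 'w \<Rightarrow> 'u) \<Rightarrow> real^'n \<Rightarrow> (real \<Rightarrow> 'w \<Rightarrow> real^'n) \<Rightarrow> bool" where
  "solves_sde M W b \<sigma> \<alpha> x X \<longleftrightarrow>
     measurable_adapted M W X \<and>
     (\<forall>\<omega>\<in>space M. continuous_on {0..} (\<lambda>t. X t \<omega>)) \<and>
     (AE \<omega> in M. X 0 \<omega> = x) \<and>
     (\<forall>t\<ge>0. has_ito_integral M W (\<lambda>s \<omega>. \<sigma> (X s \<omega>) (\<alpha> s \<omega>)) t
        (\<lambda>\<omega>. X t \<omega> - x - (LINT s:{0..t}|lborel. b (X s \<omega>) (\<alpha> s \<omega>))))"

definition invariant_set ::
  "'w measure \<Rightarrow> (real \<Rightarrow> 'w \<Rightarrow> real^'d) \<Rightarrow> 'u::metric_space set \<Rightarrow>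
   (real^'n \<Rightarrow> 'u \<Rightarrow> real^'n) \<Rightarrow> (real^'n \<Rightarrow> 'u \<Rightarrow> real^'d^'n) \<Rightarrow> (real^'n) set \<Rightarrow> bool" where
  "invariant_set M W U b \<sigma> S \<longleftrightarrow>
     (\<forall>x\<in>S. \<forall>\<alpha> X. admissible_control M W U \<alpha> \<longrightarrow> solves_sde M W b \<sigma> \<alpha> x X \<longrightarrow>
        (AE \<omega> in M. \<forall>t\<ge>0. X t \<omega> \<in> S))"

section \<open>Assumptions on the coefficients\<close>

text \<open>The norm on \<open>real^'d^'n\<close> is the Frobenius norm.\<close>

definition H1 ::
  "'u::metric_space set \<Rightarrow> (real^'n \<Rightarrow> 'u \<Rightarrow> real^'n) \<Rightarrow> (real^'n \<Rightarrow> 'u \<Rightarrow> real^'d^'n) \<Rightarrow> bool" where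
  "H1 U b \<sigma> \<longleftrightarrow>
     uniformly_continuous_on (UNIV \<times> U) (\<lambda>(x, a). b x a) \<and>
     uniformly_continuous_on (UNIV \<times> U) (\<lambda>(x, a). \<sigma> x a) \<and>
     (\<exists>c>0. \<forall>a\<in>U.
        (\<forall>x x'. norm (b x a - b x' a) + norm (\<sigma> x a - \<sigma> x' a) \<le> c * norm (x - x')) \<and>
        (\<forall>x. norm (b x a) + norm (\<sigma> x a) \<le> c * (1 + norm x)))"

definition H2 ::
  "'u::metric_space set \<Rightarrow> (real^'n \<Rightarrow> real^'d \<Rightarrow> 'u \<Rightarrow> real) \<Rightarrow> bool" where
  "H2 U \<psi> \<longleftrightarrow>
     continuous_on (UNIV \<times> UNIV \<times> U) (\<lambda>(x, z, a). \<psi> x z a) \<and>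
     (\<exists>Kx\<ge>0. \<exists>Kz\<ge>0. \<exists>M\<ge>0. \<forall>a\<in>U.
        (\<forall>x x' z z'. \<bar>\<psi> x z a - \<psi> x' z' a\<bar> \<le> Kx * norm (x - x') + Kz * norm (z - z')) \<and>
        (\<forall>x. \<bar>\<psi> x 0 a\<bar> \<le> M))"

section \<open>Viscosity solutions\<close>

text \<open>The supremum is taken in \<open>real\<close>; under \<open>H1\<close>, \<open>H2\<close> and with \<open>U\<close> compact and non-empty
  it is over a non-empty bounded set.\<close>

definition hamiltonian ::
  "'u set \<Rightarrow> (real^'n \<Rightarrow> 'u \<Rightarrow> real^'n) \<Rightarrow> (real^'n \<Rightarrow> 'u \<Rightarrow> real^'d^'n) \<Rightarrow>
   (real^'n \<Rightarrow> real^'d \<Rightarrow> 'u \<Rightarrow> real) \<Rightarrow> real^'n \<Rightarrow> real^'n \<Rightarrow> real^'n^'n \<Rightarrow> real" where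
  "hamiltonian U b \<sigma> \<psi> x p A =
     (SUP a\<in>U. (- p) \<bullet> b x a - 1/2 * trace (\<sigma> x a ** transpose (\<sigma> x a) ** A)
               - \<psi> x (p v* \<sigma> x a) a)"

definition usc_on :: "'a::topological_space set \<Rightarrow> ('a \<Rightarrow> real) \<Rightarrow> bool" where
  "usc_on S u \<longleftrightarrow> (\<forall>x\<in>S. \<forall>r>u x. \<forall>\<^sub>F y in at x within S. u y < r)"

definition lsc_on :: "'a::topological_space set \<Rightarrow> ('a \<Rightarrow> real) \<Rightarrow> bool" where
  "lsc_on S u \<longleftrightarrow> (\<forall>x\<in>S. \<forall>r<u x. \<forall>\<^sub>F y in at x within S. r < u y)"

text \<open>\<open>\<phi>\<close> is of class \<open>C\<^sup>2\<close> on the whole space with gradient \<open>D\<close> and Hessian \<open>D2\<close>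
  (the latter is then automatically symmetric).\<close>

definition C2_with ::
  "(real^'n \<Rightarrow> real) \<Rightarrow> (real^'n \<Rightarrow> real^'n) \<Rightarrow> (real^'n \<Rightarrow> real^'n^'n) \<Rightarrow> bool" where
  "C2_with \<phi> D D2 \<longleftrightarrow>
     (\<forall>x. (\<phi> has_derivative (\<lambda>h. D x \<bullet> h)) (at x)) \<and>
     (\<forall>x. (D has_derivative (\<lambda>h. D2 x *v h)) (at x)) \<and>
     continuous_on UNIV D2"

definition local_max_on :: "'a::topological_space set \<Rightarrow> ('a \<Rightarrow> real) \<Rightarrow> 'a \<Rightarrow> bool" where
  "local_max_on S f x \<longleftrightarrow> x \<in> S \<and> (\<forall>\<^sub>F y in at x within S. f y \<le> f x)"

definition local_min_on :: "'a::topological_space set \<Rightarrow> ('a \<Rightarrow> real) \<Rightarrow> 'a \<Rightarrow> bool" where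
  "local_min_on S f x \<longleftrightarrow> x \<in> S \<and> (\<forall>\<^sub>F y in at x within S. f x \<le> f y)"

definition viscosity_subsolution ::
  "(real^'n) set \<Rightarrow> real \<Rightarrow> (real^'n \<Rightarrow> real^'n \<Rightarrow> real^'n^'n \<Rightarrow> real) \<Rightarrow> (real^'n \<Rightarrow> real) \<Rightarrow> bool" where
  "viscosity_subsolution S l H u \<longleftrightarrow>
     usc_on S u \<and>
     (\<forall>x\<in>S. \<forall>\<phi> D D2. C2_with \<phi> D D2 \<longrightarrow> local_max_on S (\<lambda>y. u y - \<phi> y) x \<longrightarrow>
        l * u x + H x (D x) (D2 x) \<le> 0)"

definition viscosity_supersolution ::
  "(real^'n) set \<Rightarrow> real \<Rightarrow> (real^'n \<Rightarrow> real^'n \<Rightarrow> real^'n^'n \<Rightarrow> real) \<Rightarrow> (real^'n \<Rightarrow> real) \<Rightarrow> bool" where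
  "viscosity_supersolution S l H v \<longleftrightarrow>
     lsc_on S v \<and>
     (\<forall>x\<in>S. \<forall>\<phi> D D2. C2_with \<phi> D D2 \<longrightarrow> local_min_on S (\<lambda>y. v y - \<phi> y) x \<longrightarrow>
        0 \<le> l * v x + H x (D x) (D2 x))"

end

(* Doubling of variables. With sup-convolutions S u and S (-v) one maximizes
     S u (x) + S (-v) (y) - \<beta> |x - y|^2 / 2.
   This function is semiconvex, and on the set of points where it is touched from above by an affine
   function its gradient is Lipschitz. The gradients attained there fill a ball, whereas the image of a
   null set is null; hence (Rademacher) there are such points, almost maximal and with almost zero
   gradient, where the gradient is differentiable along the contact set. As almost every point of the
   contact set is not a point of porosity, this yields a second order Taylor expansion at such a point.
   The Hessian is negative semidefinite there, and since the only mixed term comes from the penalization,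
   it gives second order jets of u and v at nearby points whose quadratic forms satisfy
     <X h, h> - <Y k, k> \<le> \<beta> |h - k|^2.
   Inserting h = \<sigma>_j(\<xi>) and k = \<sigma>_j(\<eta>) column by column and letting \<beta> tend to infinity gives the
   comparison. Both viscosity inequalities hold up to the boundary of the compact set, so a maximum
   located there needs no separate treatment. *)

theory Submission
  imports Defs
begin

text \<open>The obstacle is that \<open>u\<close> and \<open>v\<close> are merely semicontinuous, so
  a maximum of the doubled functional yields no second order information by itself. Sup-convolution
  provides a quadratic bound from below, and wherever a plane touches from above the function is
  pinched between a plane and a parabola. Differentiability of the slope is available only along the
  contact set, since an extension of the slope says nothing about the function elsewhere. The
  expansion therefore has to travel along a segment by way of contact points, and these must exist
  within an arbitrarily small fraction of the distance to the base point; this is what non-porosity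
  grants. The second delicate point is the size of the errors. The drift and the
  \<open>z\<close>-argument of the drivers contribute \<beta> |x - y| |\<xi> - \<eta>|, the
  diffusion \<beta> |\<xi> - \<eta>|^2. It is not enough that the doubled points come together:
  \<beta> times the squared distances must vanish, and this is where semicontinuity enters a second
  time.\<close>

section \<open>Differentiation of measures and porosity\<close>

text \<open>Vitali's theorem selects countably many disjoint balls inside an open set of almost the
  same \<nu>-measure as \<open>E\<close>, missing only a Lebesgue null part of \<open>E\<close>;
  \<open>null\<close> discards that part for \<mu>, and the inequality is summed over the balls. The
  balls need only contain the point, which admits intervals that are not centred at it.\<close>

lemma vitali_emeasure_le:
  fixes \<mu> \<nu> :: "'a::euclidean_space measure"
  assumes sets: "sets \<mu> = sets borel" "sets \<nu> = sets borel"
    and null: "\<And>N. N \<in> null_sets lborel \<Longrightarrow> emeasure \<mu> N = 0"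
    and outer: "\<And>e. 0 < (e::real) \<Longrightarrow> \<exists>V. open V \<and> E \<subseteq> V \<and> emeasure \<nu> V \<le> emeasure \<nu> E + ennreal e"
    and E: "E \<in> sets borel"
    and fine: "\<And>x d::real. x \<in> E \<Longrightarrow> d > 0 \<Longrightarrow>
      \<exists>a r. 0 < r \<and> r < d \<and> x \<in> cball a r \<and> emeasure \<mu> (cball a r) \<le> emeasure \<nu> (cball a r)"
  shows "emeasure \<mu> E \<le> emeasure \<nu> E"
proof (rule ennreal_le_epsilon)
  fix e :: real assume "e > 0"
  then obtain V where V: "open V" "E \<subseteq> V" "emeasure \<nu> V \<le> emeasure \<nu> E + e"
    using outer[OF \<open>e > 0\<close>] by blast
  define K where "K = {(a, r). 0 < r \<and> cball a r \<subseteq> V \<and>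
    emeasure \<mu> (cball a r) \<le> emeasure \<nu> (cball a r)}"
  have cov: "\<exists>i. i \<in> K \<and> x \<in> cball (fst i) (snd i) \<and> snd i < d" if xE: "x \<in> E" and d: "0 < d" for x d
  proof -
    have "x \<in> V" using V(2) xE by auto
    then obtain k where k: "k > 0" "cball x k \<subseteq> V"
      using V(1) unfolding open_contains_cball by blast
    \<comment> \<open>The ball is not centred at \<open>x\<close>, so its far points lie up to
      \<open>2 * r\<close> from \<open>x\<close>; hence \<open>k/2\<close>.\<close>
    obtain a r where ar: "0 < r" "r < min d (k/2)" "x \<in> cball a r"
      "emeasure \<mu> (cball a r) \<le> emeasure \<nu> (cball a r)"
      using fine[OF xE, of "min d (k/2)"] k d by auto
    have "cball a r \<subseteq> cball x k"
    proof
      fix y assume "y \<in> cball a r"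
      then have "dist x y \<le> 2 * r"
        using ar(3) dist_triangle[of x y a] by (simp add: dist_commute)
      then show "y \<in> cball x k" using ar(2) by simp
    qed
    then show ?thesis
      using ar k by (intro exI[of _ "(a, r)"]) (auto simp: K_def)
  qed
  obtain C where C: "countable C" "C \<subseteq> K"
     "pairwise (\<lambda>i j. disjnt (cball (fst i) (snd i)) (cball (fst j) (snd j))) C"
     and neg: "negligible (E - (\<Union>i \<in> C. cball (fst i) (snd i)))"
  proof (rule Vitali_covering_theorem_cballs[of K snd E fst])
    show "0 < snd i" if "i \<in> K" for i using that by (auto simp: K_def)
  qed (use cov in auto)
  let ?B = "\<lambda>i. cball (fst i) (snd i) :: 'a set"
  have UB: "(\<Union>i\<in>C. ?B i) \<in> sets borel"
    using C by (intro sets.countable_UN') auto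
  have disj: "disjoint_family_on ?B C"
    using C(3) by (auto simp: disjoint_family_on_def pairwise_def disjnt_def)
  have "E - (\<Union>i\<in>C. ?B i) \<in> null_sets lborel"
    using neg UB E unfolding negligible_iff_null_sets
    by (metis null_sets_completion_iff sets.Diff sets_lborel)
  then have 0: "emeasure \<mu> (E - (\<Union>i\<in>C. ?B i)) = 0" by (rule null)
  have "emeasure \<mu> E \<le> emeasure \<mu> ((E - (\<Union>i\<in>C. ?B i)) \<union> (\<Union>i\<in>C. ?B i))"
    using E UB sets by (intro emeasure_mono) auto
  also have "\<dots> \<le> emeasure \<mu> (E - (\<Union>i\<in>C. ?B i)) + emeasure \<mu> (\<Union>i\<in>C. ?B i)"
    using E UB sets by (intro emeasure_subadditive) auto
  also have "\<dots> = emeasure \<mu> (\<Union>i\<in>C. ?B i)" using 0 by simp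
  also have "\<dots> = (\<integral>\<^sup>+i. emeasure \<mu> (?B i) \<partial>count_space C)"
    using C disj sets by (intro emeasure_UN_countable) auto
  also have "\<dots> \<le> (\<integral>\<^sup>+i. emeasure \<nu> (?B i) \<partial>count_space C)"
    using C by (intro nn_integral_mono) (auto simp: K_def)
  also have "\<dots> = emeasure \<nu> (\<Union>i\<in>C. ?B i)"
    using C disj sets by (intro emeasure_UN_countable[symmetric]) auto
  also have "\<dots> \<le> emeasure \<nu> V"
  proof (rule emeasure_mono)
    have "?B i \<subseteq> V" if "i \<in> C" for i using subsetD[OF C(2) that] by (simp add: K_def case_prod_beta)
    then show "(\<Union>i\<in>C. ?B i) \<subseteq> V" by blast
  qed (use V sets in simp)
  finally show "emeasure \<mu> E \<le> emeasure \<nu> E + e" using V by simp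
qed

lemma outer_open_scale_lborel:
  fixes E :: "'a::euclidean_space set" and c e :: real
  assumes E: "E \<in> sets borel" and "0 < e" "0 \<le> c"
  obtains V where "open V" "E \<subseteq> V"
    "emeasure (scale_measure (ennreal c) lborel) V
      \<le> emeasure (scale_measure (ennreal c) lborel) E + ennreal e"
proof -
  \<comment> \<open>Dividing by \<open>c + 1\<close> instead of \<open>c\<close> covers
    \<open>c = 0\<close>.\<close>
  have "0 < e / (c + 1)" using assms by simp
  then obtain V where V: "open V" "E \<subseteq> V" "emeasure lborel (V - E) < e / (c + 1)"
    using outer_regular_lborel[OF E, of "e / (c + 1)"] by auto
  have "emeasure lborel V = emeasure lborel (E \<union> (V - E))"
    using V(2) by (simp add: Un_absorb1)
  also have "\<dots> \<le> emeasure lborel E + emeasure lborel (V - E)"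
    using E V by (intro emeasure_subadditive) auto
  also have "\<dots> \<le> emeasure lborel E + ennreal (e / (c + 1))"
    using V(3) by (intro add_left_mono) auto
  finally have "ennreal c * emeasure lborel V
      \<le> ennreal c * emeasure lborel E + ennreal c * ennreal (e / (c + 1))"
    by (metis distrib_left mult_left_mono zero_le)
  also have "ennreal c * ennreal (e / (c + 1)) = ennreal (c * (e / (c + 1)))"
    using assms by (subst ennreal_mult) auto
  also have "\<dots> \<le> ennreal e"
    using assms by (intro ennreal_leI) (simp add: divide_simps algebra_simps)
  finally show ?thesis
    using V that by (auto simp: add_left_mono)
qed

text \<open>Equivalently, \<open>A\<close> is not porous at \<open>x\<close>. This is weaker than \<open>x\<close> being a density point of \<open>A\<close>.\<close>

definition solid_at :: "'a::metric_space set \<Rightarrow> 'a \<Rightarrow> bool" where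
  "solid_at A x \<longleftrightarrow> (\<forall>e>0. \<exists>d>0. \<forall>y. dist y x < d \<longrightarrow> (\<exists>z\<in>A. dist z y \<le> e * dist y x))"

text \<open>Near a point of porosity there are holes of \<open>A\<close> of size comparable to their
  distance, so \<open>A\<close> fills at most a fixed fraction \<open>1 - q\<close> of arbitrarily
  small balls. Vitali, with Lebesgue measure restricted to \<open>A\<close>, then bounds the measure
  of the bad set by \<open>1 - q\<close> times itself.\<close>

lemma negligible_not_solid:
  fixes A :: "'a::euclidean_space set"
  assumes A: "closed A"
  shows "negligible {x\<in>A. \<not> solid_at A x}"
proof -
  \<comment> \<open>A union of open conditions on \<open>x\<close>: this form makes the bad set
    Borel.\<close>
  define G where "G k d = (\<Union>y. {x. dist y x < d \<and> dist y x / Suc k < infdist y A})" for k and d :: real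
  have opG: "open (G k d)" for k d
    unfolding G_def
    by (intro open_UN open_Collect_conj open_Collect_less continuous_intros ballI) auto
  \<comment> \<open>The index \<open>k\<close> fixes the relative size of the hole; \<open>j\<close>
    makes the measure finite, so that \<open>m \<le> (1 - q) * m\<close> can be absorbed at the
    end.\<close>
  define E where "E k j = A \<inter> ball 0 (real j) \<inter> (\<Inter>n. G k (1 / Suc n))" for k j
  have Eb: "E k j \<in> sets borel" for k j
    unfolding E_def using A opG by (intro sets.Int sets.countable_INT'') auto
  have E0: "emeasure lborel (E k j) = 0" for k j
  proof -
    \<comment> \<open>Volume ratio of a hole of radius \<open>\<rho> / Suc k\<close> to a ball of
      radius \<open>2 * \<rho>\<close>. The latter is centred at \<open>x\<close> and contains the
      hole, whose centre is at distance \<rho>.\<close>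
    define q :: real where "q = (1 / (2 * Suc k)) ^ DIM('a)"
    have q: "0 < q" "q \<le> 1" unfolding q_def
      by (auto intro!: power_le_one simp: divide_simps)
    have "emeasure (density lborel (indicator A)) (E k j)
        \<le> emeasure (scale_measure (ennreal (1 - q)) lborel) (E k j)"
    proof (rule vitali_emeasure_le)
      fix N :: "'a set" assume "N \<in> null_sets lborel"
      then have "A \<inter> N \<in> null_sets lborel"
        using A by (intro null_set_Int1) auto
      then show "emeasure (density lborel (indicator A)) N = 0"
        using A \<open>N \<in> null_sets lborel\<close> by (subst emeasure_restricted) (auto simp: null_setsD1 null_setsD2)
    next
      fix e :: real assume "0 < e"
      then show "\<exists>V. open V \<and> E k j \<subseteq> V \<and> emeasure (scale_measure (ennreal (1 - q)) lborel) V
           \<le> emeasure (scale_measure (ennreal (1 - q)) lborel) (E k j) + ennreal e"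
        using outer_open_scale_lborel[OF Eb, of e "1 - q"] q by (metis diff_ge_0_iff_ge)
    next
      fix x and d :: real assume x: "x \<in> E k j" and d: "d > 0"
      obtain n where n: "1 / Suc n < d / 2"
        using d reals_Archimedean[of "d/2"] by (auto simp: inverse_eq_divide)
      have "x \<in> G k (1 / Suc n)" using x by (auto simp: E_def)
      then obtain y where y: "dist y x < 1 / Suc n" "dist y x / Suc k < infdist y A"
        by (auto simp: G_def)
      have "x \<in> A" using x by (auto simp: E_def)
      define \<rho> where "\<rho> = dist y x"
      have \<rho>: "\<rho> > 0"
        using y(2) \<open>x \<in> A\<close> infdist_le[of x A y] by (cases "y = x") (auto simp: \<rho>_def)
      have sub: "ball y (\<rho> / Suc k) \<subseteq> cball x (2 * \<rho>)"
      proof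
        fix w assume "w \<in> ball y (\<rho> / Suc k)"
        then have "dist y w < \<rho> / Suc k" by simp
        also have "\<dots> \<le> \<rho>" using \<rho> by (simp add: divide_simps mult_left_le)
        finally show "w \<in> cball x (2 * \<rho>)"
          using dist_triangle[of x w y] by (simp add: \<rho>_def dist_commute)
      qed
      have "A \<inter> cball x (2 * \<rho>) \<subseteq> cball x (2 * \<rho>) - ball y (\<rho> / Suc k)"
        using y(2) infdist_le[of _ A y] by (fastforce simp: \<rho>_def)
      then have "emeasure lborel (A \<inter> cball x (2 * \<rho>))
          \<le> emeasure lborel (cball x (2 * \<rho>) - ball y (\<rho> / Suc k))"
        by (intro emeasure_mono) auto
      also have "\<dots> = emeasure lborel (cball x (2 * \<rho>)) - emeasure lborel (ball y (\<rho> / Suc k))"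
        using sub \<rho> by (intro emeasure_Diff) (auto simp: emeasure_ball)
      also have "\<dots> = ennreal (unit_ball_vol (real DIM('a)) * (2 * \<rho>) ^ DIM('a))
          - ennreal (unit_ball_vol (real DIM('a)) * (\<rho> / Suc k) ^ DIM('a))"
        using \<rho> by (simp add: emeasure_ball emeasure_cball)
      also have "\<dots> = ennreal (unit_ball_vol (real DIM('a)) * (2 * \<rho>) ^ DIM('a)
          - unit_ball_vol (real DIM('a)) * (\<rho> / Suc k) ^ DIM('a))"
        using \<rho> by (intro ennreal_minus) auto
      also have "\<rho> / Suc k = (1 / (2 * Suc k)) * (2 * \<rho>)" by (simp add: field_simps)
      also have "unit_ball_vol (real DIM('a)) * (2 * \<rho>) ^ DIM('a)
          - unit_ball_vol (real DIM('a)) * ((1 / (2 * Suc k)) * (2 * \<rho>)) ^ DIM('a)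
          = (1 - q) * (unit_ball_vol (real DIM('a)) * (2 * \<rho>) ^ DIM('a))"
        unfolding power_mult_distrib[of "1 / (2 * Suc k)"] q_def by (simp add: algebra_simps)
      also have "ennreal \<dots> = ennreal (1 - q) * emeasure lborel (cball x (2 * \<rho>))"
        using q \<rho> by (simp add: emeasure_cball ennreal_mult)
      finally have "emeasure (density lborel (indicator A)) (cball x (2 * \<rho>))
          \<le> emeasure (scale_measure (ennreal (1 - q)) lborel) (cball x (2 * \<rho>))"
        using A by (subst emeasure_restricted) auto
      moreover have "2 * \<rho> < d" using y(1) n by (simp add: \<rho>_def)
      ultimately show "\<exists>a r. 0 < r \<and> r < d \<and> x \<in> cball a r \<and>
          emeasure (density lborel (indicator A)) (cball a r)
          \<le> emeasure (scale_measure (ennreal (1 - q)) lborel) (cball a r)"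
        using \<rho> by (intro exI[of _ x] exI[of _ "2 * \<rho>"]) auto
    qed (use Eb in auto)
    then have le: "emeasure lborel (E k j) \<le> ennreal (1 - q) * emeasure lborel (E k j)"
      using A Eb by (subst (asm) emeasure_restricted) (auto simp: E_def Int_absorb1 Int_assoc)
    have "bounded (E k j)" unfolding E_def by (metis bounded_Int bounded_ball inf_commute)
    then have "emeasure lborel (E k j) < \<infinity>"
      by (rule emeasure_bounded_finite)
    then obtain m where m: "0 \<le> m" "emeasure lborel (E k j) = ennreal m"
      by (cases "emeasure lborel (E k j)") auto
    then have "m \<le> (1 - q) * m"
      using le q by (simp add: ennreal_mult[symmetric])
    then have "m \<le> 0" using q by (simp add: algebra_simps mult_le_0_iff)
    then show ?thesis using m by (simp add: ennreal_neg)
  qed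
  have "{x\<in>A. \<not> solid_at A x} \<subseteq> (\<Union>k. \<Union>j. E k j)"
  proof
    fix x assume "x \<in> {x\<in>A. \<not> solid_at A x}"
    then obtain e where x: "x \<in> A" and e: "e > 0"
      "\<And>d. d > 0 \<Longrightarrow> \<exists>y. dist y x < d \<and> (\<forall>z\<in>A. e * dist y x < dist z y)"
      unfolding solid_at_def by (auto simp: not_le)
    obtain k where k: "1 / Suc k < e"
      using e(1) reals_Archimedean[of e] by (auto simp: inverse_eq_divide)
    obtain j where j: "norm x < real j" using reals_Archimedean2 by blast
    have "x \<in> G k d" if d: "d > 0" for d
    proof -
      obtain y where y: "dist y x < d" "\<And>z. z \<in> A \<Longrightarrow> e * dist y x < dist z y"
        using e(2)[OF d] by auto
      have "dist y x > 0" using y(2)[OF x] by auto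
      then have "dist y x / Suc k < e * dist y x"
        using k by (metis mult.commute mult_strict_right_mono times_divide_eq_right mult.right_neutral)
      also have "\<dots> \<le> infdist y A"
        using x y(2) by (subst infdist_notempty) (auto intro!: cINF_greatest simp: dist_commute less_imp_le)
      finally show ?thesis using y(1) by (auto simp: G_def)
    qed
    then have "x \<in> E k j" using x j by (auto simp: E_def)
    then show "x \<in> (\<Union>k. \<Union>j. E k j)" by blast
  qed
  moreover have "negligible (\<Union>k. \<Union>j. E k j)"
  proof -
    have "E k j \<in> null_sets lborel" for k j using E0 Eb by (simp add: null_sets_def)
    then have "(\<Union>k. \<Union>j. E k j) \<in> null_sets lborel" by (intro null_sets_UN)
    then show ?thesis by (simp add: negligible_iff_null_sets null_sets_completionI)
  qed
  ultimately show ?thesis by (rule negligible_subset[rotated])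
qed

section \<open>Rademacher's theorem\<close>

lemma cball_atLeastAtMost:
  fixes a b :: real
  shows "cball ((a + b) / 2) ((b - a) / 2) = {a..b}"
  by (simp add: cball_eq_atLeastAtMost field_simps)

text \<open>Adding a linear term to \<open>f\<close> gives an increasing \<open>F\<close>, and \<open>\<mu>\<close> below is its Stieltjes
  measure. If each point of \<open>E\<close> lies in arbitrarily short intervals of slope less than \<open>p\<close> and in
  arbitrarily short ones of slope greater than \<open>q > p\<close>, then Vitali's theorem, applied twice, shows that
  \<open>\<mu> E\<close> is at most \<open>p\<close> times and at least \<open>q\<close> times the Lebesgue measure of \<open>E\<close>.\<close>

lemma lipschitz_real_differentiable_ae:
  fixes f :: "real \<Rightarrow> real"
  assumes lip: "\<And>x y. \<bar>f x - f y\<bar> \<le> L * \<bar>x - y\<bar>"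
  shows "negligible {x. \<not> f differentiable (at x)}"
proof -
  define K where "K = max L 1"
  have K: "K \<ge> 1" by (simp add: K_def)
  have lipK: "\<bar>f x - f y\<bar> \<le> K * \<bar>x - y\<bar>" for x y
    using lip[of x y] by (smt (verit) K_def mult_right_mono)
  \<comment> \<open>Slope \<open>2 * K\<close> puts all difference quotients of \<open>F\<close>
    between \<open>K\<close> and \<open>3 * K\<close>, so \<open>F\<close> is a bi-Lipschitz
    bijection of the line.\<close>
  define F where "F x = f x + 2 * K * x" for x
  have lo: "K * (y - x) \<le> F y - F x" and hi: "F y - F x \<le> 3 * K * (y - x)" if "x \<le> y" for x y
    using lipK[of y x] that by (auto simp: F_def algebra_simps abs_if split: if_splits)
  have Flip: "\<bar>F x - F y\<bar> \<le> 3 * K * \<bar>x - y\<bar>" for x y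
    using lo[of x y] hi[of x y] lo[of y x] hi[of y x] K
    by (smt (verit) mult_nonneg_nonneg)
  have sm: "strict_mono F"
  proof (rule strict_monoI)
    fix x y :: real assume "x < y"
    then show "F x < F y" using lo[of x y] K by (smt (verit) mult_pos_pos)
  qed
  have contF: "continuous_on UNIV F"
    by (rule lipschitz_on_continuous_on[of "3*K"])
       (use Flip K in \<open>auto intro!: lipschitz_onI simp: dist_real_def\<close>)
  have surjF: "\<exists>x. F x = y" for y
  proof -
    define B where "B = \<bar>y\<bar> + \<bar>F 0\<bar>"
    have "B \<ge> 0" by (simp add: B_def)
    have "K * B \<ge> B" using K \<open>B \<ge> 0\<close> by (simp add: mult_le_cancel_right1)
    moreover have "K * B \<le> F 0 - F (-B)" "K * B \<le> F B - F 0"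
      using lo[of "-B" 0] lo[of 0 B] \<open>B \<ge> 0\<close> by simp_all
    moreover have "y \<le> B + F 0" "F 0 - B \<le> y" by (auto simp: B_def)
    ultimately have "F (-B) \<le> y" "y \<le> F B" by linarith+
    then show ?thesis
      using IVT'[of F "-B" y B] \<open>B \<ge> 0\<close> continuous_on_subset[OF contF, of "{-B..B}"] by auto
  qed
  define G where "G = inv F"
  have injF: "inj F" using sm by (rule strict_mono_imp_inj_on)
  have GF: "G (F x) = x" for x by (simp add: G_def injF)
  have FG: "F (G y) = y" for y unfolding G_def using surjF by (metis f_inv_into_f rangeI)
  have Gm: "G \<in> borel_measurable lborel"
  proof -
    have "mono G" using sm by (metis FG linorder_not_le monoI strict_monoD)
    then show ?thesis by (simp add: borel_measurable_mono)
  qed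
  \<comment> \<open>Pushforward under the inverse: \<open>\<mu> A\<close> is the Lebesgue measure of
    the image of \<open>A\<close> under \<open>F\<close>. Intervals get mass
    \<open>F b - F a\<close>, and null sets stay null because \<open>F\<close> is Lipschitz.\<close>
  define \<mu> where "\<mu> = distr lborel borel G"
  have em: "emeasure \<mu> A = emeasure lborel (G -` A)" if "A \<in> sets borel" for A
    using Gm that by (simp add: \<mu>_def emeasure_distr)
  have sets\<mu>: "sets \<mu> = sets borel" by (simp add: \<mu>_def)
  have em_int: "emeasure \<mu> {a..b} = ennreal (F b - F a)" if "a \<le> b" for a b
  proof -
    have "G -` {a..b} = {F a..F b}"
      using sm FG GF by (auto simp: strict_mono_less_eq) (metis FG sm strict_mono_less_eq)+
    then show ?thesis
      using that sm by (simp add: em strict_mono_less_eq)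
  qed
  have null\<mu>: "emeasure \<mu> N = 0" if "N \<in> null_sets lborel" for N
  proof -
    have "negligible N" using that by (simp add: negligible_iff_null_sets null_sets_completionI)
    then have "negligible (F ` N)"
      by (intro negligible_locally_Lipschitz_image)
         (use Flip in \<open>auto intro!: exI[of _ UNIV] exI[of _ "3*K"]\<close>)
    moreover have "F ` N = G -` N" using FG GF by (auto simp: image_iff) metis
    moreover have "G -` N \<in> sets lborel"
      using Gm that measurable_sets[of G lborel borel N] by auto
    ultimately have "G -` N \<in> null_sets lborel"
      by (simp add: negligible_iff_null_sets null_sets_completion_iff)
    moreover have "N \<in> sets borel" using that by (simp add: null_sets_def)
    ultimately show ?thesis by (simp add: em null_setsD1)
  qed
  \<comment> \<open>Open intervals around \<open>x\<close>, rather than one-sided quotients at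
    \<open>x\<close>, make \<open>S p\<close> and \<open>T q\<close> countable intersections of open
    sets; \<open>main\<close> below returns to intervals with endpoint \<open>x\<close>.\<close>
  define S where "S p = (\<Inter>n. \<Union>{{a<..<b} |a b. a < b \<and> b - a < 1 / Suc n \<and> F b - F a < p * (b - a)})" for p
  define T where "T q = (\<Inter>n. \<Union>{{a<..<b} |a b. a < b \<and> b - a < 1 / Suc n \<and> F b - F a > q * (b - a)})" for q
  have Sb: "S p \<in> sets borel" for p
    unfolding S_def by (intro sets.countable_INT'') (auto intro!: borel_open open_Union)
  have Tb: "T p \<in> sets borel" for p
    unfolding T_def by (intro sets.countable_INT'') (auto intro!: borel_open open_Union)
  have SD: "\<exists>a b. a < x \<and> x < b \<and> b - a < d \<and> F b - F a < p * (b - a)" if "x \<in> S p" "d > 0" for x p d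
  proof -
    obtain n where "1 / Suc n < d"
      using reals_Archimedean[OF \<open>d > 0\<close>] by (auto simp: inverse_eq_divide)
    then show ?thesis using that(1) unfolding S_def by (fastforce dest: spec[of _ n])
  qed
  have TD: "\<exists>a b. a < x \<and> x < b \<and> b - a < d \<and> F b - F a > p * (b - a)" if "x \<in> T p" "d > 0" for x p d
  proof -
    obtain n where "1 / Suc n < d"
      using reals_Archimedean[OF \<open>d > 0\<close>] by (auto simp: inverse_eq_divide)
    then show ?thesis using that(1) unfolding T_def by (fastforce dest: spec[of _ n])
  qed
  have null: "S p \<inter> T q \<in> null_sets lborel" if pq: "p < q" for p q
  \<comment> \<open>All slopes of \<open>F\<close> are positive, so \<open>S p\<close> is empty for
    \<open>p \<le> 0\<close>, where \<open>ennreal p\<close> would collapse to zero.\<close>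
  proof (cases "p > 0")
    case False
    have "S p = {}"
    proof (rule ccontr)
      assume "S p \<noteq> {}"
      then obtain x where "x \<in> S p" by blast
      then obtain a b where "a < x" "x < b" "F b - F a < p * (b - a)"
        using SD[of x p 1] by auto
      then show False using lo[of a b] False K
        by (smt (verit) mult_nonneg_nonneg mult_nonpos_nonneg)
    qed
    then show ?thesis by simp
  next
    case p: True
    have z: "emeasure lborel (S p \<inter> T q \<inter> {-real j..real j}) = 0" for j
    proof -
      define E where "E = S p \<inter> T q \<inter> {-real j..real j}"
      have Eb: "E \<in> sets borel" using Sb Tb by (simp add: E_def)
      have "emeasure \<mu> E \<le> emeasure (scale_measure (ennreal p) lborel) E"
      proof (rule vitali_emeasure_le)
        fix e :: real assume "0 < e"
        then show "\<exists>V. open V \<and> E \<subseteq> V \<and> emeasure (scale_measure (ennreal p) lborel) V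
           \<le> emeasure (scale_measure (ennreal p) lborel) E + ennreal e"
          using p outer_open_scale_lborel[OF Eb, of e p] by (metis less_imp_le)
      next
        fix x d :: real assume "x \<in> E" "d > 0"
        then obtain a b where ab: "a < x" "x < b" "b - a < d" "F b - F a < p * (b - a)"
          using SD[of x p d] by (auto simp: E_def)
        then have "emeasure \<mu> {a..b} \<le> emeasure (scale_measure (ennreal p) lborel) {a..b}"
          using p by (simp add: em_int ennreal_mult[symmetric] ennreal_leI)
        then show "\<exists>a r. 0 < r \<and> r < d \<and> x \<in> cball a r \<and>
            emeasure \<mu> (cball a r) \<le> emeasure (scale_measure (ennreal p) lborel) (cball a r)"
          using ab by (intro exI[of _ "(a+b)/2"] exI[of _ "(b-a)/2"]) (simp only: cball_atLeastAtMost, simp)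
      qed (use Eb null\<mu> sets\<mu> in auto)
      moreover have "emeasure (scale_measure (ennreal q) lborel) E \<le> emeasure \<mu> E"
      proof (rule vitali_emeasure_le)
        fix e :: real assume "0 < e"
        moreover have GE: "G -` E \<in> sets borel" using Gm Eb measurable_sets[of G lborel borel E] by auto
        ultimately obtain V where V: "open V" "G -` E \<subseteq> V"
          "emeasure (scale_measure (ennreal 1) lborel) V
             \<le> emeasure (scale_measure (ennreal 1) lborel) (G -` E) + ennreal e"
          using outer_open_scale_lborel[of "G -` E" e 1] by (metis zero_le_one)
        \<comment> \<open>Outer regularity is inherited by \<mu>: the image of \<open>E\<close>
          under \<open>F\<close> is enclosed in an open \<open>V\<close>, and \<open>V\<close> is
          pulled back along the continuous \<open>F\<close>.\<close>
        have "open (F -` V)" using contF V(1) by (simp add: continuous_on_open_vimage open_vimage)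
        moreover have "E \<subseteq> F -` V" using V(2) GF by auto
        moreover have "G -` (F -` V) = V" using FG by auto
        then have "emeasure \<mu> (F -` V) \<le> emeasure \<mu> E + ennreal e"
          using V(3) Eb \<open>open (F -` V)\<close> by (simp add: em)
        ultimately show "\<exists>V. open V \<and> E \<subseteq> V \<and> emeasure \<mu> V \<le> emeasure \<mu> E + ennreal e" by blast
      next
        fix x d :: real assume "x \<in> E" "d > 0"
        then obtain a b where ab: "a < x" "x < b" "b - a < d" "F b - F a > q * (b - a)"
          using TD[of x q d] by (auto simp: E_def)
        then have "emeasure (scale_measure (ennreal q) lborel) {a..b} \<le> emeasure \<mu> {a..b}"
          using p pq by (simp add: em_int ennreal_mult[symmetric] ennreal_leI)
        then show "\<exists>a r. 0 < r \<and> r < d \<and> x \<in> cball a r \<and>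
            emeasure (scale_measure (ennreal q) lborel) (cball a r) \<le> emeasure \<mu> (cball a r)"
          using ab by (intro exI[of _ "(a+b)/2"] exI[of _ "(b-a)/2"]) (simp only: cball_atLeastAtMost, simp)
      qed (use Eb sets\<mu> in \<open>auto simp: null_setsD1\<close>)
      ultimately have le: "ennreal q * emeasure lborel E \<le> ennreal p * emeasure lborel E" by simp
      have "bounded E" unfolding E_def by (metis bounded_Int bounded_closed_interval inf_commute)
      then have "emeasure lborel E < \<infinity>" by (rule emeasure_bounded_finite)
      then obtain m where m: "0 \<le> m" "emeasure lborel E = ennreal m"
        by (cases "emeasure lborel E") auto
      then have "q * m \<le> p * m" using le p pq by (simp add: ennreal_mult[symmetric])
      then have "(q - p) * m \<le> 0" by (simp add: algebra_simps)
      then have "m \<le> 0" using pq by (simp add: mult_le_0_iff)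
      then show ?thesis using m by (simp add: ennreal_neg E_def)
    qed
    have "S p \<inter> T q = (\<Union>j. S p \<inter> T q \<inter> {-real j..real j})"
    proof -
      have "\<exists>j. - real j \<le> x \<and> x \<le> real j" for x
        using real_arch_simple[of "\<bar>x\<bar>"] by (auto simp: abs_le_iff minus_le_iff)
      then show ?thesis by auto
    qed
    moreover have "(\<Union>j. S p \<inter> T q \<inter> {-real j..real j}) \<in> null_sets lborel"
      using z Sb Tb by (intro null_sets_UN) (auto simp: null_sets_def)
    ultimately show ?thesis by simp
  qed
  have diff: "f differentiable (at x)" if x: "\<And>p q. p \<in> \<rat> \<Longrightarrow> q \<in> \<rat> \<Longrightarrow> p < q \<Longrightarrow> x \<notin> S p \<inter> T q" for x
  proof -
    define P where "P = {p. x \<in> S p}"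
    \<comment> \<open>The lower derivative of \<open>F\<close> over intervals shrinking to
      \<open>x\<close>. Avoiding every \<open>S p \<inter> T q\<close> with rational
      \<open>p < q\<close> forces the upper one to agree.\<close>
    define D where "D = Inf P"
    have up: "x \<in> S p'" if pp: "x \<in> S p" "p \<le> p'" for p p'
      unfolding S_def
    proof (intro InterI, clarify)
      fix n
      obtain a b where ab: "a < x" "x < b" "b - a < 1 / Suc n" "F b - F a < p * (b - a)"
        using SD[OF pp(1), of "1 / Suc n"] by auto
      then have "F b - F a < p' * (b - a)"
        using pp(2) by (smt (verit) mult_right_mono)
      then show "x \<in> \<Union>{{a<..<b} |a b. a < b \<and> b - a < 1 / Suc n \<and> F b - F a < p' * (b - a)}"
        using ab by (intro UnionI[of "{a<..<b}"] CollectI exI[of _ a] exI[of _ b]) auto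
    qed
    have "4 * K \<in> P"
      unfolding P_def S_def
    proof (clarify)
      fix n
      define h where "h = 1 / (4 * real (Suc n))"
      have h: "h > 0" "2 * h < 1 / Suc n" by (auto simp: h_def field_simps)
      have "F (x + h) - F (x - h) \<le> 3 * K * (2 * h)"
        using hi[of "x - h" "x + h"] h by simp
      also have "\<dots> < 4 * K * (2 * h)" using h K by simp
      finally show "x \<in> \<Union>{{a<..<b} |a b. a < b \<and> b - a < 1 / Suc n \<and> F b - F a < 4 * K * (b - a)}"
        using h by (intro UnionI[of "{x - h<..<x + h}"] CollectI exI[of _ "x - h"] exI[of _ "x + h"]) auto
    qed
    moreover have low: "0 \<le> p" if pP: "p \<in> P" for p
    proof -
      obtain a b where ab: "a < x" "x < b" "F b - F a < p * (b - a)"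
        using SD[of x p 1] pP by (auto simp: P_def)
      then have "0 < p * (b - a)" using lo[of a b] K by (smt (verit) mult_nonneg_nonneg)
      then show ?thesis using ab by (simp add: zero_less_mult_iff)
    qed
    ultimately have "0 \<le> D"
      unfolding D_def by (intro cInf_greatest) auto
    have Ple: "p \<notin> P" if "p < D" for p
      using cInf_lower[of p P] low that unfolding D_def by (auto simp: bdd_below_def)
    have lower: "\<exists>d>0. \<forall>a b. a < x \<and> x < b \<and> b - a < d \<longrightarrow> (D - \<epsilon>) * (b - a) \<le> F b - F a"
      if e0: "\<epsilon> > 0" for \<epsilon>
    proof -
      have "D - \<epsilon> \<notin> P" using Ple e0 by simp
      then obtain n where n: "x \<notin> \<Union>{{a<..<b} |a b. a < b \<and> b - a < 1 / Suc n \<and> F b - F a < (D - \<epsilon>) * (b - a)}"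
        unfolding P_def S_def by blast
      have "(D - \<epsilon>) * (b - a) \<le> F b - F a" if "a < x" "x < b" "b - a < 1 / Suc n" for a b
      proof (rule ccontr)
        assume "\<not> ?thesis"
        then have "x \<in> \<Union>{{a<..<b} |a b. a < b \<and> b - a < 1 / Suc n \<and> F b - F a < (D - \<epsilon>) * (b - a)}"
          using that by (intro UnionI[of "{a<..<b}"] CollectI exI[of _ a] exI[of _ b]) auto
        then show False using n by contradiction
      qed
      then show ?thesis by (intro exI[of _ "1 / Suc n"]) auto
    qed
    have upper: "\<exists>d>0. \<forall>a b. a < x \<and> x < b \<and> b - a < d \<longrightarrow> F b - F a \<le> (D + \<epsilon>) * (b - a)"
      if e0: "\<epsilon> > 0" for \<epsilon>
    proof -
      have "P \<noteq> {}" using \<open>4 * K \<in> P\<close> by auto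
      then obtain p where p: "p \<in> P" "p < D + \<epsilon>"
        using cInf_lessD[of P "D + \<epsilon>"] e0 by (auto simp: D_def)
      \<comment> \<open>Two rationals are inserted: \<open>x\<close> lies in \<open>S r\<close>, and
        the gap \<open>r < r'\<close> then excludes \<open>T r'\<close>.\<close>
      obtain r where r: "r \<in> \<rat>" "p < r" "r < D + \<epsilon>" using Rats_dense_in_real[OF p(2)] by auto
      obtain r' where r': "r' \<in> \<rat>" "r < r'" "r' < D + \<epsilon>" using Rats_dense_in_real[OF r(3)] by auto
      have "x \<in> S r" using p(1) r(2) up by (auto simp: P_def)
      then have "x \<notin> T r'" using x[OF r(1) r'(1,2)] by simp
      then obtain n where n: "x \<notin> \<Union>{{a<..<b} |a b. a < b \<and> b - a < 1 / Suc n \<and> F b - F a > r' * (b - a)}"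
        unfolding T_def by blast
      have "F b - F a \<le> r' * (b - a)" if "a < x" "x < b" "b - a < 1 / Suc n" for a b
      proof (rule ccontr)
        assume "\<not> ?thesis"
        then have "x \<in> \<Union>{{a<..<b} |a b. a < b \<and> b - a < 1 / Suc n \<and> F b - F a > r' * (b - a)}"
          using that by (intro UnionI[of "{a<..<b}"] CollectI exI[of _ a] exI[of _ b]) auto
        then show False using n by contradiction
      qed
      moreover have "r' * (b - a) \<le> (D + \<epsilon>) * (b - a)" if "a < x" "x < b" for a b
        using that r' by (intro mult_right_mono) auto
      ultimately have "F b - F a \<le> (D + \<epsilon>) * (b - a)" if "a < x" "x < b" "b - a < 1 / Suc n" for a b
        using that order_trans by blast
      then show ?thesis by (intro exI[of _ "1 / Suc n"]) auto
    qed
    have "(F has_real_derivative D) (at x)"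
      unfolding has_field_derivative_def has_derivative_at_alt
    proof (intro conjI allI impI bounded_linear_mult_right)
      fix e :: real assume "e > 0"
      define \<epsilon> where "\<epsilon> = e / 3"
      have "\<epsilon> > 0" using \<open>e > 0\<close> by (simp add: \<epsilon>_def)
      obtain d1 where d1: "d1 > 0" "\<And>a b. a < x \<Longrightarrow> x < b \<Longrightarrow> b - a < d1 \<Longrightarrow> (D - \<epsilon>) * (b - a) \<le> F b - F a"
        using lower[OF \<open>\<epsilon> > 0\<close>] by blast
      obtain d2 where d2: "d2 > 0" "\<And>a b. a < x \<Longrightarrow> x < b \<Longrightarrow> b - a < d2 \<Longrightarrow> F b - F a \<le> (D + \<epsilon>) * (b - a)"
        using upper[OF \<open>\<epsilon> > 0\<close>] by blast
      define d where "d = min d1 d2"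
      have d: "d > 0" using d1 d2 by (simp add: d_def)
      have main: "\<bar>F b - F a - D * (b - a)\<bar> \<le> e * (b - a)"
        if ab: "a \<le> x" "x \<le> b" "a < b" "b - a < d / 2" for a b
      proof -
        define h where "h = b - a"
        \<comment> \<open>\<open>lower\<close> and \<open>upper\<close> concern intervals with
          \<open>x\<close> in the interior, whereas a difference quotient has \<open>x\<close> as an
          endpoint. Both ends are moved outwards by \<iota>, so little that the changes of
          \<open>F\<close> and of the linear term cost at most
          \<open>\<epsilon> * h\<close>.\<close>
        define \<iota> where "\<iota> = min (h / 2) (\<epsilon> * h / (3 * (3 * K + D)))"
        have h: "h > 0" using ab by (simp add: h_def)
        have KD: "3 * K + D > 0" using K \<open>0 \<le> D\<close> by simp
        have \<iota>: "\<iota> > 0" "\<iota> \<le> h / 2"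
          using h \<open>\<epsilon> > 0\<close> KD unfolding \<iota>_def by (simp_all only: min_less_iff_conj min.cobounded1) simp
        have "\<iota> \<le> \<epsilon> * h / (3 * (3 * K + D))" by (simp add: \<iota>_def)
        then have \<iota>3: "3 * (3 * K + D) * \<iota> \<le> \<epsilon> * h"
          using KD by (simp add: pos_le_divide_eq mult.commute)
        define a' b' where "a' = a - \<iota>" and "b' = b + \<iota>"
        have len: "b' - a' = h + 2 * \<iota>" by (simp add: a'_def b'_def h_def)
        have in': "a' < x" "x < b'" "b' - a' < d1" "b' - a' < d2"
          using ab \<iota> by (auto simp: a'_def b'_def d_def h_def)
        have "\<bar>F b' - F a' - D * (b' - a')\<bar> \<le> \<epsilon> * (h + 2 * \<iota>)"
          using d1(2)[OF in'(1-3)] d2(2)[OF in'(1,2,4)] unfolding len by (simp add: algebra_simps abs_le_iff)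
        moreover have "\<epsilon> * (h + 2 * \<iota>) \<le> \<epsilon> * (2 * h)" using \<iota> \<open>\<epsilon> > 0\<close> by (intro mult_left_mono) auto
        moreover have "\<bar>F b' - F b\<bar> \<le> 3 * K * \<iota>" "\<bar>F a' - F a\<bar> \<le> 3 * K * \<iota>"
          using Flip[of b' b] Flip[of a' a] \<iota> by (auto simp: a'_def b'_def)
        moreover have "D * (b' - a') = D * h + 2 * (D * \<iota>)" unfolding len by (simp add: algebra_simps)
        moreover have "3 * (3 * K + D) * \<iota> = 9 * K * \<iota> + 3 * (D * \<iota>)" by (simp add: algebra_simps)
        moreover have "0 \<le> D * \<iota>" "0 \<le> K * \<iota>" using \<iota> \<open>0 \<le> D\<close> K by auto
        moreover have "e * h = 3 * (\<epsilon> * h)" by (simp add: \<epsilon>_def)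
        ultimately show ?thesis using \<iota>3 unfolding h_def[symmetric] by linarith
      qed
      show "\<exists>d>0. \<forall>y. norm (y - x) < d \<longrightarrow> norm (F y - F x - D * (y - x)) \<le> e * norm (y - x)"
      proof (intro exI[of _ "d/2"] conjI allI impI)
        fix y assume y: "norm (y - x) < d / 2"
        consider "y < x" | "y = x" | "x < y" by linarith
        then show "norm (F y - F x - D * (y - x)) \<le> e * norm (y - x)"
        proof cases
          case 1
          then show ?thesis using main[of y x] y by (simp add: algebra_simps abs_minus_commute)
        next
          case 3
          then show ?thesis using main[of x y] y by (simp add: algebra_simps)
        qed simp
      qed (use d in simp)
    qed
    then have "((\<lambda>x. F x - 2 * K * x) has_real_derivative (D - 2 * K)) (at x)"
      by (auto intro!: derivative_eq_intros)
    then show ?thesis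
      by (auto simp: F_def real_differentiable_def)
  qed
  have "{x. \<not> f differentiable (at x)} \<subseteq> (\<Union>p\<in>\<rat>. \<Union>q\<in>\<rat> \<inter> {p<..}. S p \<inter> T q)"
  proof
    fix x assume "x \<in> {x. \<not> f differentiable (at x)}"
    then show "x \<in> (\<Union>p\<in>\<rat>. \<Union>q\<in>\<rat> \<inter> {p<..}. S p \<inter> T q)" using diff[of x] by fastforce
  qed
  moreover have "(\<Union>p\<in>\<rat>. \<Union>q\<in>\<rat> \<inter> {p<..}. S p \<inter> T q) \<in> null_sets lborel"
    using null by (intro null_sets_UN' countable_rat countable_Int1) auto
  ultimately show ?thesis
    using negligible_subset by (auto simp: negligible_iff_null_sets dest: null_sets_completionI)
qed

text \<open>Fubini without coordinates: by translation invariance every slice in \<open>t\<close>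
  integrates to the measure of \<open>N\<close>. Averaging over \<open>t\<close> in
  \<open>{0..1}\<close> and exchanging the integrals leaves measures along lines, which
  vanish.\<close>

lemma null_sets_lines:
  fixes N :: "'a::euclidean_space set"
  assumes N: "N \<in> sets borel"
    and lines: "\<And>x. negligible {t::real. x + t *\<^sub>R e \<in> N}"
  shows "N \<in> null_sets lborel"
proof -
  have m1: "(\<lambda>(x, t::real). x + t *\<^sub>R e) \<in> borel_measurable (lborel \<Otimes>\<^sub>M lborel)"
    by measurable
  have m2: "(\<lambda>(x, t::real). indicator N (x + t *\<^sub>R e) * indicator {0..1} t :: ennreal)
      \<in> borel_measurable (lborel \<Otimes>\<^sub>M lborel)"
    using N m1 by measurable
  have slice: "(\<integral>\<^sup>+x. indicator N (x + t *\<^sub>R e) \<partial>lborel) = emeasure lborel N" for t :: real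
  proof -
    have "(\<integral>\<^sup>+x. indicator N (x + t *\<^sub>R e) \<partial>lborel)
        = (\<integral>\<^sup>+x. indicator N x \<partial>distr lborel borel ((+) (t *\<^sub>R e)))"
      using N by (subst nn_integral_distr) (auto simp: add.commute)
    then show ?thesis using N by (simp add: lborel_distr_plus)
  qed
  have "emeasure lborel N = (\<integral>\<^sup>+t. emeasure lborel N * indicator {0..1::real} t \<partial>lborel)"
    by (subst nn_integral_cmult) (auto simp: nn_integral_indicator)
  also have "\<dots> = (\<integral>\<^sup>+t. (\<integral>\<^sup>+x. indicator N (x + t *\<^sub>R e) * indicator {0..1::real} t \<partial>lborel) \<partial>lborel)"
    using N by (subst nn_integral_multc) (auto simp: slice)
  also have "\<dots> = (\<integral>\<^sup>+x. (\<integral>\<^sup>+t. indicator N (x + t *\<^sub>R e) * indicator {0..1::real} t \<partial>lborel) \<partial>lborel)"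
    using lborel_pair.Fubini'[OF m2] by simp
  also have "\<dots> = (\<integral>\<^sup>+x. 0 \<partial>(lborel :: 'a measure))"
  proof (intro nn_integral_cong)
    fix x :: 'a
    have "{t. x + t *\<^sub>R e \<in> N} \<in> sets borel"
      using N by measurable
    then have "{t. x + t *\<^sub>R e \<in> N} \<in> null_sets lborel"
      using lines[of x] by (simp add: negligible_iff_null_sets null_sets_completion_iff)
    then have "AE t in lborel. x + t *\<^sub>R e \<notin> N"
      by (auto dest: AE_not_in)
    then have "AE t in lborel. indicator N (x + t *\<^sub>R e) * indicator {0..1::real} t = (0::ennreal)"
      by eventually_elim auto
    then show "(\<integral>\<^sup>+t. indicator N (x + t *\<^sub>R e) * indicator {0..1::real} t \<partial>lborel) = 0"
      by (subst nn_integral_cong_AE) auto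
  qed
  finally show ?thesis using N by (simp add: null_sets_def)
qed

text \<open>\<open>A e k m\<close> is a Cauchy criterion for the difference quotients, with
  tolerance \<open>1 / Suc k\<close> at steps below \<open>1 / Suc m\<close>. Continuity of the
  quotients in \<open>x\<close> makes it closed, which provides both the measurability for Fubini
  and closed sets for the porosity lemma; on each line the one-dimensional theorem applies.\<close>

lemma lipschitz_partial_derivative_ae:
  fixes f :: "'a::euclidean_space \<Rightarrow> real"
  assumes lip: "\<And>x y. \<bar>f x - f y\<bar> \<le> L * norm (x - y)"
  defines "q \<equiv> \<lambda>e t x. (f (x + t *\<^sub>R e) - f x) / t"
  defines "A \<equiv> \<lambda>e k m. {x. \<forall>s t. 0 < \<bar>s\<bar> \<and> \<bar>s\<bar> < 1 / real (Suc m) \<and> 0 < \<bar>t\<bar> \<and> \<bar>t\<bar> < 1 / real (Suc m)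
      \<longrightarrow> \<bar>q e s x - q e t x\<bar> \<le> 1 / real (Suc k)}"
  shows "closed (A e k m)" and "negligible {x. \<exists>k. \<forall>m. x \<notin> A e k m}"
proof -
  have contf: "continuous_on UNIV f"
  proof (rule lipschitz_on_continuous_on[of "max L 0"], rule lipschitz_onI)
    show "dist (f x) (f y) \<le> max L 0 * dist x y" for x y
      using lip[of x y] mult_right_mono[of L "max L 0" "norm (x - y)"] by (simp add: dist_real_def dist_norm)
  qed simp
  have contq: "continuous_on UNIV (q e t)" for e t
    unfolding q_def divide_inverse by (intro continuous_intros continuous_on_compose2[OF contf]) auto
  show closedA: "closed (A e k m)" for e k m
  proof -
    have "closed {x. P \<longrightarrow> \<bar>q e s x - q e t x\<bar> \<le> 1 / real (Suc k)}" for s t P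
      using contq by (cases P) (auto intro!: closed_Collect_le continuous_intros)
    then show ?thesis unfolding A_def by (intro closed_Collect_all)
  qed
  have "{x. \<exists>k. \<forall>m. x \<notin> A e k m} = (\<Union>k. \<Inter>m. - A e k m)" by auto
  then have "{x. \<exists>k. \<forall>m. x \<notin> A e k m} \<in> sets borel"
    using closedA by (auto intro!: sets.countable_UN sets.countable_INT'')
  moreover have "negligible {t::real. x + t *\<^sub>R e \<in> {x. \<exists>k. \<forall>m. x \<notin> A e k m}}" for x
  proof (rule negligible_subset)
    define g where "g t = f (x + t *\<^sub>R e)" for t
    have "\<bar>g t - g s\<bar> \<le> (L * norm e) * \<bar>t - s\<bar>" for s t
      using lip[of "x + t *\<^sub>R e" "x + s *\<^sub>R e"] by (simp add: g_def scaleR_left_diff_distrib[symmetric] mult_ac)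
    then show "negligible {t. \<not> g differentiable (at t)}"
      by (rule lipschitz_real_differentiable_ae)
    show "{t::real. x + t *\<^sub>R e \<in> {x. \<exists>k. \<forall>m. x \<notin> A e k m}} \<subseteq> {t. \<not> g differentiable (at t)}"
    proof clarify
      fix t k assume k: "\<forall>m. x + t *\<^sub>R e \<notin> A e k m" and "g differentiable (at t)"
      then obtain D where D: "(g has_real_derivative D) (at t)" by (auto simp: real_differentiable_def)
      have "(\<lambda>h. (g (t + h) - g t) / h) \<midarrow>0\<rightarrow> D" using D by (simp add: DERIV_def)
      then obtain d where d: "d > 0" "\<And>h. h \<noteq> 0 \<Longrightarrow> \<bar>h\<bar> < d \<Longrightarrow> \<bar>(g (t + h) - g t) / h - D\<bar> < 1 / real (Suc k) / 2"
        using LIM_D[of "\<lambda>h. (g (t + h) - g t) / h" D 0 "1 / real (Suc k) / 2"] by auto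
      obtain m where m: "1 / Suc m < d"
        using reals_Archimedean[OF d(1)] by (auto simp: inverse_eq_divide)
      have "x + t *\<^sub>R e \<in> A e k m"
        unfolding A_def
      proof (intro CollectI allI impI)
        fix s s' :: real
        assume s: "0 < \<bar>s\<bar> \<and> \<bar>s\<bar> < 1 / real (Suc m) \<and> 0 < \<bar>s'\<bar> \<and> \<bar>s'\<bar> < 1 / real (Suc m)"
        have "q e h (x + t *\<^sub>R e) = (g (t + h) - g t) / h" for h
          by (simp add: q_def g_def scaleR_add_left add.assoc)
        moreover have "\<bar>(g (t + s) - g t) / s - D\<bar> < 1 / real (Suc k) / 2" "\<bar>(g (t + s') - g t) / s' - D\<bar> < 1 / real (Suc k) / 2"
          using d(2) s m by auto
        moreover have "\<bar>u - v\<bar> \<le> \<bar>u - D\<bar> + \<bar>v - D\<bar>" for u v :: real by arith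
        note this[of "(g (t + s) - g t) / s" "(g (t + s') - g t) / s'"]
        ultimately show "\<bar>q e s (x + t *\<^sub>R e) - q e s' (x + t *\<^sub>R e)\<bar> \<le> 1 / real (Suc k)"
          by (smt (verit) field_sum_of_halves)
      qed
      then show False using k by blast
    qed
  qed
  ultimately have "{x. \<exists>k. \<forall>m. x \<notin> A e k m} \<in> null_sets lborel"
    by (rule null_sets_lines)
  then show "negligible {x. \<exists>k. \<forall>m. x \<notin> A e k m}"
    by (simp add: negligible_iff_null_sets null_sets_completionI)
qed

text \<open>Linearity of the derivative comes for free: one passes from \<open>x\<close> to \<open>x + h\<close> along the coordinate
  directions and replaces each intermediate point by a nearby point of the closed set \<open>A e k m\<close>, on
  which the difference quotients in direction \<open>e\<close> are uniformly controlled.\<close>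

theorem rademacher:
  fixes f :: "'a::euclidean_space \<Rightarrow> real"
  assumes lip: "\<And>x y. \<bar>f x - f y\<bar> \<le> L * norm (x - y)"
  shows "negligible {x. \<not> f differentiable (at x)}"
proof -
  define q where "q = (\<lambda>e t x. (f (x + t *\<^sub>R e) - f x) / t)"
  define A where "A = (\<lambda>e k m. {x. \<forall>s t. 0 < \<bar>s\<bar> \<and> \<bar>s\<bar> < 1 / real (Suc m) \<and> 0 < \<bar>t\<bar> \<and> \<bar>t\<bar> < 1 / real (Suc m)
      \<longrightarrow> \<bar>q e s x - q e t x\<bar> \<le> 1 / real (Suc k)})"
  have clA: "closed (A e k m)" and ngA: "negligible {x. \<exists>k. \<forall>m. x \<notin> A e k m}" for e k m
    unfolding A_def q_def using lipschitz_partial_derivative_ae[OF lip] by blast+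
  \<comment> \<open>Outside \<open>N\<close>, each basis direction and each tolerance
    \<open>k\<close> admit some \<open>A e k m\<close> that contains \<open>x\<close> and is not
    porous there.\<close>
  define N where "N = (\<Union>e\<in>Basis. {x. \<exists>k. \<forall>m. x \<notin> A e k m} \<union> (\<Union>k. \<Union>m. {x\<in>A e k m. \<not> solid_at (A e k m) x}))"
  have "negligible N"
    unfolding N_def
    by (intro negligible_Union negligible_Un ngA negligible_countable_Union)
       (auto intro!: negligible_countable_Union negligible_Un ngA negligible_not_solid clA)
  moreover have "f differentiable (at x)" if xN: "x \<notin> N" for x
  proof -
    define K where "K = max L 1"
    have K: "K \<ge> 1" by (simp add: K_def)
    have lipK: "\<bar>f y - f z\<bar> \<le> K * norm (y - z)" for y z
      using lip[of y z] by (smt (verit) K_def mult_right_mono norm_ge_zero)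
    have contf: "continuous_on UNIV f"
      by (rule lipschitz_on_continuous_on[of K], rule lipschitz_onI)
         (use lipK K in \<open>auto simp: dist_real_def dist_norm\<close>)
    have contq: "isCont (q e t) y" for e t y
    proof -
      have "continuous_on UNIV (q e t)"
        unfolding q_def divide_inverse by (intro continuous_intros continuous_on_compose2[OF contf]) auto
      then show ?thesis by (simp add: continuous_on_eq_continuous_at)
    qed
    have sol: "\<exists>m. x \<in> A e k m \<and> solid_at (A e k m) x" if "e \<in> Basis" for e k
      using xN that unfolding N_def by blast
    \<comment> \<open>More than a directional derivative at \<open>x\<close>: increments from every
      base point \<open>y\<close> near \<open>x\<close> are controlled, at a cost proportional to
      the distance of \<open>y\<close>. This is what allows coordinate steps to be
      concatenated.\<close>
    have "\<exists>D. \<forall>\<epsilon>>0. \<exists>d>0. \<forall>y r. norm (y - x) < d \<longrightarrow> \<bar>r\<bar> < d \<longrightarrow>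
        \<bar>f (y + r *\<^sub>R e) - f y - r * D\<bar> \<le> \<epsilon> * (\<bar>r\<bar> + norm (y - x))" if e: "e \<in> Basis" for e
    proof -
      have "\<exists>m. \<forall>k. x \<in> A e k (m k) \<and> solid_at (A e k (m k)) x"
        using sol[OF e] by metis
      then obtain m where m: "\<And>k. x \<in> A e k (m k)" "\<And>k. solid_at (A e k (m k)) x" by blast
      have AD: "\<bar>q e s z - q e t z\<bar> \<le> 1 / real (Suc k)"
        if "z \<in> A e k (m k)" "0 < \<bar>s\<bar>" "\<bar>s\<bar> < 1 / real (Suc (m k))" "0 < \<bar>t\<bar>" "\<bar>t\<bar> < 1 / real (Suc (m k))" for k s t z
        using that by (auto simp: A_def)
      \<comment> \<open>The offset 2 makes the steps strictly smaller than \<open>1 / Suc M\<close>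
        from index \<open>M\<close> on.\<close>
      define a where "a n = q e (1 / (real n + 2)) x" for n
      have small: "\<bar>1 / (real n + 2)\<bar> < 1 / real (Suc M)" if "n \<ge> M" for n M
        using that by (simp add: divide_simps)
      have "Cauchy a"
      proof (rule metric_CauchyI)
        fix \<epsilon> :: real assume "0 < \<epsilon>"
        then obtain k where k: "1 / real (Suc k) < \<epsilon>"
          using reals_Archimedean[of \<epsilon>] by (auto simp: inverse_eq_divide)
        show "\<exists>M. \<forall>n\<ge>M. \<forall>n'\<ge>M. dist (a n) (a n') < \<epsilon>"
        proof (intro exI[of _ "m k"] allI impI)
          fix n n' assume "m k \<le> n" "m k \<le> n'"
          then have "\<bar>a n - a n'\<bar> \<le> 1 / real (Suc k)"
            unfolding a_def by (intro AD m small) auto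
          then show "dist (a n) (a n') < \<epsilon>" using k by (simp add: dist_real_def)
        qed
      qed
      then obtain D where D: "a \<longlonglongrightarrow> D" using Cauchy_convergent convergent_def by blast
      have qD: "\<bar>q e s x - D\<bar> \<le> 1 / real (Suc k)" if s: "0 < \<bar>s\<bar>" "\<bar>s\<bar> < 1 / real (Suc (m k))" for s k
      proof (rule LIMSEQ_le_const2)
        show "(\<lambda>n. \<bar>q e s x - a n\<bar>) \<longlonglongrightarrow> \<bar>q e s x - D\<bar>" using D by (intro tendsto_intros)
        show "\<exists>M. \<forall>n\<ge>M. \<bar>q e s x - a n\<bar> \<le> 1 / real (Suc k)"
          unfolding a_def using s by (intro exI[of _ "m k"] allI impI AD m small) auto
      qed
      show ?thesis
      proof (rule exI[of _ D], intro allI impI)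
        fix \<epsilon> :: real assume "\<epsilon> > 0"
        then obtain k where k: "1 / real (Suc k) < \<epsilon> / 3"
          using reals_Archimedean[of "\<epsilon> / 3"] by (auto simp: inverse_eq_divide)
        define \<kappa> where "\<kappa> = 1 / real (Suc k)"
        define \<tau> where "\<tau> = 1 / real (Suc (m k))"
        have \<tau>: "\<tau> > 0" by (simp add: \<tau>_def)
        have \<kappa>: "\<kappa> > 0" "3 * \<kappa> \<le> \<epsilon>" using k by (auto simp: \<kappa>_def)
        \<comment> \<open>The fixed step \<open>\<tau>/2\<close> links base points: at
          \<open>z\<close> its quotient is within \<kappa> of the one with step \<open>r\<close>, it
          is continuous in the base point, and at \<open>x\<close> it is within \<kappa> of
          \<open>D\<close>.\<close>
        obtain d1 where d1: "d1 > 0" "\<And>y. norm (y - x) < d1 \<Longrightarrow> \<bar>q e (\<tau>/2) y - q e (\<tau>/2) x\<bar> < \<kappa>"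
          using contq[where e = e and t = "\<tau>/2" and y = x] \<kappa>(1) unfolding continuous_within_eps_delta[of x UNIV]
        by (auto simp: dist_norm)
        \<comment> \<open>Replacing \<open>y\<close> by a point \<open>z\<close> of the closed set
          alters two values of \<open>f\<close>, at a total cost of \<open>2 * K * \<eta>\<close>
          times the distance from \<open>y\<close> to \<open>x\<close>.\<close>
        define \<eta> where "\<eta> = min 1 (\<epsilon> / (2 * K))"
        have \<eta>: "\<eta> > 0" "\<eta> \<le> 1" using \<open>\<epsilon> > 0\<close> K by (auto simp: \<eta>_def)
        have "\<eta> \<le> \<epsilon> / (2 * K)" by (simp add: \<eta>_def)
        then have \<eta>K: "2 * (K * \<eta>) \<le> \<epsilon>" using K by (simp add: pos_le_divide_eq mult.commute mult.left_commute)
        obtain d2 where d2: "d2 > 0" "\<And>y. norm (y - x) < d2 \<Longrightarrow> \<exists>z\<in>A e k (m k). norm (z - y) \<le> \<eta> * norm (y - x)"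
          using m(2)[of k] \<eta>(1) unfolding solid_at_def dist_norm by blast
        show "\<exists>d>0. \<forall>y r. norm (y - x) < d \<longrightarrow> \<bar>r\<bar> < d \<longrightarrow>
            \<bar>f (y + r *\<^sub>R e) - f y - r * D\<bar> \<le> \<epsilon> * (\<bar>r\<bar> + norm (y - x))"
        proof (intro exI[of _ "min (d1/2) (min d2 \<tau>)"] conjI allI impI)
          fix y r assume y: "norm (y - x) < min (d1/2) (min d2 \<tau>)" and r: "\<bar>r\<bar> < min (d1/2) (min d2 \<tau>)"
          show "\<bar>f (y + r *\<^sub>R e) - f y - r * D\<bar> \<le> \<epsilon> * (\<bar>r\<bar> + norm (y - x))"
          proof (cases "r = 0")
            case False
            obtain z where z: "z \<in> A e k (m k)" "norm (z - y) \<le> \<eta> * norm (y - x)"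
              using d2(2)[of y] y by auto
            have "\<eta> * norm (y - x) \<le> norm (y - x)"
              using \<eta> by (simp add: mult_left_le_one_le)
            then have "norm (z - x) \<le> 2 * norm (y - x)"
              using z(2) norm_triangle_ineq[of "z - y" "y - x"] by simp
            then have "norm (z - x) < d1" using y by simp
            then have 1: "\<bar>q e (\<tau>/2) z - q e (\<tau>/2) x\<bar> < \<kappa>" by (rule d1)
            have 2: "\<bar>q e r z - q e (\<tau>/2) z\<bar> \<le> \<kappa>"
              unfolding \<kappa>_def by (rule AD[OF z(1)]) (use False r \<tau> in \<open>simp_all del: of_nat_Suc add: \<tau>_def[symmetric]\<close>)
            have 3: "\<bar>q e (\<tau>/2) x - D\<bar> \<le> \<kappa>"
              unfolding \<kappa>_def by (rule qD) (use \<tau> in \<open>simp_all del: of_nat_Suc add: \<tau>_def[symmetric]\<close>)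
            have "\<bar>q e r z - D\<bar> \<le> \<epsilon>" using 1 2 3 \<kappa>(2) by linarith
            moreover have "f (z + r *\<^sub>R e) - f z - r * D = r * (q e r z - D)"
              using False by (simp add: q_def field_simps)
            ultimately have 4: "\<bar>f (z + r *\<^sub>R e) - f z - r * D\<bar> \<le> \<epsilon> * \<bar>r\<bar>"
              by (simp add: abs_mult mult.commute[of \<epsilon>] mult_left_mono)
            have "\<bar>f (y + r *\<^sub>R e) - f (z + r *\<^sub>R e)\<bar> \<le> K * norm (z - y)" "\<bar>f y - f z\<bar> \<le> K * norm (z - y)"
              using lipK[of "y + r *\<^sub>R e" "z + r *\<^sub>R e"] lipK[of y z] by (auto simp: norm_minus_commute)
            moreover have "K * norm (z - y) \<le> K * \<eta> * norm (y - x)"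
              using z(2) K by (simp add: mult.assoc mult_left_mono)
            moreover have "2 * (K * \<eta>) * norm (y - x) \<le> \<epsilon> * norm (y - x)"
              using \<eta>K by (rule mult_right_mono) simp
            ultimately show ?thesis using 4 by (simp add: distrib_left)
          qed (use \<open>\<epsilon> > 0\<close> in simp)
        qed (use d1 d2 \<tau> in auto)
      qed
    qed
    then obtain D where D: "\<And>e \<epsilon>. e \<in> Basis \<Longrightarrow> \<epsilon> > 0 \<Longrightarrow> \<exists>d>0. \<forall>y r. norm (y - x) < d \<longrightarrow> \<bar>r\<bar> < d \<longrightarrow>
        \<bar>f (y + r *\<^sub>R e) - f y - r * D e\<bar> \<le> \<epsilon> * (\<bar>r\<bar> + norm (y - x))"
      by metis
    define n where "n = real DIM('a)"
    have n: "n \<ge> 1" using DIM_positive[where 'a='a] unfolding n_def by linarith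
    have part: "\<exists>d>0. \<forall>h. norm h < d \<longrightarrow>
        \<bar>f (x + (\<Sum>e\<in>S. (h \<bullet> e) *\<^sub>R e)) - f x - (\<Sum>e\<in>S. (h \<bullet> e) * D e)\<bar> \<le> \<epsilon> * norm h"
      if "finite S" "S \<subseteq> Basis" "\<epsilon> > 0" for S \<epsilon>
      using that
    proof (induction S arbitrary: \<epsilon> rule: finite_induct)
      case empty
      then show ?case by (intro exI[of _ 1]) auto
    next
      case (insert e S)
      obtain d1 where d1: "d1 > 0" "\<And>h. norm h < d1 \<Longrightarrow>
          \<bar>f (x + (\<Sum>e\<in>S. (h \<bullet> e) *\<^sub>R e)) - f x - (\<Sum>e\<in>S. (h \<bullet> e) * D e)\<bar> \<le> (\<epsilon> / 2) * norm h"
        using insert.IH[of "\<epsilon> / 2"] insert.prems by auto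
      \<comment> \<open>After the earlier coordinates the base point is at distance at most
        \<open>n * norm h\<close>, so the new step costs
        \<open>\<epsilon>' * (1 + n) * norm h\<close>, half of the allowance.\<close>
      define \<epsilon>' where "\<epsilon>' = \<epsilon> / (2 * (1 + n))"
      have \<epsilon>': "\<epsilon>' > 0" using insert.prems n by (simp add: \<epsilon>'_def)
      obtain d2 where d2: "d2 > 0" "\<And>y r. norm (y - x) < d2 \<Longrightarrow> \<bar>r\<bar> < d2 \<Longrightarrow>
          \<bar>f (y + r *\<^sub>R e) - f y - r * D e\<bar> \<le> \<epsilon>' * (\<bar>r\<bar> + norm (y - x))"
        using D[of e \<epsilon>'] insert.prems \<epsilon>' by auto
      show ?case
      proof (intro exI[of _ "min d1 (d2 / n)"] conjI allI impI)
        fix h :: 'a assume h: "norm h < min d1 (d2 / n)"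
        define y where "y = x + (\<Sum>e\<in>S. (h \<bullet> e) *\<^sub>R e)"
        have "norm (y - x) \<le> (\<Sum>e\<in>S. norm h)"
          unfolding y_def add_diff_cancel_left'
          by (rule sum_norm_le) (use insert.prems(1) in \<open>auto simp: Basis_le_norm\<close>)
        also have "\<dots> \<le> n * norm h"
          using insert.prems(1) card_mono[of Basis S] by (auto simp: n_def intro!: mult_right_mono)
        finally have yx: "norm (y - x) \<le> n * norm h" .
        have he: "\<bar>h \<bullet> e\<bar> \<le> norm h" using insert.prems(1) by (simp add: Basis_le_norm)
        have nh: "n * norm h < d2" using h n by (simp add: pos_less_divide_eq mult.commute)
        moreover have "norm h \<le> n * norm h" using n by (simp add: mult_le_cancel_right1)
        ultimately have "\<bar>f (y + (h \<bullet> e) *\<^sub>R e) - f y - (h \<bullet> e) * D e\<bar> \<le> \<epsilon>' * (\<bar>h \<bullet> e\<bar> + norm (y - x))"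
          using yx he by (intro d2) auto
        also have "\<dots> \<le> \<epsilon>' * (norm h + n * norm h)"
          using \<epsilon>' yx he by (intro mult_left_mono) auto
        also have "\<dots> = (\<epsilon> / 2) * norm h"
          using n by (simp add: \<epsilon>'_def field_simps)
        finally have "\<bar>f (y + (h \<bullet> e) *\<^sub>R e) - f y - (h \<bullet> e) * D e\<bar> \<le> (\<epsilon> / 2) * norm h" .
        moreover have "\<bar>f y - f x - (\<Sum>e\<in>S. (h \<bullet> e) * D e)\<bar> \<le> (\<epsilon> / 2) * norm h"
          unfolding y_def using h by (intro d1) auto
        moreover have 1: "x + (\<Sum>e\<in>insert e S. (h \<bullet> e) *\<^sub>R e) = y + (h \<bullet> e) *\<^sub>R e"
          using insert.hyps by (simp add: y_def)
        moreover have 2: "(\<Sum>e\<in>insert e S. (h \<bullet> e) * D e) = (h \<bullet> e) * D e + (\<Sum>e\<in>S. (h \<bullet> e) * D e)"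
          using insert.hyps by simp
        moreover have "\<epsilon> * norm h = (\<epsilon> / 2) * norm h + (\<epsilon> / 2) * norm h" by simp
        ultimately show "\<bar>f (x + (\<Sum>e\<in>insert e S. (h \<bullet> e) *\<^sub>R e)) - f x - (\<Sum>e\<in>insert e S. (h \<bullet> e) * D e)\<bar> \<le> \<epsilon> * norm h"
          unfolding 1 2 by linarith
      qed (use d1 d2 n in auto)
    qed
    have "(f has_derivative (\<lambda>h. \<Sum>e\<in>Basis. (h \<bullet> e) * D e)) (at x)"
      unfolding has_derivative_at_alt
    proof (intro conjI allI impI)
      show "bounded_linear (\<lambda>h. \<Sum>e\<in>Basis. (h \<bullet> e) * D e)"
        by (intro bounded_linear_sum bounded_linear_mult_const bounded_linear_inner_left)
      fix \<epsilon> :: real assume "\<epsilon> > 0"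
      then obtain d where d: "d > 0" "\<And>h. norm h < d \<Longrightarrow>
          \<bar>f (x + (\<Sum>e\<in>Basis. (h \<bullet> e) *\<^sub>R e)) - f x - (\<Sum>e\<in>Basis. (h \<bullet> e) * D e)\<bar> \<le> \<epsilon> * norm h"
        using part[of Basis \<epsilon>] by auto
      show "\<exists>d>0. \<forall>y. norm (y - x) < d \<longrightarrow>
          norm (f y - f x - (\<Sum>e\<in>Basis. ((y - x) \<bullet> e) * D e)) \<le> \<epsilon> * norm (y - x)"
        using d(2)[of "y - x" for y] by (intro exI[of _ d]) (simp add: euclidean_representation d(1))
    qed
    then show ?thesis by (auto simp: differentiable_def)
  qed
  ultimately show ?thesis by (blast intro: negligible_subset)
qed

section \<open>Extension of Lipschitz maps from a subset\<close>

lemma mcshane_extension: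
  fixes g :: "'a::metric_space \<Rightarrow> real"
  assumes lip: "\<And>x y. x \<in> E \<Longrightarrow> y \<in> E \<Longrightarrow> \<bar>g x - g y\<bar> \<le> L * dist x y" and "0 \<le> L" "E \<noteq> {}"
  obtains f where "\<And>x y. \<bar>f x - f y\<bar> \<le> L * dist x y" "\<And>x. x \<in> E \<Longrightarrow> f x = g x"
proof
  define f where "f x = (INF z\<in>E. g z + L * dist x z)" for x
  have bdd: "bdd_below ((\<lambda>z. g z + L * dist x z) ` E)" for x
  proof -
    obtain z0 where z0: "z0 \<in> E" using \<open>E \<noteq> {}\<close> by blast
    have "g z0 - L * dist x z0 \<le> g z + L * dist x z" if "z \<in> E" for z
    proof -
      have "L * dist z0 z \<le> L * (dist x z0 + dist x z)"
        using \<open>0 \<le> L\<close> by (intro mult_left_mono) (auto simp: dist_triangle3)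
      then show ?thesis using lip[OF z0 that] by (simp add: algebra_simps)
    qed
    then show ?thesis by (auto simp: bdd_below_def)
  qed
  have le: "f x \<le> f y + L * dist x y" for x y
  proof -
    have "f x - L * dist x y \<le> f y"
      unfolding f_def[of y]
    proof (rule cINF_greatest)
      fix z assume z: "z \<in> E"
      have "f x \<le> g z + L * dist x z" unfolding f_def by (rule cINF_lower[OF bdd z])
      moreover have "L * dist x z \<le> L * (dist x y + dist y z)"
        using \<open>0 \<le> L\<close> by (intro mult_left_mono dist_triangle)
      ultimately show "f x - L * dist x y \<le> g z + L * dist y z" by (simp add: algebra_simps)
    qed fact
    then show ?thesis by simp
  qed
  show "\<bar>f x - f y\<bar> \<le> L * dist x y" for x y
    using le[of x y] le[of y x] by (simp add: dist_commute abs_le_iff)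
  show "f x = g x" if x: "x \<in> E" for x
  proof (rule antisym)
    show "f x \<le> g x" using cINF_lower[OF bdd x, of x] by (simp add: f_def)
    show "g x \<le> f x"
      unfolding f_def
    proof (rule cINF_greatest)
      show "g x \<le> g z + L * dist x z" if "z \<in> E" for z using lip[OF x that] by simp
    qed fact
  qed
qed

text \<open>Rademacher's theorem asks for a map on the whole space, while the slope will be
  meaningful on the contact set alone; its coordinates are extended one at a time.\<close>

lemma lipschitz_extension_differentiable_ae:
  fixes P :: "'a::euclidean_space \<Rightarrow> 'b::euclidean_space"
  assumes lip: "\<And>x y. x \<in> E \<Longrightarrow> y \<in> E \<Longrightarrow> norm (P x - P y) \<le> L * norm (x - y)"
    and L: "0 \<le> L" and E: "E \<noteq> {}"
  obtains G where "\<And>x. x \<in> E \<Longrightarrow> G x = P x" "negligible {x. \<not> G differentiable (at x)}"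
proof -
  have "\<exists>f. (\<forall>x y. \<bar>f x - f y\<bar> \<le> L * dist x y) \<and> (\<forall>x\<in>E. f x = P x \<bullet> i)" if i: "i \<in> Basis" for i
  proof -
    have "\<bar>P x \<bullet> i - P y \<bullet> i\<bar> \<le> L * dist x y" if "x \<in> E" "y \<in> E" for x y
      using Basis_le_norm[OF i, of "P x - P y"] lip[OF that] by (simp add: inner_diff_left dist_norm)
    then show ?thesis using mcshane_extension[of E "\<lambda>x. P x \<bullet> i" L] L E by metis
  qed
  then obtain f where f: "\<And>i x y. i \<in> Basis \<Longrightarrow> \<bar>f i x - f i y\<bar> \<le> L * dist x y"
     "\<And>i x. i \<in> Basis \<Longrightarrow> x \<in> E \<Longrightarrow> f i x = P x \<bullet> i" by metis
  define G where "G x = (\<Sum>i\<in>Basis. f i x *\<^sub>R i)" for x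
  show ?thesis
  proof
    show "G x = P x" if "x \<in> E" for x using f(2) that by (simp add: G_def euclidean_representation)
    have "G differentiable (at x)" if "\<And>i. i \<in> Basis \<Longrightarrow> f i differentiable (at x)" for x
      unfolding G_def using that by (intro differentiable_sum ballI differentiable_scaleR) auto
    then have "{x. \<not> G differentiable (at x)} \<subseteq> (\<Union>i\<in>Basis. {x. \<not> f i differentiable (at x)})" by blast
    moreover have "negligible (\<Union>i\<in>(Basis::'b set). {x. \<not> f i differentiable (at x)})"
      using f(1) by (intro negligible_Union) (auto intro!: rademacher[of _ L] simp: dist_norm)
    ultimately show "negligible {x. \<not> G differentiable (at x)}" by (rule negligible_subset[rotated])
  qed
qed

section \<open>Second order expansion of semiconvex functions near a maximum\<close>

text \<open>Semiconvexity bounds \<open>w y\<close> from below through the reflection of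
  \<open>y\<close> in \<open>x\<close>, and there the touching plane bounds \<open>w\<close> from
  above.\<close>

lemma contact_lower_bound:
  fixes w :: "'a::real_inner \<Rightarrow> real"
  assumes semi: "\<And>x h. 2 * w x - C * (norm h)\<^sup>2 \<le> w (x + h) + w (x - h)"
    and touch: "\<And>y. w y \<le> w x + p \<bullet> (y - x)"
  shows "w x + p \<bullet> (y - x) - C * (norm (y - x))\<^sup>2 \<le> w y"
  using semi[of x "y - x"] touch[of "x - (y - x)"] by (simp add: inner_diff_right)

text \<open>The parabola below \<open>w\<close> at \<open>x\<close> cannot cross the plane above
  \<open>w\<close> at \<open>x'\<close>. Moving from \<open>x'\<close> by \<open>s\<close> in the
  direction of \<open>p - p'\<close> separates the planes by \<open>s * norm (p - p')\<close>, while
  the parabola allows only \<open>C * (2 * s)^2\<close>. For \<open>x = x'\<close> this is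
  uniqueness of the slope.\<close>

lemma contact_slope_lipschitz:
  fixes w :: "'a::real_inner \<Rightarrow> real"
  assumes semi: "\<And>x h. 2 * w x - C * (norm h)\<^sup>2 \<le> w (x + h) + w (x - h)" and C: "0 \<le> C"
    and touch: "\<And>y. w y \<le> w x + p \<bullet> (y - x)" "\<And>y. w y \<le> w x' + p' \<bullet> (y - x')"
  shows "norm (p - p') \<le> 4 * C * norm (x - x')"
proof (cases "p = p'")
  case False
  define e where "e = (p - p') /\<^sub>R norm (p - p')"
  have e: "norm e = 1" "(p - p') \<bullet> e = norm (p - p')"
    using False by (auto simp: e_def dot_square_norm power2_eq_square)
  \<comment> \<open>Here \<open>s\<close> has to be positive, so the distance itself is reached only
    as a limit; this includes \<open>x = x'\<close>.\<close>
  have key: "norm (p - p') \<le> 4 * C * s" if s: "s > 0" "norm (x - x') \<le> s" for s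
  proof -
    define y where "y = x' + s *\<^sub>R e"
    have "w x + p \<bullet> (y - x) - C * (norm (y - x))\<^sup>2 \<le> w x' + p' \<bullet> (y - x')"
      using contact_lower_bound[of w C x p y, OF semi touch(1)] touch(2)[of y] by linarith
    moreover have "w x' \<le> w x + p \<bullet> (x' - x)" by (rule touch)
    moreover have "p \<bullet> (y - x) = p \<bullet> (y - x') + p \<bullet> (x' - x)" by (simp add: inner_diff_right)
    ultimately have "(p - p') \<bullet> (y - x') \<le> C * (norm (y - x))\<^sup>2" by (simp add: inner_diff_left)
    moreover have "(p - p') \<bullet> (y - x') = s * norm (p - p')" using e by (simp add: y_def)
    moreover have "norm (y - x) \<le> 2 * s"
      using norm_triangle_ineq[of "x' - x" "s *\<^sub>R e"] s e by (simp add: y_def norm_minus_commute algebra_simps)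
    then have "C * (norm (y - x))\<^sup>2 \<le> C * (2 * s)\<^sup>2"
      using C by (intro mult_left_mono power_mono) auto
    ultimately have "s * norm (p - p') \<le> s * (4 * C * s)" by (simp add: power2_eq_square mult_ac)
    then show ?thesis using s by simp
  qed
  show ?thesis
  proof (rule field_le_epsilon)
    fix \<epsilon> :: real assume "\<epsilon> > 0"
    define t where "t = \<epsilon> / (4 * C + 1)"
    have "t > 0" using \<open>\<epsilon> > 0\<close> C by (simp add: t_def)
    then have "norm (p - p') \<le> 4 * C * (norm (x - x') + t)" by (intro key) (auto intro: add_nonneg_pos)
    moreover have "4 * C * t \<le> \<epsilon>" using \<open>\<epsilon> > 0\<close> C by (simp add: t_def divide_simps)
    ultimately show "norm (p - p') \<le> 4 * C * norm (x - x') + \<epsilon>" by (simp add: distrib_left)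
  qed
qed (use C in auto)

lemma abs_telescope:
  fixes f :: "nat \<Rightarrow> real"
  assumes "\<And>i. i < m \<Longrightarrow> \<bar>f (Suc i) - f i\<bar> \<le> c" "f 0 = 0"
  shows "\<bar>f m\<bar> \<le> real m * c"
  using assms
proof (induction m)
  case (Suc m)
  have "\<bar>f m\<bar> \<le> real m * c" using Suc by auto
  moreover have "\<bar>f (Suc m) - f m\<bar> \<le> c" using Suc by auto
  ultimately show ?case by (simp add: algebra_simps)
qed simp

text \<open>\<open>G\<close> describes \<open>w\<close> only at points of \<open>E\<close>, so it
  cannot be integrated along the segment. The segment is cut into \<open>m\<close> pieces, and each
  increment is computed from a contact point within \<open>\<tau> * norm h\<close> of the piece's
  start. The contact error per piece is quadratic in \<open>\<tau> * norm h\<close>, so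
  \<open>m = 1 / \<tau>\<close> pieces together cost only the order of
  \<open>\<tau> * (norm h)^2\<close>.\<close>

lemma second_order_expansion:
  fixes w :: "'a::euclidean_space \<Rightarrow> real"
  assumes contact: "\<And>x y. x \<in> E \<Longrightarrow> \<bar>w y - w x - G x \<bullet> (y - x)\<bar> \<le> C * (norm (y - x))\<^sup>2"
    and C: "0 \<le> C" and x0: "x0 \<in> E" "solid_at E x0" and G: "(G has_derivative A) (at x0)"
    and \<epsilon>: "\<epsilon> > 0"
  shows "\<exists>d>0. \<forall>h. norm h < d \<longrightarrow>
    \<bar>w (x0 + h) - w x0 - G x0 \<bullet> h - 1/2 * (h \<bullet> A h)\<bar> \<le> \<epsilon> * (norm h)\<^sup>2"
proof -
  interpret A: bounded_linear A using G by (rule has_derivative_bounded_linear)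
  obtain B where B: "B \<ge> 0" "\<And>h. norm (A h) \<le> B * norm h"
    using A.nonneg_bounded by (auto simp: mult.commute)
  \<comment> \<open>\<open>5 * C\<close> collects the contact errors at the two ends of a piece,
    \<open>C\<close> and \<open>4 * C\<close>. \<open>2 * B\<close> covers \<open>3/2 * B\<close>,
    which stems from the displaced contact point and from the term
    \<open>\<tau>^2 / 2 * a\<close>.\<close>
  obtain m' where m': "(5 * C + 2 * B) * 2 / \<epsilon> < real m'" using reals_Archimedean2 by blast
  define m where "m = Suc m'"
  define \<tau> where "\<tau> = 1 / real m"
  have \<tau>: "0 < \<tau>" "\<tau> \<le> 1" "real m * \<tau> = 1" by (auto simp: \<tau>_def m_def)
  have "(5 * C + 2 * B) * 2 < \<epsilon> * real m" using m' \<epsilon> by (simp add: m_def pos_divide_less_eq algebra_simps)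
  then have \<tau>\<epsilon>: "(5 * C + 2 * B) * \<tau> \<le> \<epsilon> / 2" by (simp add: \<tau>_def m_def divide_simps)
  obtain d1 where d1: "d1 > 0" "\<And>y. norm (y - x0) < d1 \<Longrightarrow> \<exists>z\<in>E. norm (z - y) \<le> \<tau> * norm (y - x0)"
    using x0(2) \<tau>(1) unfolding solid_at_def dist_norm by blast
  obtain d2 where d2: "d2 > 0" "\<And>y. norm (y - x0) < d2 \<Longrightarrow>
      norm (G y - G x0 - A (y - x0)) \<le> (\<epsilon> / 4) * norm (y - x0)"
    using G \<epsilon> unfolding has_derivative_at_alt by (meson divide_pos_pos zero_less_numeral)
  show ?thesis
  proof (intro exI[of _ "min d1 (d2/2)"] conjI allI impI)
    fix h :: 'a assume h: "norm h < min d1 (d2/2)"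
    define a where "a = h \<bullet> A h"
    \<comment> \<open>Deviation from the expected Taylor polynomial along the segment; it vanishes
      at 0 and is wanted at 1.\<close>
    define g where "g s = w (x0 + s *\<^sub>R h) - w x0 - s * (G x0 \<bullet> h) - s\<^sup>2 / 2 * a" for s
    have a: "\<bar>a\<bar> \<le> B * (norm h)\<^sup>2"
      using Cauchy_Schwarz_ineq2[of h "A h"] mult_left_mono[OF B(2)[of h] norm_ge_zero[of h]]
      by (simp add: a_def power2_eq_square mult_ac)
    have step: "\<bar>g (s + \<tau>) - g s\<bar> \<le> \<tau> * (\<epsilon> * (norm h)\<^sup>2)" if s: "0 \<le> s" "s \<le> 1" for s
    proof -
      have sh: "norm (s *\<^sub>R h) \<le> norm h" using s by (simp add: mult_left_le_one_le)
      then obtain x where x: "x \<in> E" "norm (x - (x0 + s *\<^sub>R h)) \<le> \<tau> * norm (s *\<^sub>R h)"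
        using d1(2)[of "x0 + s *\<^sub>R h"] h by auto
      define k where "k = x - (x0 + s *\<^sub>R h)"
      have k: "norm k \<le> \<tau> * norm h"
        using x(2) mult_left_mono[OF sh, of \<tau>] \<tau> unfolding k_def by linarith
      have xx: "x - x0 = s *\<^sub>R h + k" by (simp add: k_def)
      have "\<tau> * norm h \<le> norm h" using \<tau> by (simp add: mult_left_le_one_le)
      then have nx: "norm (x - x0) \<le> 2 * norm h"
        unfolding xx using norm_triangle_ineq[of "s *\<^sub>R h" k] sh k by linarith
      define r where "r = G x - G x0 - A (x - x0)"
      have "norm r \<le> (\<epsilon> / 4) * norm (x - x0)" unfolding r_def using nx h by (intro d2) auto
      also have "\<dots> \<le> (\<epsilon> / 4) * (2 * norm h)" using nx \<epsilon> by (intro mult_left_mono) auto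
      finally have r: "norm r \<le> (\<epsilon> / 2) * norm h" by simp
      have c1: "\<bar>w (x0 + s *\<^sub>R h) - w x - G x \<bullet> (- k)\<bar> \<le> C * (\<tau> * norm h)\<^sup>2"
      proof -
        have "C * (norm k)\<^sup>2 \<le> C * (\<tau> * norm h)\<^sup>2" using k C by (intro mult_left_mono power_mono) auto
        then show ?thesis using contact[OF x(1), of "x0 + s *\<^sub>R h"] by (simp add: k_def norm_minus_commute)
      qed
      have c2: "\<bar>w (x0 + (s + \<tau>) *\<^sub>R h) - w x - G x \<bullet> (\<tau> *\<^sub>R h - k)\<bar> \<le> C * (2 * (\<tau> * norm h))\<^sup>2"
      proof -
        have "norm (\<tau> *\<^sub>R h - k) \<le> 2 * (\<tau> * norm h)"
          using norm_triangle_ineq4[of "\<tau> *\<^sub>R h" k] k \<tau> by simp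
        then have "C * (norm (\<tau> *\<^sub>R h - k))\<^sup>2 \<le> C * (2 * (\<tau> * norm h))\<^sup>2"
          using C by (intro mult_left_mono power_mono) auto
        moreover have "x0 + (s + \<tau>) *\<^sub>R h - x = \<tau> *\<^sub>R h - k" by (simp add: k_def algebra_simps)
        ultimately show ?thesis using contact[OF x(1), of "x0 + (s + \<tau>) *\<^sub>R h"] by simp
      qed
      have Gx: "G x \<bullet> h = G x0 \<bullet> h + s * a + A k \<bullet> h + r \<bullet> h"
      proof -
        have "G x = G x0 + (s *\<^sub>R A h + A k) + r"
          unfolding r_def xx by (simp add: A.add A.scaleR)
        then show ?thesis by (simp add: inner_add_left a_def inner_commute[of h])
      qed
      have "norm (A k) \<le> B * (\<tau> * norm h)"
        using B(2)[of k] mult_left_mono[OF k B(1)] by linarith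
      then have Ak: "\<bar>A k \<bullet> h\<bar> \<le> B * \<tau> * (norm h)\<^sup>2"
        using Cauchy_Schwarz_ineq2[of "A k" h] mult_right_mono[of "norm (A k)" "B * (\<tau> * norm h)" "norm h"]
        by (simp add: power2_eq_square mult_ac)
      have rh: "\<bar>r \<bullet> h\<bar> \<le> \<epsilon> / 2 * (norm h)\<^sup>2"
        using Cauchy_Schwarz_ineq2[of r h] mult_right_mono[OF r norm_ge_zero[of h]]
        by (simp add: power2_eq_square mult_ac)
      have "g (s + \<tau>) - g s = (w (x0 + (s + \<tau>) *\<^sub>R h) - w x - G x \<bullet> (\<tau> *\<^sub>R h - k))
          - (w (x0 + s *\<^sub>R h) - w x - G x \<bullet> (- k)) + \<tau> * (A k \<bullet> h + r \<bullet> h) - \<tau>\<^sup>2 / 2 * a"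
        unfolding g_def inner_diff_right inner_scaleR_right Gx inner_minus_right
        by (simp add: power2_eq_square field_simps)
      moreover have "\<bar>\<tau> * (A k \<bullet> h + r \<bullet> h)\<bar> \<le> \<tau> * (B * \<tau> * (norm h)\<^sup>2 + \<epsilon> / 2 * (norm h)\<^sup>2)"
        using Ak rh \<tau> by (simp add: abs_mult)
      moreover have "\<bar>\<tau>\<^sup>2 / 2 * a\<bar> \<le> \<tau>\<^sup>2 / 2 * (B * (norm h)\<^sup>2)"
        using a \<tau> by (simp add: abs_mult mult_left_mono)
      ultimately have "\<bar>g (s + \<tau>) - g s\<bar> \<le> C * (2 * (\<tau> * norm h))\<^sup>2 + C * (\<tau> * norm h)\<^sup>2
          + \<tau> * (B * \<tau> * (norm h)\<^sup>2 + \<epsilon> / 2 * (norm h)\<^sup>2) + \<tau>\<^sup>2 / 2 * (B * (norm h)\<^sup>2)"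
        using c1 c2 by linarith
      also have "\<dots> = \<tau> * ((norm h)\<^sup>2 * ((5 * C + 3/2 * B) * \<tau> + \<epsilon> / 2))"
        by (simp add: power2_eq_square algebra_simps)
      also have "\<dots> \<le> \<tau> * ((norm h)\<^sup>2 * \<epsilon>)"
      proof (intro mult_left_mono)
        have "(5 * C + 3/2 * B) * \<tau> \<le> (5 * C + 2 * B) * \<tau>" using \<tau> B(1) by (intro mult_right_mono) auto
        then show "(5 * C + 3/2 * B) * \<tau> + \<epsilon> / 2 \<le> \<epsilon>" using \<tau>\<epsilon> by linarith
      qed (use \<tau> in auto)
      finally show ?thesis by (simp add: mult.commute)
    qed
    have "\<bar>g (real m * \<tau>)\<bar> \<le> real m * (\<tau> * (\<epsilon> * (norm h)\<^sup>2))"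
    proof (rule abs_telescope[of m "\<lambda>i. g (real i * \<tau>)"])
      fix i assume "i < m"
      then have "real i * \<tau> \<le> real m * \<tau>" using \<tau> by (intro mult_right_mono) auto
      then have "real i * \<tau> \<le> 1" "0 \<le> real i * \<tau>" using \<tau> by auto
      moreover have "real (Suc i) * \<tau> = real i * \<tau> + \<tau>" by (simp add: algebra_simps)
      ultimately show "\<bar>g (real (Suc i) * \<tau>) - g (real i * \<tau>)\<bar> \<le> \<tau> * (\<epsilon> * (norm h)\<^sup>2)"
        using step[of "real i * \<tau>"] by simp
    qed (simp add: g_def)
    then show "\<bar>w (x0 + h) - w x0 - G x0 \<bullet> h - 1/2 * (h \<bullet> A h)\<bar> \<le> \<epsilon> * (norm h)\<^sup>2"
      using \<tau>(3) by (simp add: mult.assoc[symmetric]) (simp add: g_def a_def)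
  qed (use d1 d2 in auto)
qed

text \<open>Alexandrov's theorem combined with Jensen's lemma. Coercivity plays the part of a
  bounded domain: it confines the contact points of all small slopes to one ball, so every small
  slope occurs and the points of contact are almost maximal.\<close>

theorem semiconvex_near_maximum:
  fixes w :: "'a::euclidean_space \<Rightarrow> real"
  assumes cont: "continuous_on UNIV w"
    and semi: "\<And>x h. 2 * w x - C * (norm h)\<^sup>2 \<le> w (x + h) + w (x - h)" and C: "0 \<le> C"
    and coercive: "\<And>x. w x \<le> c0 - c1 * (norm x)\<^sup>2" "0 < c1" and \<delta>: "0 < \<delta>"
  obtains x0 p A where "\<And>y. w y \<le> w x0 + \<delta>" "norm p \<le> \<delta>" "bounded_linear A" "\<And>h. h \<bullet> A h \<le> 0"
    "\<And>\<epsilon>. \<epsilon> > 0 \<Longrightarrow> \<exists>d>0. \<forall>h. norm h < d \<longrightarrow>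
      \<bar>w (x0 + h) - w x0 - p \<bullet> h - 1/2 * (h \<bullet> A h)\<bar> \<le> \<epsilon> * (norm h)\<^sup>2"
proof -
  \<comment> \<open>Outside radius \<open>R\<close> the function lies below
    \<open>w 0 - norm x\<close>, so no plane of slope at most 1 can touch there.\<close>
  define R where "R = (1 + \<bar>c0 - w 0\<bar>) / c1 + 1"
  have R: "R \<ge> 1" using coercive(2) by (simp add: R_def)
  have far: "w x < w 0 - norm x" if "norm x > R" for x
  proof -
    define r where "r = norm x"
    have "c1 * r > c1 * R" using that coercive(2) by (simp add: r_def)
    moreover have "c1 * R = 1 + \<bar>c0 - w 0\<bar> + c1" using coercive(2) by (simp add: R_def field_simps)
    ultimately have "c1 * r - 1 > \<bar>c0 - w 0\<bar>" using coercive(2) by linarith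
    moreover have "r > 1" using that R by (simp add: r_def)
    ultimately have "r * (c1 * r - 1) > 1 * \<bar>c0 - w 0\<bar>" by (intro mult_strict_mono) auto
    then show ?thesis using coercive(1)[of x] by (simp add: r_def[symmetric] algebra_simps power2_eq_square abs_less_iff)
  qed
  \<comment> \<open>The bound 1 serves \<open>far\<close>, and \<open>\<delta> / (2 * R)\<close>
    keeps the rise of a touching plane over the ball of radius \<open>R\<close> below
    \<delta>.\<close>
  define \<rho> where "\<rho> = min (min 1 \<delta>) (\<delta> / (2 * R))"
  have \<rho>: "\<rho> > 0" "\<rho> \<le> 1" "\<rho> \<le> \<delta>" using \<delta> R by (auto simp: \<rho>_def)
  have "\<rho> \<le> \<delta> / (2 * R)" by (simp add: \<rho>_def)
  then have \<rho>R: "\<rho> * (2 * R) \<le> \<delta>" using R by (simp add: pos_le_divide_eq)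
  define T where "T x p \<longleftrightarrow> norm p \<le> \<rho> \<and> (\<forall>y. w y \<le> w x + p \<bullet> (y - x))" for x p
  define E where "E = {x. \<exists>p. T x p}"
  have TR: "norm x \<le> R" if "T x p" for x p
  proof (rule ccontr)
    assume "\<not> norm x \<le> R"
    then have "w x < w 0 - norm x" by (intro far) auto
    moreover have "w 0 \<le> w x + p \<bullet> (0 - x)" using that unfolding T_def by blast
    moreover have "p \<bullet> (0 - x) \<le> 1 * norm x"
      using norm_cauchy_schwarz[of p "0 - x"] that \<rho>(2) mult_right_mono[of "norm p" 1 "norm x"] by (simp add: T_def)
    ultimately show False by linarith
  qed
  have ex: "\<exists>x. T x p" if p: "norm p \<le> \<rho>" for p
  proof -
    have "\<exists>x\<in>cball 0 R. \<forall>y\<in>cball 0 R. w y - p \<bullet> y \<le> w x - p \<bullet> x"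
      using R by (intro continuous_attains_sup continuous_intros continuous_on_subset[OF cont]) auto
    then obtain x where "\<forall>y\<in>cball 0 R. w y - p \<bullet> y \<le> w x - p \<bullet> x" by blast
    then have x: "w y - p \<bullet> y \<le> w x - p \<bullet> x" if "norm y \<le> R" for y using that by simp
    have "w y - p \<bullet> y \<le> w x - p \<bullet> x" for y
    proof (cases "norm y \<le> R")
      case False
      have "- (p \<bullet> y) \<le> 1 * norm y"
        using norm_cauchy_schwarz[of "-p" y] p \<rho>(2) mult_right_mono[of "norm p" 1 "norm y"] by simp
      then have "w y - p \<bullet> y \<le> w 0" using far[of y] False by simp
      also have "\<dots> \<le> w x - p \<bullet> x" using x[of 0] R by simp
      finally show ?thesis .
    qed (rule x)
    then show ?thesis using p by (auto simp: T_def inner_diff_right algebra_simps intro!: exI[of _ x])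
  qed
  have closedE: "closed E"
  proof -
    \<comment> \<open>Contact pairs of point and slope form a compact set, and \<open>E\<close> is
      its projection. Closedness of \<open>E\<close> is what \<open>negligible_not_solid\<close>
      requires.\<close>
    define Z where "Z = {z. \<forall>y. w y \<le> w (fst z) + snd z \<bullet> (y - fst z)}"
    have "closed Z"
      unfolding Z_def
      by (intro closed_Collect_all closed_Collect_le continuous_intros continuous_on_compose2[OF cont]) auto
    then have "compact ((cball 0 R \<times> cball 0 \<rho>) \<inter> Z)"
      by (intro compact_Int_closed compact_Times compact_cball)
    then have "compact (fst ` ((cball 0 R \<times> cball 0 \<rho>) \<inter> Z))"
      by (intro compact_continuous_image continuous_intros)
    moreover have "E = fst ` ((cball 0 R \<times> cball 0 \<rho>) \<inter> Z)"
      using TR by (force simp: E_def Z_def T_def image_iff)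
    ultimately show ?thesis by (simp add: compact_imp_closed)
  qed
  define P where "P x = (SOME p. T x p)" for x
  have TP: "T x (P x)" if "x \<in> E" for x
    using that unfolding E_def P_def by (auto intro: someI)
  have lip: "norm (p - p') \<le> 4 * C * norm (x - x')" if "T x p" "T x' p'" for x x' p p'
    using that by (intro contact_slope_lipschitz[OF semi C]) (auto simp: T_def)
  have uniq: "P x = p" if "T x p" for x p
  proof -
    have "T x (P x)" using that by (intro TP) (auto simp: E_def)
    then show ?thesis using lip[OF _ that, of x "P x"] by simp
  qed
  have "E \<noteq> {}" using ex[of 0] \<rho> by (auto simp: E_def)
  obtain G where G: "\<And>x. x \<in> E \<Longrightarrow> G x = P x" "negligible {x. \<not> G differentiable (at x)}"
  proof (rule lipschitz_extension_differentiable_ae[of E P "4 * C"])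
    show "norm (P x - P y) \<le> 4 * C * norm (x - y)" if "x \<in> E" "y \<in> E" for x y
      using that by (intro lip TP)
  qed (use C \<open>E \<noteq> {}\<close> in auto)
  define N where "N = E \<inter> ({x. \<not> G differentiable (at x)} \<union> {x\<in>E. \<not> solid_at E x})"
  have "negligible N"
    unfolding N_def by (intro negligible_Int negligible_Un G(2) negligible_not_solid[OF closedE] disjI2)
  then have "negligible (P ` N)"
  proof (rule negligible_locally_Lipschitz_image[rotated])
    show "\<exists>T B. open T \<and> x \<in> T \<and> (\<forall>y\<in>N \<inter> T. norm (P y - P x) \<le> B * norm (y - x))" if "x \<in> N" for x
      using that lip TP by (intro exI[of _ UNIV] exI[of _ "4 * C"]) (auto simp: N_def)
  qed simp
  moreover have "\<not> negligible (cball (0::'a) \<rho>)"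
    using open_not_negligible[of "ball (0::'a) \<rho>"] \<rho>(1) negligible_subset[OF _ ball_subset_cball] by auto
  ultimately have "\<not> cball 0 \<rho> \<subseteq> P ` N" using negligible_subset by blast
  then obtain p where "p \<in> cball 0 \<rho>" and p: "p \<notin> P ` N" by blast
  then have p: "norm p \<le> \<rho>" "p \<notin> P ` N" by simp_all
  obtain x0 where x0: "T x0 p" using ex p(1) by blast
  have "x0 \<in> E" "P x0 = p" using x0 uniq by (auto simp: E_def)
  then have "x0 \<notin> N" using p(2) by auto
  then obtain A where A: "(G has_derivative A) (at x0)" and sol: "solid_at E x0"
    using \<open>x0 \<in> E\<close> by (auto simp: N_def differentiable_def)
  have touch: "w y \<le> w x0 + p \<bullet> (y - x0)" for y using x0 by (auto simp: T_def)
  have expand: "\<exists>d>0. \<forall>h. norm h < d \<longrightarrow>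
      \<bar>w (x0 + h) - w x0 - p \<bullet> h - 1/2 * (h \<bullet> A h)\<bar> \<le> \<epsilon> * (norm h)\<^sup>2" if "\<epsilon> > 0" for \<epsilon>
  proof -
    have "\<bar>w y - w x - G x \<bullet> (y - x)\<bar> \<le> C * (norm (y - x))\<^sup>2" if "x \<in> E" for x y
    proof -
      have t: "\<And>y. w y \<le> w x + P x \<bullet> (y - x)" using TP[OF that] by (auto simp: T_def)
      have "0 \<le> C * (norm (y - x))\<^sup>2" using C by simp
      then show ?thesis using t[of y] contact_lower_bound[OF semi t, of y] G(1)[OF that] by (simp add: abs_le_iff)
    qed
    from second_order_expansion[OF this C \<open>x0 \<in> E\<close> sol A \<open>\<epsilon> > 0\<close>]
    show ?thesis using G(1) \<open>x0 \<in> E\<close> \<open>P x0 = p\<close> by simp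
  qed
  show ?thesis
  proof (rule that)
    show "w y \<le> w x0 + \<delta>" for y
    proof -
      have *: "w y \<le> w x0 + \<delta>" if "norm y \<le> R" for y
      proof -
        have "norm (y - x0) \<le> 2 * R" using norm_triangle_ineq4[of y x0] TR[OF x0] that by linarith
        then have "norm p * norm (y - x0) \<le> \<rho> * (2 * R)" using p(1) \<rho>(1) by (intro mult_mono) auto
        then show ?thesis using touch[of y] norm_cauchy_schwarz[of p "y - x0"] \<rho>R by linarith
      qed
      show ?thesis
      proof (cases "norm y \<le> R")
        case False
        then have "w y < w 0" using far[of y] norm_ge_zero[of y] by linarith
        then show ?thesis using *[of 0] R by simp
      qed (rule *)
    qed
    show "norm p \<le> \<delta>" using p \<rho> by simp
    show bl: "bounded_linear A" using A by (rule has_derivative_bounded_linear)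
    show "h \<bullet> A h \<le> 0" for h
    proof (cases "h = 0")
      case False
      show ?thesis
      proof (rule field_le_epsilon)
        fix e :: real assume "e > 0"
        define \<epsilon> where "\<epsilon> = e / (2 * (norm h)\<^sup>2)"
        have "\<epsilon> > 0" using \<open>e > 0\<close> False by (simp add: \<epsilon>_def)
        obtain d where d: "d > 0" "\<And>k. norm k < d \<Longrightarrow>
            \<bar>w (x0 + k) - w x0 - p \<bullet> k - 1/2 * (k \<bullet> A k)\<bar> \<le> \<epsilon> * (norm k)\<^sup>2"
          using expand[OF \<open>\<epsilon> > 0\<close>] by blast
        define t where "t = d / (2 * norm h)"
        have t: "t > 0" "norm (t *\<^sub>R h) < d" using d(1) False by (auto simp: t_def)
        have "A (t *\<^sub>R h) = t *\<^sub>R A h" using bl by (simp add: bounded_linear.linear linear_scale)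
        then have 1: "(t *\<^sub>R h) \<bullet> A (t *\<^sub>R h) = t\<^sup>2 * (h \<bullet> A h)" by (simp add: power2_eq_square)
        have 2: "(norm (t *\<^sub>R h))\<^sup>2 = t\<^sup>2 * (norm h)\<^sup>2" by (simp add: power_mult_distrib)
        have "w (x0 + t *\<^sub>R h) \<le> w x0 + p \<bullet> (t *\<^sub>R h)" using touch[of "x0 + t *\<^sub>R h"] by simp
        then have "1/2 * (t\<^sup>2 * (h \<bullet> A h)) \<le> \<epsilon> * (t\<^sup>2 * (norm h)\<^sup>2)"
          using d(2)[OF t(2)] unfolding 1 2 by linarith
        then have "t\<^sup>2 * (1/2 * (h \<bullet> A h)) \<le> t\<^sup>2 * (\<epsilon> * (norm h)\<^sup>2)"
          by (simp add: mult.left_commute)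
        then have "1/2 * (h \<bullet> A h) \<le> \<epsilon> * (norm h)\<^sup>2" using t(1) by simp
        then show "h \<bullet> A h \<le> 0 + e" using False by (simp add: \<epsilon>_def)
      qed
    qed simp
  qed (rule expand)
qed

section \<open>Sup-convolutions and the theorem on sums\<close>

lemma usc_on_add:
  assumes "usc_on S u" "usc_on S v"
  shows "usc_on S (\<lambda>x. u x + v x)"
  unfolding usc_on_def
proof (intro ballI allI impI)
  fix x r assume x: "x \<in> S" and r: "u x + v x < r"
  define e where "e = (r - (u x + v x)) / 2"
  have "\<forall>\<^sub>F y in at x within S. u y < u x + e"
    using assms(1) x r by (auto simp: usc_on_def e_def)
  moreover have "\<forall>\<^sub>F y in at x within S. v y < v x + e"
    using assms(2) x r by (auto simp: usc_on_def e_def)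
  ultimately show "\<forall>\<^sub>F y in at x within S. u y + v y < r"
    by eventually_elim (simp add: e_def field_simps)
qed

lemma continuous_on_imp_usc_on: "continuous_on S g \<Longrightarrow> usc_on S g"
  by (auto simp: usc_on_def continuous_on_def intro: order_tendstoD(2))

lemma usc_on_uminus: "usc_on S (\<lambda>x. - v x) \<longleftrightarrow> lsc_on S v"
  unfolding usc_on_def lsc_on_def
  by (intro ball_cong refl iffI allI impI; drule_tac x = "- r" in spec; simp add: minus_less_iff)

lemma usc_on_sequentially:
  assumes "usc_on S u" "x \<in> S" "\<And>n. X n \<in> S" "X \<longlonglongrightarrow> x" "u x < r"
  shows "\<forall>\<^sub>F n in sequentially. u (X n) < r"
proof -
  have "\<forall>\<^sub>F y in at x within S. u y < r" using assms by (auto simp: usc_on_def)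
  then obtain T where T: "open T" "x \<in> T" "\<And>y. y \<in> T \<Longrightarrow> y \<noteq> x \<Longrightarrow> y \<in> S \<Longrightarrow> u y < r"
    unfolding eventually_at_topological by blast
  have "\<forall>\<^sub>F n in sequentially. X n \<in> T" using assms(4) T(1,2) by (rule topological_tendstoD)
  then show ?thesis
    by eventually_elim (use T(3) assms(3,5) in metis)
qed

text \<open>Otherwise the relatively open sets \<open>{x\<in>K. u x < u y}\<close> cover
  \<open>K\<close>, but a best index of a finite subcover lies in none of its members.\<close>

lemma usc_on_attains_sup:
  assumes K: "compact K" "K \<noteq> {}" and u: "usc_on K u"
  shows "\<exists>x\<in>K. \<forall>y\<in>K. u y \<le> u x"
proof (rule ccontr)
  assume "\<not> ?thesis"
  then have "\<exists>y\<in>K. u x < u y" if "x \<in> K" for x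
    using that by (meson not_le)
  then have cov: "K \<subseteq> \<Union>((\<lambda>y. {x\<in>K. u x < u y}) ` K)" by blast
  have op: "openin (top_of_set K) {x\<in>K. u x < r}" for r
  proof (subst openin_subopen, intro ballI)
    fix x assume x: "x \<in> {x\<in>K. u x < r}"
    then have "\<forall>\<^sub>F y in at x within K. u y < r" using u by (auto simp: usc_on_def)
    then obtain T where T: "open T" "x \<in> T" "\<And>y. y \<in> T \<Longrightarrow> y \<noteq> x \<Longrightarrow> y \<in> K \<Longrightarrow> u y < r"
      unfolding eventually_at_topological by blast
    have "K \<inter> T \<subseteq> {x\<in>K. u x < r}" using T(3) x by auto
    then show "\<exists>T. openin (top_of_set K) T \<and> x \<in> T \<and> T \<subseteq> {x\<in>K. u x < r}"
      using T x by (intro exI[of _ "K \<inter> T"]) (auto simp: openin_open_Int)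
  qed
  have "\<exists>D\<subseteq>C. finite D \<and> K \<subseteq> \<Union>D" if "\<And>c. c \<in> C \<Longrightarrow> openin (top_of_set K) c" "K \<subseteq> \<Union>C" for C
    using K(1) that unfolding compact_eq_openin_cover by blast
  from this[OF _ cov] obtain D where D: "D \<subseteq> (\<lambda>y. {x\<in>K. u x < u y}) ` K" "finite D" "K \<subseteq> \<Union>D"
    using op by blast
  then obtain F where F: "F \<subseteq> K" "finite F" "K \<subseteq> (\<Union>y\<in>F. {x\<in>K. u x < u y})"
    using finite_subset_image[OF D(2,1)] by blast
  have "F \<noteq> {}" using F(3) K(2) by auto
  then have "Max (u ` F) \<in> u ` F" using F(2) by (intro Max_in) auto
  then obtain y where y: "y \<in> F" "u y = Max (u ` F)" by auto
  then obtain z where "z \<in> F" "u y < u z" using F(1,3) by blast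
  then show False using y F(2) by (metis Max_ge finite_imageI imageI not_le)
qed

text \<open>The supremum runs over \<open>K\<close> only, while \<open>x\<close> ranges over the
  whole space. The problem thus moves to a space without boundary, and the maximizers lead back to
  points of \<open>K\<close>.\<close>

definition sup_convolution :: "'a::real_normed_vector set \<Rightarrow> ('a \<Rightarrow> real) \<Rightarrow> real \<Rightarrow> 'a \<Rightarrow> real" where
  "sup_convolution K u \<beta> x = (SUP \<xi>\<in>K. u \<xi> - \<beta> / 2 * (norm (x - \<xi>))\<^sup>2)"

context
  fixes K :: "'a::euclidean_space set" and u :: "'a \<Rightarrow> real" and \<beta> :: real
  assumes K: "compact K" "K \<noteq> {}" and usc: "usc_on K u" and \<beta>: "0 < \<beta>"
begin

lemma sup_convolution_attained:
  "\<exists>\<xi>\<in>K. sup_convolution K u \<beta> x = u \<xi> - \<beta> / 2 * (norm (x - \<xi>))\<^sup>2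
    \<and> (\<forall>\<zeta>\<in>K. u \<zeta> - \<beta> / 2 * (norm (x - \<zeta>))\<^sup>2 \<le> sup_convolution K u \<beta> x)"
proof -
  have "usc_on K (\<lambda>\<xi>. u \<xi> + - (\<beta> / 2 * (norm (x - \<xi>))\<^sup>2))"
    by (intro usc_on_add usc continuous_on_imp_usc_on continuous_intros)
  then obtain \<xi> where \<xi>: "\<xi> \<in> K" "\<And>\<zeta>. \<zeta> \<in> K \<Longrightarrow> u \<zeta> - \<beta> / 2 * (norm (x - \<zeta>))\<^sup>2 \<le> u \<xi> - \<beta> / 2 * (norm (x - \<xi>))\<^sup>2"
    using usc_on_attains_sup[OF K] by (metis (no_types, lifting) diff_conv_add_uminus)
  then have "sup_convolution K u \<beta> x = u \<xi> - \<beta> / 2 * (norm (x - \<xi>))\<^sup>2"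
    unfolding sup_convolution_def by (intro cSup_eq_maximum) auto
  then show ?thesis using \<xi> by auto
qed

lemma sup_convolution_upper:
  "\<zeta> \<in> K \<Longrightarrow> u \<zeta> - \<beta> / 2 * (norm (x - \<zeta>))\<^sup>2 \<le> sup_convolution K u \<beta> x"
  using sup_convolution_attained[of x] by blast

text \<open>A maximizer for \<open>x\<close> competes at \<open>x + h\<close> and at
  \<open>x - h\<close>; the parallelogram law evaluates the two penalties.\<close>

lemma sup_convolution_semiconvex:
  "2 * sup_convolution K u \<beta> x - \<beta> * (norm h)\<^sup>2
    \<le> sup_convolution K u \<beta> (x + h) + sup_convolution K u \<beta> (x - h)"
proof -
  obtain \<xi> where \<xi>: "\<xi> \<in> K" "sup_convolution K u \<beta> x = u \<xi> - \<beta> / 2 * (norm (x - \<xi>))\<^sup>2"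
    using sup_convolution_attained[of x] by blast
  have "(norm (x + h - \<xi>))\<^sup>2 + (norm (x - h - \<xi>))\<^sup>2 = 2 * (norm (x - \<xi>))\<^sup>2 + 2 * (norm h)\<^sup>2"
    by (simp add: power2_norm_eq_inner inner_add_left inner_add_right inner_diff_left inner_diff_right inner_commute)
  then have "\<beta> / 2 * ((norm (x + h - \<xi>))\<^sup>2 + (norm (x - h - \<xi>))\<^sup>2)
      = \<beta> / 2 * (2 * (norm (x - \<xi>))\<^sup>2 + 2 * (norm h)\<^sup>2)"
    by (rule arg_cong)
  then have "\<beta> / 2 * (norm (x + h - \<xi>))\<^sup>2 + \<beta> / 2 * (norm (x - h - \<xi>))\<^sup>2
      = \<beta> * (norm (x - \<xi>))\<^sup>2 + \<beta> * (norm h)\<^sup>2"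
    by (simp add: distrib_left)
  then show ?thesis
    using \<xi>(2) sup_convolution_upper[OF \<xi>(1), of "x + h"] sup_convolution_upper[OF \<xi>(1), of "x - h"] by simp
qed

lemma sup_convolution_continuous: "continuous_on UNIV (sup_convolution K u \<beta>)"
proof -
  obtain B where B: "\<And>\<xi>. \<xi> \<in> K \<Longrightarrow> norm \<xi> \<le> B"
    using compact_imp_bounded[OF K(1)] by (auto simp: bounded_iff)
  have le: "sup_convolution K u \<beta> x - sup_convolution K u \<beta> y \<le> \<beta> / 2 * (norm (x - y) * (norm x + norm y + 2 * B))" for x y
  proof -
    obtain \<xi> where \<xi>: "\<xi> \<in> K" "sup_convolution K u \<beta> x = u \<xi> - \<beta> / 2 * (norm (x - \<xi>))\<^sup>2"
      using sup_convolution_attained[of x] by blast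
    have "(norm (y - \<xi>))\<^sup>2 - (norm (x - \<xi>))\<^sup>2 = (y - x) \<bullet> (x + y - 2 *\<^sub>R \<xi>)"
      by (simp add: power2_norm_eq_inner inner_add_left inner_add_right inner_diff_left inner_diff_right inner_commute)
    also have "\<dots> \<le> norm (y - x) * norm (x + y - 2 *\<^sub>R \<xi>)" by (rule norm_cauchy_schwarz)
    also have "\<dots> \<le> norm (x - y) * (norm x + norm y + 2 * B)"
    proof -
      have "norm (x + y - 2 *\<^sub>R \<xi>) \<le> norm x + norm y + 2 * B"
        using norm_triangle_ineq4[of "x + y" "2 *\<^sub>R \<xi>"] norm_triangle_ineq[of x y] B[OF \<xi>(1)] by simp
      then show ?thesis by (simp add: norm_minus_commute mult_left_mono)
    qed
    finally have "\<beta> / 2 * (norm (y - \<xi>))\<^sup>2 - \<beta> / 2 * (norm (x - \<xi>))\<^sup>2 \<le> \<beta> / 2 * (norm (x - y) * (norm x + norm y + 2 * B))"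
      using \<beta> by (simp add: right_diff_distrib[symmetric])
    then show ?thesis using \<xi>(2) sup_convolution_upper[OF \<xi>(1), of y] by linarith
  qed
  have "(sup_convolution K u \<beta> \<longlongrightarrow> sup_convolution K u \<beta> x) (at x)" for x
  proof (rule LIM_zero_cancel, rule Lim_null_comparison)
    show "\<forall>\<^sub>F y in at x. norm (sup_convolution K u \<beta> y - sup_convolution K u \<beta> x)
        \<le> \<beta> / 2 * (norm (y - x) * (norm y + norm x + 2 * B))"
    proof (intro always_eventually allI)
      show "norm (sup_convolution K u \<beta> y - sup_convolution K u \<beta> x)
        \<le> \<beta> / 2 * (norm (y - x) * (norm y + norm x + 2 * B))" for y
        using le[of y x] le[of x y] unfolding norm_minus_commute[of x y] add.commute[of "norm x" "norm y"]
        by (simp only: real_norm_def abs_le_iff) simp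
    qed
    show "((\<lambda>y. \<beta> / 2 * (norm (y - x) * (norm y + norm x + 2 * B))) \<longlongrightarrow> 0) (at x)"
      by (auto intro!: tendsto_eq_intros)
  qed
  then show ?thesis by (simp add: continuous_on_def)
qed

text \<open>Prepares for \<open>semiconvex_near_maximum\<close> on the whole space.
  \<open>\<beta> / 4\<close> is what remains of \<open>\<beta> / 2\<close> when
  \<open>norm x\<close> is split into \<open>norm (x - \<xi>)\<close> and a bounded part.\<close>

lemma sup_convolution_coercive: "\<exists>c. \<forall>x. sup_convolution K u \<beta> x \<le> c - \<beta> / 4 * (norm x)\<^sup>2"
proof -
  obtain B where B: "\<And>\<xi>. \<xi> \<in> K \<Longrightarrow> norm \<xi> \<le> B"
    using compact_imp_bounded[OF K(1)] by (auto simp: bounded_iff)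
  obtain m where m: "\<And>y. y \<in> K \<Longrightarrow> u y \<le> u m" using usc_on_attains_sup[OF K usc] by blast
  have "sup_convolution K u \<beta> x \<le> (u m + \<beta> / 2 * B\<^sup>2) - \<beta> / 4 * (norm x)\<^sup>2" for x
  proof -
    obtain \<xi> where \<xi>: "\<xi> \<in> K" "sup_convolution K u \<beta> x = u \<xi> - \<beta> / 2 * (norm (x - \<xi>))\<^sup>2"
      using sup_convolution_attained[of x] by blast
    have "norm x \<le> norm (x - \<xi>) + norm \<xi>" using norm_triangle_ineq[of "x - \<xi>" \<xi>] by simp
    then have "(norm x)\<^sup>2 \<le> (norm (x - \<xi>) + norm \<xi>)\<^sup>2" by (intro power_mono) auto
    also have "\<dots> \<le> 2 * (norm (x - \<xi>))\<^sup>2 + 2 * (norm \<xi>)\<^sup>2"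
      using zero_le_power2[of "norm (x - \<xi>) - norm \<xi>"] by (simp add: power2_eq_square algebra_simps)
    also have "(norm \<xi>)\<^sup>2 \<le> B\<^sup>2" using B[OF \<xi>(1)] by (intro power_mono) auto
    finally have "\<beta> / 4 * (norm x)\<^sup>2 \<le> \<beta> / 4 * (2 * (norm (x - \<xi>))\<^sup>2 + 2 * B\<^sup>2)"
      using \<beta> by (intro mult_left_mono) auto
    also have "\<dots> = \<beta> / 2 * (norm (x - \<xi>))\<^sup>2 + \<beta> / 2 * B\<^sup>2" by (simp add: algebra_simps)
    finally show ?thesis using \<xi>(2) m[OF \<xi>(1)] by linarith
  qed
  then show ?thesis by blast
qed

end

text \<open>The second order superjet relative to \<open>K\<close>, with the little-o spelled out.
  \<open>X\<close> matters only through its quadratic form and is not asked to be symmetric: it will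
  come from the derivative of an extended slope.\<close>

definition superjet :: "'a::real_inner set \<Rightarrow> ('a \<Rightarrow> real) \<Rightarrow> 'a \<Rightarrow> 'a \<Rightarrow> ('a \<Rightarrow> 'a) \<Rightarrow> bool" where
  "superjet K u x p X \<longleftrightarrow> x \<in> K \<and> bounded_linear X \<and>
    (\<forall>\<epsilon>>0. \<exists>d>0. \<forall>z\<in>K. norm (z - x) < d \<longrightarrow>
      u z \<le> u x + p \<bullet> (z - x) + 1/2 * ((z - x) \<bullet> X (z - x)) + \<epsilon> * (norm (z - x))\<^sup>2)"

text \<open>A form of the Crandall-Ishii lemma at approximate maxima: \<open>(x, y)\<close> almost
  maximizes the regularized functional, and \<xi>, \<eta> attain the two sup-convolutions there. The
  jets are attained at \<xi> and \<eta> themselves, with slopes exact up to \<delta>, so no closure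
  of jets is taken.\<close>

theorem theorem_on_sums:
  fixes K :: "'a::euclidean_space set"
  assumes K: "compact K" "K \<noteq> {}" and u1: "usc_on K u1" and u2: "usc_on K u2" and \<beta>: "0 < \<beta>" and \<delta>: "0 < \<delta>"
  obtains x y \<xi> \<eta> p q X Y where "superjet K u1 \<xi> p X" "superjet K u2 \<eta> q Y"
    "\<And>z. z \<in> K \<Longrightarrow> u1 z + u2 z \<le> u1 \<xi> + u2 \<eta>
        - \<beta> / 2 * ((norm (x - \<xi>))\<^sup>2 + (norm (y - \<eta>))\<^sup>2 + (norm (x - y))\<^sup>2) + \<delta>"
    "norm (p - \<beta> *\<^sub>R (x - y)) \<le> \<delta>" "norm (q + \<beta> *\<^sub>R (x - y)) \<le> \<delta>"
    "\<And>h k. h \<bullet> X h + k \<bullet> Y k \<le> \<beta> * (norm (h - k))\<^sup>2"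
proof -
  let ?S1 = "sup_convolution K u1 \<beta>" and ?S2 = "sup_convolution K u2 \<beta>"
  note conv = sup_convolution_attained[OF K _ \<beta>] sup_convolution_upper[OF K _ \<beta>]
    sup_convolution_semiconvex[OF K _ \<beta>] sup_convolution_continuous[OF K _ \<beta>] sup_convolution_coercive[OF K _ \<beta>]
  define \<Psi> where "\<Psi> z = ?S1 (fst z) + ?S2 (snd z) - \<beta> / 2 * (norm (fst z - snd z))\<^sup>2" for z :: "'a \<times> 'a"
  obtain a1 a2 where a: "\<And>x. ?S1 x \<le> a1 - \<beta> / 4 * (norm x)\<^sup>2" "\<And>x. ?S2 x \<le> a2 - \<beta> / 4 * (norm x)\<^sup>2"
    using conv(5)[OF u1] conv(5)[OF u2] by blast
  have norm2: "(norm z)\<^sup>2 = (norm (fst z))\<^sup>2 + (norm (snd z))\<^sup>2" for z :: "'a \<times> 'a"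
    by (simp add: norm_prod_def)
  have cont: "continuous_on UNIV \<Psi>"
    unfolding \<Psi>_def
    by (intro continuous_intros continuous_on_compose2[OF conv(4)[OF u1]] continuous_on_compose2[OF conv(4)[OF u2]]) auto
  \<comment> \<open>Each sup-convolution contributes \<beta> in its own variable, and the
    penalization adds \<open>2 * \<beta>\<close>, since \<open>(norm k)^2\<close> is at most
    \<open>2 * (norm h)^2\<close>.\<close>
  have semi: "2 * \<Psi> z - (3 * \<beta>) * (norm h)\<^sup>2 \<le> \<Psi> (z + h) + \<Psi> (z - h)" for z h
  proof -
    define d where "d = fst z - snd z"
    define k where "k = fst h - snd h"
    have "(norm (d + k))\<^sup>2 + (norm (d - k))\<^sup>2 = 2 * (norm d)\<^sup>2 + 2 * (norm k)\<^sup>2"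
      by (simp add: power2_norm_eq_inner inner_add_left inner_add_right inner_diff_left inner_diff_right inner_commute)
    moreover have "(norm k)\<^sup>2 \<le> 2 * (norm h)\<^sup>2"
    proof -
      have "(norm k)\<^sup>2 \<le> (norm (fst h) + norm (snd h))\<^sup>2" unfolding k_def by (intro power_mono norm_triangle_ineq4) auto
      also have "\<dots> \<le> 2 * (norm h)\<^sup>2"
        unfolding norm2 using zero_le_power2[of "norm (fst h) - norm (snd h)"] by (simp add: power2_eq_square algebra_simps)
      finally show ?thesis .
    qed
    ultimately have "(norm (d + k))\<^sup>2 + (norm (d - k))\<^sup>2 \<le> 2 * (norm d)\<^sup>2 + 4 * (norm h)\<^sup>2" by linarith
    then have "\<beta> / 2 * ((norm (d + k))\<^sup>2 + (norm (d - k))\<^sup>2) \<le> \<beta> / 2 * (2 * (norm d)\<^sup>2 + 4 * (norm h)\<^sup>2)"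
      using \<beta> by (intro mult_left_mono) auto
    moreover have "fst (z + h) - snd (z + h) = d + k" "fst (z - h) - snd (z - h) = d - k" "fst z - snd z = d"
      by (auto simp: d_def k_def)
    moreover have "\<beta> * (norm h)\<^sup>2 = \<beta> * (norm (fst h))\<^sup>2 + \<beta> * (norm (snd h))\<^sup>2" by (simp add: norm2 distrib_left)
    ultimately show ?thesis
      using conv(3)[OF u1, of "fst z" "fst h"] conv(3)[OF u2, of "snd z" "snd h"]
      by (simp add: \<Psi>_def distrib_left)
  qed
  have coer: "\<Psi> z \<le> (a1 + a2) - \<beta> / 4 * (norm z)\<^sup>2" for z
  proof -
    have "0 \<le> \<beta> / 2 * (norm (fst z - snd z))\<^sup>2" using \<beta> by simp
    then show ?thesis using a(1)[of "fst z"] a(2)[of "snd z"] unfolding \<Psi>_def norm2 distrib_left by linarith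
  qed
  have pos: "0 \<le> 3 * \<beta>" "0 < \<beta> / 4" using \<beta> by auto
  have "\<exists>z0 P A. (\<forall>z. \<Psi> z \<le> \<Psi> z0 + \<delta>) \<and> norm P \<le> \<delta> \<and> bounded_linear A \<and> (\<forall>h. h \<bullet> A h \<le> 0) \<and>
      (\<forall>\<epsilon>>0. \<exists>d>0. \<forall>h. norm h < d \<longrightarrow>
        \<bar>\<Psi> (z0 + h) - \<Psi> z0 - P \<bullet> h - 1/2 * (h \<bullet> A h)\<bar> \<le> \<epsilon> * (norm h)\<^sup>2)"
    by (rule semiconvex_near_maximum[OF cont semi pos(1) coer pos(2) \<delta>]) blast
  then obtain z0 P A where max: "\<And>z. \<Psi> z \<le> \<Psi> z0 + \<delta>" and P: "norm P \<le> \<delta>" and A: "bounded_linear A" "\<And>h. h \<bullet> A h \<le> 0"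
    and expand: "\<And>\<epsilon>. \<epsilon> > 0 \<Longrightarrow> \<exists>d>0. \<forall>h. norm h < d \<longrightarrow>
      \<bar>\<Psi> (z0 + h) - \<Psi> z0 - P \<bullet> h - 1/2 * (h \<bullet> A h)\<bar> \<le> \<epsilon> * (norm h)\<^sup>2"
    by blast
  define x y where "x = fst z0" and "y = snd z0"
  have z0: "z0 = (x, y)" by (simp add: x_def y_def)
  obtain \<xi> where \<xi>: "\<xi> \<in> K" "?S1 x = u1 \<xi> - \<beta> / 2 * (norm (x - \<xi>))\<^sup>2" using conv(1)[OF u1, of x] by blast
  obtain \<eta> where \<eta>: "\<eta> \<in> K" "?S2 y = u2 \<eta> - \<beta> / 2 * (norm (y - \<eta>))\<^sup>2" using conv(1)[OF u2, of y] by blast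
  define p where "p = fst P + \<beta> *\<^sub>R (x - y)"
  define q where "q = snd P - \<beta> *\<^sub>R (x - y)"
  define X where "X h = fst (A (h, 0)) + \<beta> *\<^sub>R h" for h
  define Y where "Y k = snd (A (0, k)) + \<beta> *\<^sub>R k" for k
  define Q where "Q h = h \<bullet> A h" for h
  have Q1: "Q (h, 0) = h \<bullet> fst (A (h, 0))" and Q2: "Q (0, k) = k \<bullet> snd (A (0, k))" for h k
    by (simp_all add: Q_def inner_prod_def)
  have Qs: "Q (t *\<^sub>R h) = t\<^sup>2 * Q h" for t h
    using A(1) by (simp add: Q_def bounded_linear.linear linear_scale power2_eq_square)
  \<comment> \<open>In the mixed second difference of \<Psi> the sup-convolutions cancel, each
    depending on one variable, and the penalization leaves exactly
    \<open>t^2 * (\<beta> * (h \<bullet> k))\<close>. Comparing with the expansion at scale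
    \<open>t\<close> transfers this to \<open>Q\<close>.\<close>
  have cross: "Q (h, k) = Q (h, 0) + Q (0, k) + 2 * \<beta> * (h \<bullet> k)" for h k
  proof (rule ccontr)
    define e where "e = \<bar>Q (h, k) - Q (h, 0) - Q (0, k) - 2 * \<beta> * (h \<bullet> k)\<bar>"
    assume "Q (h, k) \<noteq> Q (h, 0) + Q (0, k) + 2 * \<beta> * (h \<bullet> k)"
    then have e: "e > 0" by (simp add: e_def)
    define n where "n = (norm h)\<^sup>2 + (norm k)\<^sup>2"
    have n: "n \<ge> 0" by (simp add: n_def)
    \<comment> \<open>The three expansions cost \<open>6 * (\<epsilon> * n)\<close> in total, which
      must stay below \<open>e\<close>; \<open>n + 1\<close> keeps the denominator positive.\<close>
    define \<epsilon> where "\<epsilon> = e / (8 * (n + 1))"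
    have \<epsilon>: "\<epsilon> > 0" using e n by (simp add: \<epsilon>_def)
    obtain d where d: "d > 0" "\<And>h. norm h < d \<Longrightarrow>
      \<bar>\<Psi> (z0 + h) - \<Psi> z0 - P \<bullet> h - 1/2 * Q h\<bar> \<le> \<epsilon> * (norm h)\<^sup>2"
      using expand[OF \<epsilon>] by (auto simp: Q_def)
    define t where "t = d / (2 * (norm h + norm k + 1))"
    have pos: "norm h + norm k + 1 > 0" by (simp add: add_nonneg_pos)
    have t: "t > 0" using d pos by (simp add: t_def)
    have small: "norm (t *\<^sub>R a) < d" if "norm a \<le> norm h + norm k" for a :: "'a \<times> 'a"
    proof -
      have "norm (t *\<^sub>R a) \<le> t * (norm h + norm k)" using that t by (simp add: mult_left_mono)
      also have "\<dots> < t * (2 * (norm h + norm k + 1))" using t pos by (intro mult_strict_left_mono) auto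
      also have "\<dots> = d" using pos by (simp add: t_def)
      finally show ?thesis .
    qed
    have est: "\<bar>\<Psi> (z0 + t *\<^sub>R a) - \<Psi> z0 - t * (P \<bullet> a) - 1/2 * (t\<^sup>2 * Q a)\<bar> \<le> \<epsilon> * (t\<^sup>2 * n)"
      if "norm a \<le> norm h + norm k" "(norm a)\<^sup>2 \<le> n" for a
    proof -
      have "\<epsilon> * (norm (t *\<^sub>R a))\<^sup>2 \<le> \<epsilon> * (t\<^sup>2 * n)"
        using that(2) \<epsilon> by (simp add: power_mult_distrib mult_left_mono)
      then show ?thesis using d(2)[OF small[OF that(1)]] unfolding Qs inner_scaleR_right by linarith
    qed
    have nh: "norm (h, k) \<le> norm h + norm k" by (simp add: norm_prod_def sqrt_sum_squares_le_sum)
    have e1: "\<bar>\<Psi> (z0 + t *\<^sub>R (h, k)) - \<Psi> z0 - t * (P \<bullet> (h, k)) - 1/2 * (t\<^sup>2 * Q (h, k))\<bar> \<le> \<epsilon> * (t\<^sup>2 * n)"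
      by (rule est[OF nh]) (simp add: norm2 n_def)
    have e2: "\<bar>\<Psi> (z0 + t *\<^sub>R (h, 0)) - \<Psi> z0 - t * (P \<bullet> (h, 0)) - 1/2 * (t\<^sup>2 * Q (h, 0))\<bar> \<le> \<epsilon> * (t\<^sup>2 * n)"
      by (rule est) (simp_all add: norm2 n_def)
    have e3: "\<bar>\<Psi> (z0 + t *\<^sub>R (0, k)) - \<Psi> z0 - t * (P \<bullet> (0, k)) - 1/2 * (t\<^sup>2 * Q (0, k))\<bar> \<le> \<epsilon> * (t\<^sup>2 * n)"
      by (rule est) (simp_all add: norm2 n_def)
    have Pk: "P \<bullet> (h, k) = P \<bullet> (h, 0) + P \<bullet> (0, k)" by (simp add: inner_prod_def)
    have "(norm (x + t *\<^sub>R h - (y + t *\<^sub>R k)))\<^sup>2 - (norm (x + t *\<^sub>R h - y))\<^sup>2 - (norm (x - (y + t *\<^sub>R k)))\<^sup>2 + (norm (x - y))\<^sup>2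
        = - 2 * t\<^sup>2 * (h \<bullet> k)"
    proof -
      define d where "d = x - y"
      have "x + t *\<^sub>R h - (y + t *\<^sub>R k) = d + (t *\<^sub>R h - t *\<^sub>R k)" "x + t *\<^sub>R h - y = d + t *\<^sub>R h"
        "x - (y + t *\<^sub>R k) = d - t *\<^sub>R k" "x - y = d"
        by (auto simp: d_def)
      then show ?thesis
        by (simp only: power2_norm_eq_inner) (simp add: inner_add_left inner_add_right inner_diff_left inner_diff_right inner_commute power2_eq_square algebra_simps)
    qed
    then have "\<beta> / 2 * ((norm (x + t *\<^sub>R h - (y + t *\<^sub>R k)))\<^sup>2 - (norm (x + t *\<^sub>R h - y))\<^sup>2 - (norm (x - (y + t *\<^sub>R k)))\<^sup>2 + (norm (x - y))\<^sup>2)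
        = - (t\<^sup>2 * (\<beta> * (h \<bullet> k)))" by simp
    then have mixed: "\<Psi> (z0 + t *\<^sub>R (h, k)) - \<Psi> (z0 + t *\<^sub>R (h, 0)) - \<Psi> (z0 + t *\<^sub>R (0, k)) + \<Psi> z0 = t\<^sup>2 * (\<beta> * (h \<bullet> k))"
      by (simp add: \<Psi>_def z0 distrib_left right_diff_distrib)
    have "t * (P \<bullet> (h, k)) = t * (P \<bullet> (h, 0)) + t * (P \<bullet> (0, k))" unfolding Pk by (rule distrib_left)
    then have "\<bar>t\<^sup>2 * (\<beta> * (h \<bullet> k)) - (1/2 * (t\<^sup>2 * Q (h, k)) - 1/2 * (t\<^sup>2 * Q (h, 0)) - 1/2 * (t\<^sup>2 * Q (0, k)))\<bar> \<le> 3 * (\<epsilon> * (t\<^sup>2 * n))"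
      using e1 e2 e3 mixed by linarith
    moreover have "t\<^sup>2 * (\<beta> * (h \<bullet> k)) - (1/2 * (t\<^sup>2 * Q (h, k)) - 1/2 * (t\<^sup>2 * Q (h, 0)) - 1/2 * (t\<^sup>2 * Q (0, k)))
       = t\<^sup>2 / 2 * - (Q (h, k) - Q (h, 0) - Q (0, k) - 2 * \<beta> * (h \<bullet> k))" by (simp add: algebra_simps)
    ultimately have "t\<^sup>2 / 2 * e \<le> t\<^sup>2 / 2 * (6 * (\<epsilon> * n))"
      by (simp only: abs_mult abs_minus_cancel e_def) (simp add: mult_ac)
    then have "e \<le> 6 * (\<epsilon> * n)" using t by simp
    also have "\<dots> < e" using e n by (simp add: \<epsilon>_def divide_simps)
    finally show False by simp
  qed
  show ?thesis
  proof (rule that[of \<xi> p X \<eta> q Y x y])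
    have X: "bounded_linear X"
      unfolding X_def by (intro bounded_linear_add bounded_linear_scaleR_right
        bounded_linear_compose[OF bounded_linear_fst] bounded_linear_compose[OF A(1)] bounded_linear_Pair
        bounded_linear_ident bounded_linear_zero)
    have Y: "bounded_linear Y"
      unfolding Y_def by (intro bounded_linear_add bounded_linear_scaleR_right
        bounded_linear_compose[OF bounded_linear_snd] bounded_linear_compose[OF A(1)] bounded_linear_Pair
        bounded_linear_ident bounded_linear_zero)
    show "u1 z + u2 z \<le> u1 \<xi> + u2 \<eta>
        - \<beta> / 2 * ((norm (x - \<xi>))\<^sup>2 + (norm (y - \<eta>))\<^sup>2 + (norm (x - y))\<^sup>2) + \<delta>" if "z \<in> K" for z
    proof -
      have "u1 z + u2 z \<le> \<Psi> (z, z)"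
        using conv(2)[OF u1 that, of z] conv(2)[OF u2 that, of z] by (simp add: \<Psi>_def)
      also have "\<dots> \<le> \<Psi> z0 + \<delta>" by (rule max)
      finally show ?thesis using \<xi>(2) \<eta>(2) by (simp add: \<Psi>_def z0 distrib_left)
    qed
    show "norm (p - \<beta> *\<^sub>R (x - y)) \<le> \<delta>" "norm (q + \<beta> *\<^sub>R (x - y)) \<le> \<delta>"
      using P norm_fst_le[of "fst P" "snd P"] norm_snd_le[of "snd P" "fst P"] by (auto simp: p_def q_def)
    show "h \<bullet> X h + k \<bullet> Y k \<le> \<beta> * (norm (h - k))\<^sup>2" for h k
    proof -
      \<comment> \<open>The multiples of the identity added in \<open>X\<close> and \<open>Y\<close>
        complete the cross term \<open>- 2 * \<beta> * (h \<bullet> k)\<close> to a square.\<close>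
      have "h \<bullet> X h + k \<bullet> Y k = Q (h, k) + \<beta> * (norm (h - k))\<^sup>2"
        unfolding cross[of h k] Q1 Q2 X_def Y_def
        by (simp add: power2_norm_eq_inner inner_add_right inner_diff_left inner_diff_right inner_commute algebra_simps)
      then show ?thesis using A(2)[of "(h, k)"] by (simp add: Q_def)
    qed
    have expandQ: "\<exists>d>0. \<forall>h. norm h < d \<longrightarrow>
      \<bar>\<Psi> (z0 + h) - \<Psi> z0 - P \<bullet> h - 1/2 * Q h\<bar> \<le> \<epsilon> * (norm h)\<^sup>2" if "\<epsilon> > 0" for \<epsilon>
      using expand[OF that] unfolding Q_def .
    show "superjet K u1 \<xi> p X"
      unfolding superjet_def
    proof (intro conjI allI impI)
      show "\<xi> \<in> K" "bounded_linear X" by fact+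
      fix \<epsilon> :: real assume "\<epsilon> > 0"
      then obtain d where d: "d > 0" "\<And>h. norm h < d \<Longrightarrow>
        \<bar>\<Psi> (z0 + h) - \<Psi> z0 - P \<bullet> h - 1/2 * Q h\<bar> \<le> \<epsilon> * (norm h)\<^sup>2"
        using expandQ by blast
      show "\<exists>d>0. \<forall>z\<in>K. norm (z - \<xi>) < d \<longrightarrow>
          u1 z \<le> u1 \<xi> + p \<bullet> (z - \<xi>) + 1/2 * ((z - \<xi>) \<bullet> X (z - \<xi>)) + \<epsilon> * (norm (z - \<xi>))\<^sup>2"
      proof (intro exI[of _ d] conjI ballI impI)
        fix z assume z: "z \<in> K" "norm (z - \<xi>) < d"
        define h where "h = z - \<xi>"
        have "(norm (x + h - y))\<^sup>2 = (norm (x - y))\<^sup>2 + 2 * ((x - y) \<bullet> h) + (norm h)\<^sup>2"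
          by (simp add: power2_norm_eq_inner inner_add_left inner_add_right inner_diff_left inner_diff_right inner_commute)
        then have sq: "\<beta> / 2 * (norm (x + h - y))\<^sup>2 = \<beta> / 2 * (norm (x - y))\<^sup>2 + \<beta> * ((x - y) \<bullet> h) + \<beta> / 2 * (norm h)\<^sup>2"
          by (simp add: distrib_left)
        \<comment> \<open>The shifted point \<open>\<xi> + h\<close> competes at
          \<open>x + h\<close>, with equality for \<open>h = 0\<close>. So the expansion of the
          sup-convolution at \<open>x\<close> bounds \<open>u1\<close> near \<xi> with the same
          slope and quadratic form.\<close>
        have "u1 z - \<beta> / 2 * (norm (x - \<xi>))\<^sup>2 \<le> ?S1 (x + h)"
          using conv(2)[OF u1 z(1), of "x + h"] by (simp add: h_def)
        moreover have "\<Psi> (z0 + (h, 0)) - \<Psi> z0 - fst P \<bullet> h - 1/2 * (h \<bullet> fst (A (h, 0))) \<le> \<epsilon> * (norm h)\<^sup>2"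
          using d(2)[of "(h, 0)"] z(2) unfolding Q1 by (simp add: h_def inner_prod_def abs_le_iff)
        moreover have "\<Psi> (z0 + (h, 0)) - \<Psi> z0 = ?S1 (x + h) - ?S1 x - \<beta> / 2 * (norm (x + h - y))\<^sup>2 + \<beta> / 2 * (norm (x - y))\<^sup>2"
          by (simp add: \<Psi>_def z0)
        moreover have "p \<bullet> h = fst P \<bullet> h + \<beta> * ((x - y) \<bullet> h)" by (simp add: p_def inner_add_left)
        moreover have "h \<bullet> X h = h \<bullet> fst (A (h, 0)) + \<beta> * (norm h)\<^sup>2"
          by (simp add: X_def inner_add_right power2_norm_eq_inner)
        ultimately show "u1 z \<le> u1 \<xi> + p \<bullet> (z - \<xi>) + 1/2 * ((z - \<xi>) \<bullet> X (z - \<xi>)) + \<epsilon> * (norm (z - \<xi>))\<^sup>2"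
          unfolding h_def[symmetric] using \<xi>(2) sq by (simp add: field_simps)
      qed (rule d)
    qed
    show "superjet K u2 \<eta> q Y"
      unfolding superjet_def
    proof (intro conjI allI impI)
      show "\<eta> \<in> K" "bounded_linear Y" by fact+
      fix \<epsilon> :: real assume "\<epsilon> > 0"
      then obtain d where d: "d > 0" "\<And>h. norm h < d \<Longrightarrow>
        \<bar>\<Psi> (z0 + h) - \<Psi> z0 - P \<bullet> h - 1/2 * Q h\<bar> \<le> \<epsilon> * (norm h)\<^sup>2"
        using expandQ by blast
      show "\<exists>d>0. \<forall>z\<in>K. norm (z - \<eta>) < d \<longrightarrow>
          u2 z \<le> u2 \<eta> + q \<bullet> (z - \<eta>) + 1/2 * ((z - \<eta>) \<bullet> Y (z - \<eta>)) + \<epsilon> * (norm (z - \<eta>))\<^sup>2"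
      proof (intro exI[of _ d] conjI ballI impI)
        fix z assume z: "z \<in> K" "norm (z - \<eta>) < d"
        define h where "h = z - \<eta>"
        have "(norm (x - (y + h)))\<^sup>2 = (norm (x - y))\<^sup>2 - 2 * ((x - y) \<bullet> h) + (norm h)\<^sup>2"
          by (simp add: power2_norm_eq_inner inner_add_left inner_add_right inner_diff_left inner_diff_right inner_commute)
        then have sq: "\<beta> / 2 * (norm (x - (y + h)))\<^sup>2 = \<beta> / 2 * (norm (x - y))\<^sup>2 - \<beta> * ((x - y) \<bullet> h) + \<beta> / 2 * (norm h)\<^sup>2"
          by (simp add: distrib_left right_diff_distrib)
        have "u2 z - \<beta> / 2 * (norm (y - \<eta>))\<^sup>2 \<le> ?S2 (y + h)"
          using conv(2)[OF u2 z(1), of "y + h"] by (simp add: h_def)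
        moreover have "\<Psi> (z0 + (0, h)) - \<Psi> z0 - snd P \<bullet> h - 1/2 * (h \<bullet> snd (A (0, h))) \<le> \<epsilon> * (norm h)\<^sup>2"
          using d(2)[of "(0, h)"] z(2) unfolding Q2 by (simp add: h_def inner_prod_def abs_le_iff)
        moreover have "\<Psi> (z0 + (0, h)) - \<Psi> z0 = ?S2 (y + h) - ?S2 y - \<beta> / 2 * (norm (x - (y + h)))\<^sup>2 + \<beta> / 2 * (norm (x - y))\<^sup>2"
          by (simp add: \<Psi>_def z0)
        moreover have "q \<bullet> h = snd P \<bullet> h - \<beta> * ((x - y) \<bullet> h)" by (simp add: q_def inner_diff_left)
        moreover have "h \<bullet> Y h = h \<bullet> snd (A (0, h)) + \<beta> * (norm h)\<^sup>2"
          by (simp add: Y_def inner_add_right power2_norm_eq_inner)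
        ultimately show "u2 z \<le> u2 \<eta> + q \<bullet> (z - \<eta>) + 1/2 * ((z - \<eta>) \<bullet> Y (z - \<eta>)) + \<epsilon> * (norm (z - \<eta>))\<^sup>2"
          unfolding h_def[symmetric] using \<eta>(2) sq by (simp add: field_simps)
      qed (rule d)
    qed
  qed
qed

section \<open>Vanishing of the penalization\<close>

lemma norm_diff_sq_le:
  fixes a b x y :: "'a::real_normed_vector"
  shows "(norm (a - b))\<^sup>2 \<le> 3 * ((norm (x - a))\<^sup>2 + (norm (y - b))\<^sup>2 + (norm (x - y))\<^sup>2)"
proof -
  define r s t where "r = norm (x - a)" and "s = norm (y - b)" and "t = norm (x - y)"
  have "norm (a - b) \<le> r + s + t"
    using norm_triangle_ineq[of "a - x" "x - y"] norm_triangle_ineq[of "a - y" "y - b"]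
    by (simp add: r_def s_def t_def norm_minus_commute)
  then have "(norm (a - b))\<^sup>2 \<le> (r + s + t)\<^sup>2" by (intro power_mono) auto
  also have "\<dots> \<le> 3 * (r\<^sup>2 + s\<^sup>2 + t\<^sup>2)"
    using zero_le_power2[of "r - s"] zero_le_power2[of "r - t"] zero_le_power2[of "s - t"]
    by (simp add: power2_eq_square algebra_simps)
  finally show ?thesis by (simp add: r_def s_def t_def)
qed

text \<open>Two stages: comparison with a maximizer of \<open>u1 + u2\<close> bounds \<beta> times
  the squared distances, so along a subsequence \<xi> and \<eta> have a common limit; semicontinuity
  there makes the same product tend to zero. The factor \<open>1 + \<beta>\<close> records smallness
  both of the distances and of their product with \<beta>.\<close>

theorem theorem_on_sums_penalized:
  fixes K :: "'a::euclidean_space set"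
  assumes K: "compact K" "K \<noteq> {}" and u1: "usc_on K u1" and u2: "usc_on K u2" and \<kappa>: "0 < \<kappa>"
  obtains \<beta> x y \<xi> \<eta> p q X Y where "0 < \<beta>" "superjet K u1 \<xi> p X" "superjet K u2 \<eta> q Y"
    "\<And>z. z \<in> K \<Longrightarrow> u1 z + u2 z \<le> u1 \<xi> + u2 \<eta> + \<kappa>"
    "(1 + \<beta>) * ((norm (x - \<xi>))\<^sup>2 + (norm (y - \<eta>))\<^sup>2 + (norm (x - y))\<^sup>2) \<le> \<kappa>"
    "norm (p - \<beta> *\<^sub>R (x - y)) \<le> \<kappa>" "norm (q + \<beta> *\<^sub>R (x - y)) \<le> \<kappa>"
    "\<And>h k. h \<bullet> X h + k \<bullet> Y k \<le> \<beta> * (norm (h - k))\<^sup>2"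
proof -
  define D where "D x y \<xi> \<eta> = (norm (x - \<xi>))\<^sup>2 + (norm (y - \<eta>))\<^sup>2 + (norm (x - y))\<^sup>2" for x y \<xi> \<eta> :: 'a
  have D0: "D x y \<xi> \<eta> \<ge> 0" for x y \<xi> \<eta> by (simp add: D_def)
  define \<beta> where "\<beta> n = real n + 1" for n
  define \<delta> where "\<delta> n = min \<kappa> (1 / \<beta> n)" for n
  have \<beta>: "\<beta> n \<ge> 1" for n by (simp add: \<beta>_def)
  have \<delta>: "0 < \<delta> n" "\<delta> n \<le> \<kappa>" "\<delta> n \<le> 1 / \<beta> n" "\<delta> n \<le> 1" for n
    using \<beta>[of n] \<kappa> by (auto simp: \<delta>_def min_le_iff_disj)
  define P where "P n x y \<xi> \<eta> \<longleftrightarrow> (\<exists>p q X Y. superjet K u1 \<xi> p X \<and> superjet K u2 \<eta> q Y \<and>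
      (\<forall>z\<in>K. u1 z + u2 z \<le> u1 \<xi> + u2 \<eta> - \<beta> n / 2 * D x y \<xi> \<eta> + \<delta> n) \<and>
      norm (p - \<beta> n *\<^sub>R (x - y)) \<le> \<delta> n \<and> norm (q + \<beta> n *\<^sub>R (x - y)) \<le> \<delta> n \<and>
      (\<forall>h k. h \<bullet> X h + k \<bullet> Y k \<le> \<beta> n * (norm (h - k))\<^sup>2))" for n x y \<xi> \<eta>
  have "\<exists>x y \<xi> \<eta>. P n x y \<xi> \<eta>" for n
  proof -
    have "0 < \<beta> n" using \<beta>[of n] by simp
    then show ?thesis
      by (rule theorem_on_sums[OF K u1 u2 _ \<delta>(1)[of n]]) (unfold P_def D_def, blast)
  qed
  then obtain x y \<xi> \<eta> where Pn: "\<And>n. P n (x n) (y n) (\<xi> n) (\<eta> n)" by metis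
  have in_K: "\<xi> n \<in> K" "\<eta> n \<in> K" for n
    using Pn[of n] unfolding P_def superjet_def by blast+
  have gap: "u1 z + u2 z \<le> u1 (\<xi> n) + u2 (\<eta> n) - \<beta> n / 2 * D (x n) (y n) (\<xi> n) (\<eta> n) + \<delta> n" if "z \<in> K" for n z
    using Pn[of n] that unfolding P_def by blast
  define Dn where "Dn n = D (x n) (y n) (\<xi> n) (\<eta> n)" for n
  have "\<exists>n. (1 + \<beta> n) * Dn n \<le> \<kappa>"
  proof -
    obtain m1 where m1: "\<And>z. z \<in> K \<Longrightarrow> u1 z \<le> u1 m1" using usc_on_attains_sup[OF K u1] by blast
    obtain m2 where m2: "\<And>z. z \<in> K \<Longrightarrow> u2 z \<le> u2 m2" using usc_on_attains_sup[OF K u2] by blast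
    obtain m where m: "m \<in> K" "\<And>z. z \<in> K \<Longrightarrow> u1 z + u2 z \<le> u1 m + u2 m"
      using usc_on_attains_sup[OF K usc_on_add[OF u1 u2]] by blast
    \<comment> \<open>Separate maxima of \<open>u1\<close> and \<open>u2\<close> are used because
      \<xi> and \<eta> may still differ.\<close>
    define C where "C = 2 * (u1 m1 + u2 m2 + 1 - (u1 m + u2 m))"
    have \<beta>D: "\<beta> n * Dn n \<le> C" for n
    proof -
      have "\<beta> n / 2 * Dn n \<le> C / 2"
        using gap[OF m(1), of n] m1[OF in_K(1)[of n]] m2[OF in_K(2)[of n]] \<delta>(4)[of n]
        unfolding C_def Dn_def by simp
      then show ?thesis by simp
    qed
    have \<beta>0: "(\<lambda>n. 1 / \<beta> n) \<longlonglongrightarrow> 0"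
      unfolding \<beta>_def using LIMSEQ_inverse_real_of_nat by (simp add: inverse_eq_divide add.commute)
    have Dn0: "Dn \<longlonglongrightarrow> 0"
    proof (rule tendsto_sandwich)
      show "\<forall>\<^sub>F n in sequentially. 0 \<le> Dn n" by (simp add: Dn_def D0)
      have "Dn n \<le> C * (1 / \<beta> n)" for n using \<beta>D[of n] \<beta>[of n] by (simp add: pos_le_divide_eq mult.commute)
      then show "\<forall>\<^sub>F n in sequentially. Dn n \<le> C * (1 / \<beta> n)" by simp
      show "(\<lambda>n. C * (1 / \<beta> n)) \<longlonglongrightarrow> 0" using tendsto_mult_left[OF \<beta>0, of C] by simp
    qed (rule tendsto_const)
    obtain \<zeta> r where \<zeta>: "\<zeta> \<in> K" "strict_mono (r :: nat \<Rightarrow> nat)" "(\<xi> \<circ> r) \<longlonglongrightarrow> \<zeta>"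
      using K(1) in_K(1) unfolding compact_def by blast
    have Dr0: "(\<lambda>n. 3 * Dn (r n)) \<longlonglongrightarrow> 0"
      using tendsto_mult_left[OF LIMSEQ_subseq_LIMSEQ[OF Dn0 \<zeta>(2)], of 3] by (simp add: o_def)
    have "(\<lambda>n. (norm (\<xi> (r n) - \<eta> (r n)))\<^sup>2) \<longlonglongrightarrow> 0"
    proof (rule tendsto_sandwich[OF _ _ tendsto_const Dr0])
      show "\<forall>\<^sub>F n in sequentially. (norm (\<xi> (r n) - \<eta> (r n)))\<^sup>2 \<le> 3 * Dn (r n)"
        unfolding Dn_def D_def by (intro always_eventually allI norm_diff_sq_le)
    qed simp
    then have "(\<lambda>n. norm (\<xi> (r n) - \<eta> (r n))) \<longlonglongrightarrow> 0"
      by (auto dest: tendsto_real_sqrt)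
    then have "(\<lambda>n. \<xi> (r n) - \<eta> (r n)) \<longlonglongrightarrow> 0" by (rule tendsto_norm_zero_cancel)
    then have \<eta>\<zeta>: "(\<eta> \<circ> r) \<longlonglongrightarrow> \<zeta>"
      using tendsto_diff[OF \<zeta>(3)] by (fastforce simp: o_def)
    \<comment> \<open>Three errors of \<open>\<kappa> / 16\<close> bound \<beta> times the squared
      distances by \<open>3 * \<kappa> / 8\<close>; since \<beta> is at least 1, the factor
      \<open>1 + \<beta>\<close> at most doubles this.\<close>
    have "\<forall>\<^sub>F n in sequentially. u1 ((\<xi> \<circ> r) n) < u1 \<zeta> + \<kappa> / 16"
      using \<kappa> in_K by (intro usc_on_sequentially[OF u1 \<zeta>(1) _ \<zeta>(3)]) auto
    moreover have "\<forall>\<^sub>F n in sequentially. u2 ((\<eta> \<circ> r) n) < u2 \<zeta> + \<kappa> / 16"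
      using \<kappa> in_K by (intro usc_on_sequentially[OF u2 \<zeta>(1) _ \<eta>\<zeta>]) auto
    moreover have "\<forall>\<^sub>F n in sequentially. 1 / \<beta> (r n) < \<kappa> / 16"
    proof -
      have "(\<lambda>n. 1 / \<beta> (r n)) \<longlonglongrightarrow> 0" using LIMSEQ_subseq_LIMSEQ[OF \<beta>0 \<zeta>(2)] by (simp add: o_def)
      then show ?thesis using \<kappa> by (intro order_tendstoD) auto
    qed
    ultimately have "\<forall>\<^sub>F n in sequentially. (1 + \<beta> (r n)) * Dn (r n) \<le> \<kappa>"
    proof eventually_elim
      case (elim n)
      have "\<beta> (r n) * Dn (r n) \<le> 3 * \<kappa> / 8"
        using gap[OF m(1), of "r n"] m(2)[OF \<zeta>(1)] elim \<delta>(3)[of "r n"] unfolding Dn_def by simp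
      moreover have "1 * Dn (r n) \<le> \<beta> (r n) * Dn (r n)"
        using \<beta> D0 by (intro mult_right_mono) (auto simp: Dn_def)
      ultimately show ?case using \<kappa> by (simp add: distrib_right)
    qed
    then show ?thesis by (auto simp: eventually_sequentially)
  qed
  then obtain n where n: "(1 + \<beta> n) * Dn n \<le> \<kappa>" by blast
  obtain p q X Y where pq: "superjet K u1 (\<xi> n) p X" "superjet K u2 (\<eta> n) q Y"
      "norm (p - \<beta> n *\<^sub>R (x n - y n)) \<le> \<delta> n" "norm (q + \<beta> n *\<^sub>R (x n - y n)) \<le> \<delta> n"
      "\<And>h k. h \<bullet> X h + k \<bullet> Y k \<le> \<beta> n * (norm (h - k))\<^sup>2"
    using Pn[of n] unfolding P_def by blast
  show ?thesis
  proof (rule that[of "\<beta> n" "\<xi> n" p X "\<eta> n" q Y "x n" "y n"])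
    show "0 < \<beta> n" using \<beta>[of n] by simp
    show "u1 z + u2 z \<le> u1 (\<xi> n) + u2 (\<eta> n) + \<kappa>" if "z \<in> K" for z
    proof -
      have "0 \<le> \<beta> n / 2 * D (x n) (y n) (\<xi> n) (\<eta> n)" using \<beta>[of n] D0 by (intro mult_nonneg_nonneg) auto
      then show ?thesis using gap[OF that, of n] \<delta>(2)[of n] by linarith
    qed
    show "(1 + \<beta> n) * ((norm (x n - \<xi> n))\<^sup>2 + (norm (y n - \<eta> n))\<^sup>2 + (norm (x n - y n))\<^sup>2) \<le> \<kappa>"
      using n by (simp add: Dn_def D_def)
    show "norm (p - \<beta> n *\<^sub>R (x n - y n)) \<le> \<kappa>" "norm (q + \<beta> n *\<^sub>R (x n - y n)) \<le> \<kappa>"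
      using pq(3,4) \<delta>(2)[of n] by linarith+
  qed (use pq in auto)
qed

section \<open>Comparison\<close>

lemma symmetric_matrix_inner:
  fixes B :: "real^'n^'n"
  assumes "transpose B = B"
  shows "x \<bullet> (B *v y) = (B *v x) \<bullet> y"
  using dot_lmul_matrix[of x B y] assms by (metis vector_transpose_matrix)

text \<open>Hessians of test functions are symmetric, and symmetrizing leaves the quadratic form
  unchanged. The added multiple of the identity absorbs the error term of the superjet.\<close>

lemma symmetric_matrix_of_quadratic_form:
  fixes X :: "real^'n \<Rightarrow> real^'n"
  assumes "bounded_linear X"
  obtains B where "transpose B = B" "\<And>h. h \<bullet> (B *v h) = h \<bullet> X h + \<epsilon> * (norm h)\<^sup>2"
proof
  define A where "A = matrix X"
  define B where "B = (1/2) *\<^sub>R (A + transpose A) + \<epsilon> *\<^sub>R mat 1"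
  have A: "A *v h = X h" for h
    using assms by (simp add: A_def matrix_works bounded_linear.linear)
  have tA: "h \<bullet> (h v* A) = h \<bullet> X h" for h
    using dot_lmul_matrix[of h A h] A[of h] by (simp add: inner_commute)
  show "transpose B = B"
    by (simp add: B_def transpose_def vec_eq_iff mat_def add.commute)
  show "h \<bullet> (B *v h) = h \<bullet> X h + \<epsilon> * (norm h)\<^sup>2" for h
    by (simp add: B_def matrix_vector_mult_add_rdistrib scaleR_matrix_vector_assoc[symmetric]
        inner_add_right A tA power2_norm_eq_inner)
qed

lemma C2_with_quadratic:
  fixes B :: "real^'n^'n"
  assumes "transpose B = B"
  shows "C2_with (\<lambda>z. p \<bullet> (z - \<xi>) + 1/2 * ((z - \<xi>) \<bullet> (B *v (z - \<xi>)))) (\<lambda>z. p + B *v (z - \<xi>)) (\<lambda>z. B)"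
  unfolding C2_with_def
proof (intro conjI allI)
  fix x
  have B: "((\<lambda>z. B *v (z - \<xi>)) has_derivative (\<lambda>h. B *v h)) (at x)"
    by (rule has_derivative_eq_rhs[OF has_derivative_compose[OF _ bounded_linear_imp_has_derivative[OF matrix_vector_mul_bounded_linear]]])
       (auto intro!: derivative_eq_intros)
  show "((\<lambda>z. p + B *v (z - \<xi>)) has_derivative (\<lambda>h. B *v h)) (at x)"
    by (rule derivative_eq_intros B refl)+ simp
  show "((\<lambda>z. p \<bullet> (z - \<xi>) + 1/2 * ((z - \<xi>) \<bullet> (B *v (z - \<xi>)))) has_derivative
      (\<lambda>h. (p + B *v (x - \<xi>)) \<bullet> h)) (at x)"
  proof -
    have d: "((\<lambda>z. z - \<xi>) has_derivative (\<lambda>h. h)) (at x)" by (auto intro!: derivative_eq_intros)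
    have "(x - \<xi>) \<bullet> (B *v h) = (B *v (x - \<xi>)) \<bullet> h" for h by (rule symmetric_matrix_inner[OF assms])
    then have "(\<lambda>h. p \<bullet> h + 1/2 * ((x - \<xi>) \<bullet> (B *v h) + h \<bullet> (B *v (x - \<xi>)))) = (\<lambda>h. (p + B *v (x - \<xi>)) \<bullet> h)"
      by (simp add: fun_eq_iff inner_add_left inner_commute[of _ "B *v (x - \<xi>)"])
    then show ?thesis
      using has_derivative_add[OF has_derivative_inner_right[OF d, of p] has_derivative_mult_right[OF has_derivative_inner[OF d B], of "1/2"]]
      by simp
  qed
qed (rule continuous_on_const)

lemma uminus_matrix_vector_mult: "(- A) *v x = - (A *v (x :: real^'n))"
  by (simp add: matrix_vector_mult_def vec_eq_iff sum_negf)

lemma C2_with_uminus: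
  assumes "C2_with \<phi> D D2"
  shows "C2_with (\<lambda>z. - \<phi> z) (\<lambda>z. - D z) (\<lambda>z. - D2 z)"
  using assms unfolding C2_with_def
  by (auto intro!: has_derivative_eq_rhs[OF has_derivative_minus] continuous_intros
      simp: uminus_matrix_vector_mult fun_eq_iff)

lemma superjet_quadratic_local_max:
  assumes "superjet S u \<xi> p X" "\<epsilon> > 0" "\<And>h. h \<bullet> (B *v h) = h \<bullet> X h + \<epsilon> * (norm h)\<^sup>2"
  shows "\<forall>\<^sub>F z in at \<xi> within S. u z - (p \<bullet> (z - \<xi>) + 1/2 * ((z - \<xi>) \<bullet> (B *v (z - \<xi>)))) \<le> u \<xi>"
proof -
  \<comment> \<open>The jet is used with error \<open>\<epsilon> / 2\<close>, which is exactly half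
    of the surplus \<epsilon> in the form of \<open>B\<close>.\<close>
  obtain d where d: "d > 0" "\<And>z. z \<in> S \<Longrightarrow> norm (z - \<xi>) < d \<Longrightarrow>
      u z \<le> u \<xi> + p \<bullet> (z - \<xi>) + 1/2 * ((z - \<xi>) \<bullet> X (z - \<xi>)) + (\<epsilon> / 2) * (norm (z - \<xi>))\<^sup>2"
    using assms(1,2) unfolding superjet_def by (meson half_gt_zero)
  have "u z - (p \<bullet> (z - \<xi>) + 1/2 * ((z - \<xi>) \<bullet> (B *v (z - \<xi>)))) \<le> u \<xi>" if "z \<in> S" "norm (z - \<xi>) < d" for z
    using d(2)[OF that] unfolding assms(3) by (simp add: field_simps)
  then show ?thesis unfolding eventually_at using d(1) by (auto simp: dist_norm)
qed

lemma viscosity_subsolution_superjet: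
  assumes "viscosity_subsolution S l H u" "superjet S u \<xi> p X" "\<epsilon> > 0"
    and B: "transpose B = B" "\<And>h. h \<bullet> (B *v h) = h \<bullet> X h + \<epsilon> * (norm h)\<^sup>2"
  shows "l * u \<xi> + H \<xi> p B \<le> 0"
proof -
  have "local_max_on S (\<lambda>z. u z - (p \<bullet> (z - \<xi>) + 1/2 * ((z - \<xi>) \<bullet> (B *v (z - \<xi>))))) \<xi>"
    using superjet_quadratic_local_max[OF assms(2,3) B(2)] assms(2) by (simp add: local_max_on_def superjet_def)
  moreover have "\<xi> \<in> S" using assms(2) by (simp add: superjet_def)
  ultimately have "l * u \<xi> + H \<xi> (p + B *v (\<xi> - \<xi>)) B \<le> 0"
    using assms(1) C2_with_quadratic[OF B(1)] unfolding viscosity_subsolution_def by blast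
  then show ?thesis by simp
qed

lemma viscosity_supersolution_superjet:
  assumes "viscosity_supersolution S l H v" "superjet S (\<lambda>x. - v x) \<eta> q Y" "\<epsilon> > 0"
    and B: "transpose B = B" "\<And>h. h \<bullet> (B *v h) = h \<bullet> Y h + \<epsilon> * (norm h)\<^sup>2"
  shows "0 \<le> l * v \<eta> + H \<eta> (- q) (- B)"
proof -
  let ?\<phi> = "\<lambda>z. q \<bullet> (z - \<eta>) + 1/2 * ((z - \<eta>) \<bullet> (B *v (z - \<eta>)))"
  have "local_min_on S (\<lambda>z. v z - (- ?\<phi> z)) \<eta>"
    unfolding local_min_on_def
  proof
    show "\<eta> \<in> S" using assms(2) by (simp add: superjet_def)
    show "\<forall>\<^sub>F z in at \<eta> within S. v \<eta> - - ?\<phi> \<eta> \<le> v z - - ?\<phi> z"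
      using superjet_quadratic_local_max[OF assms(2,3) B(2)] by eventually_elim (simp add: algebra_simps)
  qed
  moreover have "\<eta> \<in> S" using assms(2) by (simp add: superjet_def)
  ultimately have "0 \<le> l * v \<eta> + H \<eta> (- (q + B *v (\<eta> - \<eta>))) (- B)"
    using assms(1) C2_with_uminus[OF C2_with_quadratic[OF B(1)]] unfolding viscosity_supersolution_def by blast
  then show ?thesis by simp
qed

section \<open>Estimates for the Hamiltonians\<close>

lemma trace_eq_sum_columns:
  fixes S :: "real^'d^'n" and B :: "real^'n^'n"
  shows "trace (S ** transpose S ** B) = (\<Sum>j\<in>UNIV. column j S \<bullet> (B *v column j S))"
proof -
  have "trace (S ** transpose S ** B) = trace (transpose S ** (B ** S))"
    by (metis matrix_mul_assoc trace_mul_sym)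
  also have "\<dots> = (\<Sum>j\<in>UNIV. column j S \<bullet> (B *v column j S))"
    by (simp add: trace_def matrix_matrix_mult_def transpose_def column_def inner_vec_def matrix_vector_mult_def)
  finally show ?thesis .
qed

lemma norm_eq_sum_columns:
  fixes S :: "real^'d^'n"
  shows "(norm S)\<^sup>2 = (\<Sum>j\<in>UNIV. (norm (column j S))\<^sup>2)"
  unfolding power2_norm_eq_inner inner_vec_def column_def
  by (subst sum.swap) (simp add: inner_vec_def)

lemma norm_vector_matrix_mult_le:
  fixes S :: "real^'d^'n"
  shows "norm (p v* S) \<le> norm p * norm S"
proof (rule power2_le_imp_le)
  have "(p v* S) $ j = p \<bullet> column j S" for j
    by (simp add: vector_matrix_mult_def column_def inner_vec_def mult.commute)
  then have "(norm (p v* S))\<^sup>2 = (\<Sum>j\<in>UNIV. (p \<bullet> column j S)\<^sup>2)"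
    unfolding power2_norm_eq_inner inner_vec_def by (simp add: power2_eq_square)
  also have "\<dots> \<le> (\<Sum>j\<in>UNIV. (norm p)\<^sup>2 * (norm (column j S))\<^sup>2)"
    using Cauchy_Schwarz_ineq[of p] by (intro sum_mono) (simp add: power2_norm_eq_inner)
  also have "\<dots> = (norm p * norm S)\<^sup>2"
    by (simp add: norm_eq_sum_columns power_mult_distrib sum_distrib_left)
  finally show "(norm (p v* S))\<^sup>2 \<le> (norm p * norm S)\<^sup>2" .
qed simp

text \<open>A real supremum is informative only over a bounded set. This is used twice: to read off
  an inequality for each control from the subsolution property, and to pick a nearly optimal control
  in the supersolution property.\<close>

lemma hamiltonian_bdd_above:
  fixes b :: "real^'n \<Rightarrow> 'u::metric_space \<Rightarrow> real^'n" and \<sigma> :: "real^'n \<Rightarrow> 'u \<Rightarrow> real^'d^'n"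
  assumes "H1 U b \<sigma>" "H2 U \<psi>"
  shows "bdd_above ((\<lambda>a. (- p) \<bullet> b x a - 1/2 * trace (\<sigma> x a ** transpose (\<sigma> x a) ** A)
               - \<psi> x (p v* \<sigma> x a) a) ` U)"
proof -
  obtain c where c: "c > 0" "\<And>a x. a \<in> U \<Longrightarrow> norm (b x a) + norm (\<sigma> x a) \<le> c * (1 + norm x)"
    using assms(1) unfolding H1_def by blast
  obtain Kx Kz M where \<psi>: "Kz \<ge> 0" "M \<ge> 0"
    "\<And>a x x' z z'. a \<in> U \<Longrightarrow> \<bar>\<psi> x z a - \<psi> x' z' a\<bar> \<le> Kx * norm (x - x') + Kz * norm (z - z')"
    "\<And>a x. a \<in> U \<Longrightarrow> \<bar>\<psi> x 0 a\<bar> \<le> M"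
    using assms(2) unfolding H2_def by blast
  define L where "L = c * (1 + norm x)"
  obtain B where B: "B \<ge> 0" "\<And>h. norm (A *v h) \<le> B * norm h"
    using bounded_linear.nonneg_bounded[OF matrix_vector_mul_bounded_linear[of A]] by (auto simp: mult.commute)
  have "(- p) \<bullet> b x a - 1/2 * trace (\<sigma> x a ** transpose (\<sigma> x a) ** A) - \<psi> x (p v* \<sigma> x a) a
      \<le> norm p * L + 1/2 * (B * L\<^sup>2) + (M + Kz * (norm p * L))" if a: "a \<in> U" for a
  proof -
    have bL: "norm (b x a) \<le> L" "norm (\<sigma> x a) \<le> L"
      using c(2)[OF a, of x] norm_ge_zero[of "b x a"] norm_ge_zero[of "\<sigma> x a"] unfolding L_def by linarith+
    have "(- p) \<bullet> b x a \<le> norm p * norm (b x a)" using norm_cauchy_schwarz[of "-p" "b x a"] by simp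
    also have "\<dots> \<le> norm p * L" using bL by (intro mult_left_mono) auto
    finally have 1: "(- p) \<bullet> b x a \<le> norm p * L" .
    have "- trace (\<sigma> x a ** transpose (\<sigma> x a) ** A) = (\<Sum>j\<in>UNIV. - (column j (\<sigma> x a) \<bullet> (A *v column j (\<sigma> x a))))"
      by (simp add: trace_eq_sum_columns sum_negf)
    also have "\<dots> \<le> (\<Sum>j\<in>UNIV. B * (norm (column j (\<sigma> x a)))\<^sup>2)"
    proof (rule sum_mono)
      fix j
      let ?s = "column j (\<sigma> x a)"
      have "- (?s \<bullet> (A *v ?s)) \<le> norm ?s * norm (A *v ?s)" using norm_cauchy_schwarz[of "- ?s" "A *v ?s"] by simp
      also have "\<dots> \<le> norm ?s * (B * norm ?s)" using B(2) by (intro mult_left_mono) auto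
      finally show "- (?s \<bullet> (A *v ?s)) \<le> B * (norm ?s)\<^sup>2" by (simp add: power2_eq_square mult_ac)
    qed
    also have "\<dots> = B * (norm (\<sigma> x a))\<^sup>2" by (simp add: norm_eq_sum_columns sum_distrib_left)
    also have "\<dots> \<le> B * L\<^sup>2" using bL B(1) by (intro mult_left_mono power_mono) auto
    finally have 2: "- trace (\<sigma> x a ** transpose (\<sigma> x a) ** A) \<le> B * L\<^sup>2" .
    have "norm (p v* \<sigma> x a) \<le> norm p * L"
      using norm_vector_matrix_mult_le[of p "\<sigma> x a"] mult_left_mono[OF bL(2) norm_ge_zero[of p]] by linarith
    then have "Kz * norm (p v* \<sigma> x a) \<le> Kz * (norm p * L)" using \<psi>(1) by (rule mult_left_mono)
    then have 3: "- \<psi> x (p v* \<sigma> x a) a \<le> M + Kz * (norm p * L)"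
      using \<psi>(3)[OF a, of x "p v* \<sigma> x a" x 0] \<psi>(4)[OF a, of x] by simp
    show ?thesis using 1 2 3 by linarith
  qed
  then show ?thesis by (intro bdd_aboveI2) blast
qed

text \<open>A control nearly optimal for the second Hamiltonian at \<eta> is inserted in the first
  one at \<xi>, which removes both suprema. The drivers are compared at identical arguments, at cost
  \<open>m\<close>, and then \<open>\<psi>\<^sub>2\<close> is moved from \<xi> to \<eta> by its
  Lipschitz bound.\<close>

theorem comparison:
  fixes b :: "real^'n \<Rightarrow> 'u::metric_space \<Rightarrow> real^'n" and \<sigma> :: "real^'n \<Rightarrow> 'u \<Rightarrow> real^'d^'n"
  assumes U: "U \<noteq> {}" and h1: "H1 U b \<sigma>" and \<psi>1: "H2 U \<psi>\<^sub>1" and \<psi>2: "H2 U \<psi>\<^sub>2"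
    and K: "compact K" and l: "l > 0"
    and sub: "viscosity_subsolution K l (hamiltonian U b \<sigma> \<psi>\<^sub>1) u"
    and super: "viscosity_supersolution K l (hamiltonian U b \<sigma> \<psi>\<^sub>2) v"
    and m: "\<And>a y z. a \<in> U \<Longrightarrow> y \<in> K \<Longrightarrow> \<bar>\<psi>\<^sub>1 y z a - \<psi>\<^sub>2 y z a\<bar> \<le> m"
    and z: "z \<in> K"
  shows "l * (u z - v z) \<le> m"
proof -
  obtain c where c: "c > 0"
    and lip: "\<And>a x x'. a \<in> U \<Longrightarrow> norm (b x a - b x' a) + norm (\<sigma> x a - \<sigma> x' a) \<le> c * norm (x - x')"
    and growth: "\<And>a x. a \<in> U \<Longrightarrow> norm (b x a) + norm (\<sigma> x a) \<le> c * (1 + norm x)"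
    using h1 unfolding H1_def by blast
  obtain Kx Kz where K0: "Kx \<ge> 0" "Kz \<ge> 0" and
    lip2: "\<And>a x x' z z'. a \<in> U \<Longrightarrow> \<bar>\<psi>\<^sub>2 x z a - \<psi>\<^sub>2 x' z' a\<bar> \<le> Kx * norm (x - x') + Kz * norm (z - z')"
    using \<psi>2 unfolding H2_def by blast
  obtain R where R: "R > 0" "\<And>x. x \<in> K \<Longrightarrow> norm x \<le> R"
    using compact_imp_bounded[OF K] unfolding bounded_pos by blast
  define L where "L = c * (1 + R)"
  have L: "L > 0" using c R by (simp add: L_def)
  have bL: "norm (b x a) \<le> L" "norm (\<sigma> x a) \<le> L" if "a \<in> U" "x \<in> K" for a x
  proof -
    have "c * (1 + norm x) \<le> L" unfolding L_def using R(2)[OF that(2)] c by (intro mult_left_mono) auto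
    then show "norm (b x a) \<le> L" "norm (\<sigma> x a) \<le> L"
      using growth[OF that(1), of x] norm_ge_zero[of "b x a"] norm_ge_zero[of "\<sigma> x a"] by linarith+
  qed
  \<comment> \<open>The coefficients of all errors below: drift, half of the diffusion bound,
    near-optimality of the control, the two Lipschitz terms of \<open>\<psi>\<^sub>2\<close>, and
    near-maximality of the doubled points.\<close>
  define Q where "Q = 2 * c + 2 * L + 3/2 * c\<^sup>2 + L\<^sup>2 + 1 + Kz * (2 * c + 2 * L) + 2 * Kx + l"
  have est: "l * (u z - v z) \<le> m + s * Q" if s: "0 < s" "s \<le> 1" for s
  proof -
    have usc: "usc_on K u" "usc_on K (\<lambda>x. - v x)"
      using sub super by (simp_all add: viscosity_subsolution_def viscosity_supersolution_def usc_on_uminus)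
    \<comment> \<open>Distances are controlled only through their squares, by \<kappa>; with
      \<open>\<kappa> = s^2\<close> every error is at most linear in \<open>s\<close>.\<close>
    define \<kappa> where "\<kappa> = s\<^sup>2"
    have \<kappa>: "\<kappa> > 0" "\<kappa> \<le> s" using s by (auto simp: \<kappa>_def power2_eq_square mult_left_le)
    have "K \<noteq> {}" using z by auto
    obtain \<beta> x y \<xi> \<eta> p q X Y where \<beta>: "0 < \<beta>" and jets: "superjet K u \<xi> p X" "superjet K (\<lambda>x. - v x) \<eta> q Y"
      and near: "\<And>z. z \<in> K \<Longrightarrow> u z + - v z \<le> u \<xi> + - v \<eta> + \<kappa>"
      and pen: "(1 + \<beta>) * ((norm (x - \<xi>))\<^sup>2 + (norm (y - \<eta>))\<^sup>2 + (norm (x - y))\<^sup>2) \<le> \<kappa>"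
      and pq: "norm (p - \<beta> *\<^sub>R (x - y)) \<le> \<kappa>" "norm (q + \<beta> *\<^sub>R (x - y)) \<le> \<kappa>"
      and XY: "\<And>h k. h \<bullet> X h + k \<bullet> Y k \<le> \<beta> * (norm (h - k))\<^sup>2"
      using theorem_on_sums_penalized[OF K \<open>K \<noteq> {}\<close> usc \<kappa>(1)] by metis
    have in_K: "\<xi> \<in> K" "\<eta> \<in> K" using jets by (auto simp: superjet_def)
    define D where "D = (norm (x - \<xi>))\<^sup>2 + (norm (y - \<eta>))\<^sup>2 + (norm (x - y))\<^sup>2"
    have D: "0 \<le> D" "D \<le> \<kappa>" "\<beta> * D \<le> \<kappa>"
    proof -
      show D0: "0 \<le> D" by (simp add: D_def)
      then have "0 \<le> \<beta> * D" using \<beta> by simp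
      then show "D \<le> \<kappa>" "\<beta> * D \<le> \<kappa>" using pen D0 by (simp_all add: D_def[symmetric] distrib_right)
    qed
    define r where "r = norm (\<xi> - \<eta>)"
    define t where "t = norm (x - y)"
    have r2: "r\<^sup>2 \<le> 3 * D" unfolding r_def D_def by (rule norm_diff_sq_le)
    have t2: "t\<^sup>2 \<le> D" by (simp add: t_def D_def)
    have "(2 * s)\<^sup>2 = 4 * \<kappa>" by (simp add: \<kappa>_def power_mult_distrib)
    then have "r\<^sup>2 \<le> (2 * s)\<^sup>2" using r2 D(2) \<kappa>(1) by linarith
    then have rs: "r \<le> 2 * s" by (rule power2_le_imp_le) (use s in simp)
    have \<beta>r: "\<beta> * r\<^sup>2 \<le> 3 * \<kappa>"
    proof -
      have "\<beta> * r\<^sup>2 \<le> \<beta> * (3 * D)" using r2 \<beta> by (intro mult_left_mono) auto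
      then show ?thesis using D(3) by linarith
    qed
    have \<beta>tr: "\<beta> * (t * r) \<le> 2 * \<kappa>"
    proof -
      have "t * r \<le> (t\<^sup>2 + r\<^sup>2) / 2" using zero_le_power2[of "t - r"] by (simp add: power2_eq_square algebra_simps)
      also have "\<dots> \<le> 2 * D" using r2 t2 by simp
      finally have "\<beta> * (t * r) \<le> \<beta> * (2 * D)" using \<beta> by (intro mult_left_mono) auto
      then show ?thesis using D(3) by linarith
    qed
    obtain B where B: "transpose B = B" "\<And>h. h \<bullet> (B *v h) = h \<bullet> X h + \<kappa> * (norm h)\<^sup>2"
      using symmetric_matrix_of_quadratic_form jets(1) unfolding superjet_def by metis
    obtain B' where B': "transpose B' = B'" "\<And>h. h \<bullet> (B' *v h) = h \<bullet> Y h + \<kappa> * (norm h)\<^sup>2"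
      using symmetric_matrix_of_quadratic_form jets(2) unfolding superjet_def by metis
    have "l * u \<xi> + hamiltonian U b \<sigma> \<psi>\<^sub>1 \<xi> p B \<le> 0"
      by (rule viscosity_subsolution_superjet[OF sub jets(1) \<kappa>(1) B])
    then have lo: "(- p) \<bullet> b \<xi> a - 1/2 * trace (\<sigma> \<xi> a ** transpose (\<sigma> \<xi> a) ** B) - \<psi>\<^sub>1 \<xi> (p v* \<sigma> \<xi> a) a \<le> - (l * u \<xi>)"
      if "a \<in> U" for a
      using cSUP_upper[OF that hamiltonian_bdd_above[OF h1 \<psi>1, of p \<xi> B]] by (simp add: hamiltonian_def)
    have "0 \<le> l * v \<eta> + hamiltonian U b \<sigma> \<psi>\<^sub>2 \<eta> (- q) (- B')"
      by (rule viscosity_supersolution_superjet[OF super jets(2) \<kappa>(1) B'])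
    then have "- (l * v \<eta>) - \<kappa> < hamiltonian U b \<sigma> \<psi>\<^sub>2 \<eta> (- q) (- B')" using \<kappa>(1) by linarith
    then obtain a where a: "a \<in> U" and hi: "- (l * v \<eta>) - \<kappa> <
        (- (- q)) \<bullet> b \<eta> a - 1/2 * trace (\<sigma> \<eta> a ** transpose (\<sigma> \<eta> a) ** (- B')) - \<psi>\<^sub>2 \<eta> ((- q) v* \<sigma> \<eta> a) a"
      unfolding hamiltonian_def less_cSUP_iff[OF U hamiltonian_bdd_above[OF h1 \<psi>2]] by blast
    let ?s = "\<lambda>j. column j (\<sigma> \<xi> a)" and ?s' = "\<lambda>j. column j (\<sigma> \<eta> a)"
    have lip': "norm (b \<xi> a - b \<eta> a) \<le> c * r" "norm (\<sigma> \<xi> a - \<sigma> \<eta> a) \<le> c * r"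
      using lip[OF a, of \<xi> \<eta>] norm_ge_zero[of "b \<xi> a - b \<eta> a"] norm_ge_zero[of "\<sigma> \<xi> a - \<sigma> \<eta> a"]
      unfolding r_def by linarith+
    \<comment> \<open>Up to sign both slopes share the large part \<beta> (x - y), which therefore
      multiplies only differences of coefficients; the coefficients themselves meet the small
      remainders \<open>e1\<close> and \<open>e2\<close>.\<close>
    define e1 e2 where "e1 = p - \<beta> *\<^sub>R (x - y)" and "e2 = q + \<beta> *\<^sub>R (x - y)"
    have p_eq: "p = \<beta> *\<^sub>R (x - y) + e1" and q_eq: "q = e2 - \<beta> *\<^sub>R (x - y)" by (auto simp: e1_def e2_def)
    have drift: "p \<bullet> b \<xi> a + q \<bullet> b \<eta> a \<le> \<kappa> * (2 * c + 2 * L)"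
    proof -
      have "p \<bullet> b \<xi> a + q \<bullet> b \<eta> a = \<beta> * ((x - y) \<bullet> (b \<xi> a - b \<eta> a)) + e1 \<bullet> b \<xi> a + e2 \<bullet> b \<eta> a"
        unfolding p_eq q_eq by (simp add: inner_add_left inner_diff_left inner_diff_right algebra_simps)
      moreover have "(x - y) \<bullet> (b \<xi> a - b \<eta> a) \<le> t * (c * r)"
        using norm_cauchy_schwarz[of "x - y" "b \<xi> a - b \<eta> a"] mult_left_mono[OF lip'(1), of t] by (simp add: t_def)
      then have "\<beta> * ((x - y) \<bullet> (b \<xi> a - b \<eta> a)) \<le> c * (\<beta> * (t * r))"
        using mult_left_mono[of _ "t * (c * r)" \<beta>] \<beta> by (simp add: mult_ac)
      moreover have "c * (\<beta> * (t * r)) \<le> c * (2 * \<kappa>)" using \<beta>tr c by (intro mult_left_mono) auto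
      moreover have "e1 \<bullet> b \<xi> a \<le> \<kappa> * L"
        using norm_cauchy_schwarz[of e1 "b \<xi> a"] mult_mono[OF pq(1)[folded e1_def] bL(1)[OF a in_K(1)]] \<kappa>(1) by simp
      moreover have "e2 \<bullet> b \<eta> a \<le> \<kappa> * L"
        using norm_cauchy_schwarz[of e2 "b \<eta> a"] mult_mono[OF pq(2)[folded e2_def] bL(1)[OF a in_K(2)]] \<kappa>(1) by simp
      ultimately show ?thesis by (simp add: algebra_simps)
    qed
    have diffusion: "trace (\<sigma> \<xi> a ** transpose (\<sigma> \<xi> a) ** B) + trace (\<sigma> \<eta> a ** transpose (\<sigma> \<eta> a) ** B')
        \<le> \<kappa> * (3 * c\<^sup>2 + 2 * L\<^sup>2)"
    proof -
      have "trace (\<sigma> \<xi> a ** transpose (\<sigma> \<xi> a) ** B) + trace (\<sigma> \<eta> a ** transpose (\<sigma> \<eta> a) ** B')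
          = (\<Sum>j\<in>UNIV. (?s j \<bullet> X (?s j) + ?s' j \<bullet> Y (?s' j)) + \<kappa> * (norm (?s j))\<^sup>2 + \<kappa> * (norm (?s' j))\<^sup>2)"
        by (simp add: trace_eq_sum_columns B(2) B'(2) sum.distrib)
      also have "\<dots> \<le> (\<Sum>j\<in>UNIV. \<beta> * (norm (column j (\<sigma> \<xi> a - \<sigma> \<eta> a)))\<^sup>2 + \<kappa> * (norm (?s j))\<^sup>2 + \<kappa> * (norm (?s' j))\<^sup>2)"
      proof (intro sum_mono add_right_mono)
        fix j
        have "column j (\<sigma> \<xi> a - \<sigma> \<eta> a) = ?s j - ?s' j" by (simp add: column_def vec_eq_iff)
        then show "?s j \<bullet> X (?s j) + ?s' j \<bullet> Y (?s' j) \<le> \<beta> * (norm (column j (\<sigma> \<xi> a - \<sigma> \<eta> a)))\<^sup>2"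
          using XY[of "?s j" "?s' j"] by simp
      qed
      also have "\<dots> = \<beta> * (norm (\<sigma> \<xi> a - \<sigma> \<eta> a))\<^sup>2 + \<kappa> * (norm (\<sigma> \<xi> a))\<^sup>2 + \<kappa> * (norm (\<sigma> \<eta> a))\<^sup>2"
        by (simp add: norm_eq_sum_columns sum.distrib sum_distrib_left)
      also have "\<dots> \<le> \<beta> * (c * r)\<^sup>2 + \<kappa> * L\<^sup>2 + \<kappa> * L\<^sup>2"
        using lip'(2) bL(2)[OF a in_K(1)] bL(2)[OF a in_K(2)] \<beta> \<kappa>(1)
        by (intro add_mono mult_left_mono power_mono) auto
      also have "\<beta> * (c * r)\<^sup>2 = c\<^sup>2 * (\<beta> * r\<^sup>2)" by (simp add: power_mult_distrib mult_ac)
      also have "\<dots> \<le> c\<^sup>2 * (3 * \<kappa>)" using \<beta>r by (intro mult_left_mono) auto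
      finally show ?thesis by (simp add: algebra_simps)
    qed
    have driver: "\<psi>\<^sub>1 \<xi> (p v* \<sigma> \<xi> a) a - \<psi>\<^sub>2 \<eta> ((- q) v* \<sigma> \<eta> a) a \<le> m + 2 * Kx * s + Kz * (\<kappa> * (2 * c + 2 * L))"
    proof -
      have eq: "p v* \<sigma> \<xi> a - (- q) v* \<sigma> \<eta> a
          = (\<beta> *\<^sub>R (x - y)) v* (\<sigma> \<xi> a - \<sigma> \<eta> a) + e1 v* \<sigma> \<xi> a + e2 v* \<sigma> \<eta> a"
        unfolding p_eq q_eq by (simp add: vec_eq_iff vector_matrix_mult_def sum.distrib sum_subtractf sum_negf algebra_simps)
      have "norm ((\<beta> *\<^sub>R (x - y)) v* (\<sigma> \<xi> a - \<sigma> \<eta> a)) \<le> (\<beta> * t) * (c * r)"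
      proof (rule order_trans[OF norm_vector_matrix_mult_le])
        have "norm (\<beta> *\<^sub>R (x - y)) = \<beta> * t" using \<beta> by (simp add: t_def)
        then show "norm (\<beta> *\<^sub>R (x - y)) * norm (\<sigma> \<xi> a - \<sigma> \<eta> a) \<le> (\<beta> * t) * (c * r)"
          using lip'(2) by (metis mult_left_mono norm_ge_zero)
      qed
      also have "\<dots> = c * (\<beta> * (t * r))" by (simp add: mult_ac)
      also have "\<dots> \<le> c * (2 * \<kappa>)" using \<beta>tr c by (intro mult_left_mono) auto
      finally have 1: "norm ((\<beta> *\<^sub>R (x - y)) v* (\<sigma> \<xi> a - \<sigma> \<eta> a)) \<le> c * (2 * \<kappa>)" .
      have 2: "norm (e1 v* \<sigma> \<xi> a) \<le> \<kappa> * L"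
        using norm_vector_matrix_mult_le[of e1 "\<sigma> \<xi> a"] mult_mono[OF pq(1)[folded e1_def] bL(2)[OF a in_K(1)]] \<kappa>(1) by simp
      have 3: "norm (e2 v* \<sigma> \<eta> a) \<le> \<kappa> * L"
        using norm_vector_matrix_mult_le[of e2 "\<sigma> \<eta> a"] mult_mono[OF pq(2)[folded e2_def] bL(2)[OF a in_K(2)]] \<kappa>(1) by simp
      have "norm (p v* \<sigma> \<xi> a - (- q) v* \<sigma> \<eta> a) \<le> c * (2 * \<kappa>) + \<kappa> * L + \<kappa> * L"
        unfolding eq by (intro norm_triangle_le add_mono 1 2 3)
      then have "Kz * norm (p v* \<sigma> \<xi> a - (- q) v* \<sigma> \<eta> a) \<le> Kz * (c * (2 * \<kappa>) + \<kappa> * L + \<kappa> * L)"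
        using K0 by (intro mult_left_mono) auto
      also have "\<dots> = Kz * (\<kappa> * (2 * c + 2 * L))" by (simp add: algebra_simps)
      finally have 4: "Kz * norm (p v* \<sigma> \<xi> a - (- q) v* \<sigma> \<eta> a) \<le> Kz * (\<kappa> * (2 * c + 2 * L))" .
      have "Kx * r \<le> Kx * (2 * s)" using rs K0 by (intro mult_left_mono) auto
      then show ?thesis
        using lip2[OF a, of \<xi> "p v* \<sigma> \<xi> a" \<eta> "(- q) v* \<sigma> \<eta> a"] m[OF a in_K(1), of "p v* \<sigma> \<xi> a"] 4
        unfolding r_def by linarith
    qed
    have tr: "trace (\<sigma> \<eta> a ** transpose (\<sigma> \<eta> a) ** (- B')) = - trace (\<sigma> \<eta> a ** transpose (\<sigma> \<eta> a) ** B')"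
      by (simp add: trace_eq_sum_columns uminus_matrix_vector_mult sum_negf)
    have "l * u \<xi> - l * v \<eta> \<le> \<kappa> + (p \<bullet> b \<xi> a + q \<bullet> b \<eta> a)
        + 1/2 * (trace (\<sigma> \<xi> a ** transpose (\<sigma> \<xi> a) ** B) + trace (\<sigma> \<eta> a ** transpose (\<sigma> \<eta> a) ** B'))
        + (\<psi>\<^sub>1 \<xi> (p v* \<sigma> \<xi> a) a - \<psi>\<^sub>2 \<eta> ((- q) v* \<sigma> \<eta> a) a)"
      using lo[OF a] hi unfolding tr by (simp add: field_simps)
    also have "\<dots> \<le> \<kappa> + \<kappa> * (2 * c + 2 * L) + 1/2 * (\<kappa> * (3 * c\<^sup>2 + 2 * L\<^sup>2)) + (m + 2 * Kx * s + Kz * (\<kappa> * (2 * c + 2 * L)))"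
      by (intro add_mono mult_left_mono drift diffusion driver order_refl) auto
    finally have main: "l * u \<xi> - l * v \<eta> \<le> \<kappa> + \<kappa> * (2 * c + 2 * L) + 1/2 * (\<kappa> * (3 * c\<^sup>2 + 2 * L\<^sup>2)) + (m + 2 * Kx * s + Kz * (\<kappa> * (2 * c + 2 * L)))" .
    have "l * (u z - v z) \<le> l * (u \<xi> - v \<eta> + \<kappa>)" using near[OF z] l by (intro mult_left_mono) auto
    then have "l * (u z - v z) \<le> m + 2 * Kx * s
        + \<kappa> * (2 * c + 2 * L + 3/2 * c\<^sup>2 + L\<^sup>2 + 1 + Kz * (2 * c + 2 * L) + l)"
      using main by (simp add: algebra_simps)
    also have "\<dots> \<le> m + 2 * Kx * s + s * (2 * c + 2 * L + 3/2 * c\<^sup>2 + L\<^sup>2 + 1 + Kz * (2 * c + 2 * L) + l)"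
      using \<kappa>(2) c L K0 l by (intro add_left_mono mult_right_mono) (auto intro!: add_nonneg_nonneg mult_nonneg_nonneg)
    also have "\<dots> = m + s * Q" by (simp add: Q_def algebra_simps)
    finally show ?thesis .
  qed
  have Q: "Q \<ge> 0" using c L K0 l unfolding Q_def by (intro add_nonneg_nonneg mult_nonneg_nonneg) auto
  show ?thesis
  proof (rule field_le_epsilon)
    fix e :: real assume "e > 0"
    define s where "s = min 1 (e / (Q + 1))"
    have s: "0 < s" "s \<le> 1" using \<open>e > 0\<close> Q by (auto simp: s_def)
    have "s \<le> e / (Q + 1)" by (simp add: s_def)
    then have "s * (Q + 1) \<le> e" using Q by (simp add: pos_le_divide_eq)
    then have "s * Q \<le> e" using s by (simp add: distrib_left)
    then show "l * (u z - v z) \<le> m + e" using est[OF s] by simp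
  qed
qed

theorem proposition4p3:
  fixes U :: "'u::metric_space set"
    and M :: "'w measure" and W :: "real \<Rightarrow> 'w \<Rightarrow> real^'d"
    and b :: "real^'n \<Rightarrow> 'u \<Rightarrow> real^'n" and \<sigma> :: "real^'n \<Rightarrow> 'u \<Rightarrow> real^'d^'n"
    and \<psi>\<^sub>1 \<psi>\<^sub>2 :: "real^'n \<Rightarrow> real^'d \<Rightarrow> 'u \<Rightarrow> real"
    and \<theta> :: "(real^'n) set" and l :: real and u v :: "real^'n \<Rightarrow> real"
  assumes "compact U" and "U \<noteq> {}"
    and "brownian_motion M W"
    and "H1 U b \<sigma>"
    and "H2 U \<psi>\<^sub>1" and "H2 U \<psi>\<^sub>2"
    and "\<theta> \<noteq> {}" and "open \<theta>" and "compact (closure \<theta>)"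
    and "invariant_set M W U b \<sigma> (closure \<theta>)"
    and "l > 0"
    and "viscosity_subsolution (closure \<theta>) l (hamiltonian U b \<sigma> \<psi>\<^sub>1) u"
    and "viscosity_supersolution (closure \<theta>) l (hamiltonian U b \<sigma> \<psi>\<^sub>2) v"
  shows "\<forall>x\<in>closure \<theta>.
    ereal (l * (u x - v x)) \<le>
      (SUP (a, y, z) \<in> U \<times> closure \<theta> \<times> UNIV. ereal \<bar>\<psi>\<^sub>1 y z a - \<psi>\<^sub>2 y z a\<bar>)"
proof
  fix x assume x: "x \<in> closure \<theta>"
  let ?S = "SUP (a, y, z) \<in> U \<times> closure \<theta> \<times> UNIV. ereal \<bar>\<psi>\<^sub>1 y z a - \<psi>\<^sub>2 y z a\<bar>"
  have le: "ereal \<bar>\<psi>\<^sub>1 y z a - \<psi>\<^sub>2 y z a\<bar> \<le> ?S" if "a \<in> U" "y \<in> closure \<theta>" for a y z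
    using that by (intro SUP_upper2[of "(a, y, z)"]) auto
  show "ereal (l * (u x - v x)) \<le> ?S"
  \<comment> \<open>The drivers may differ by an amount that grows linearly in \<open>z\<close>, so
    the supremum can be infinite, and then the claim is trivial. It is not minus infinity, as
    \<open>U\<close> contains a control.\<close>
  proof (cases ?S)
    case (real m)
    have "l * (u x - v x) \<le> m"
      using le unfolding real by (intro comparison[OF assms(2,4-6,9,11-13) _ x]) auto
    then show ?thesis unfolding real by simp
  next
    case PInf
    then show ?thesis by simp
  next
    case MInf
    obtain a where "a \<in> U" using \<open>U \<noteq> {}\<close> by blast
    then show ?thesis using le[of a x 0] x MInf by simp
  qed
qed

end
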